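(* Let $R_0$ be a commutative Noetherian domain, let $S=R_0[U_1,\dots,U_s]$ be graded by $\deg U_i=d_i>0$ and elements of $R_0$ having degree $0$, let $I\subset S$ be a homogeneous ideal, and let $R=S/I$. Then the $R$-module $H^s_{R_+}(R)$ has finitely many minimal associated primes, and these are precisely the minimal primes of the ideal $\mathrm{c}(I)R+R_+$ of $R$.
   Context: Here $s\ge 1$, $U_1,\dots,U_s$ are indeterminates of positive integer degrees $d_1,\dots,d_s$, and $R_+$ is the ideal of $R$ generated by the images of $U_1,\dots,U_s$. $H^s_{R_+}(R)$ is the $s$-th local cohomology module of $R$ with respect to $R_+$. A minimal associated prime of a module is a minimal element (with respect to inclusion) of its set of associated primes. For $f=\sum_{\lambda} a_\lambda U^\lambda\in S$ (with $a_\lambda\in R_0$), the content $\mathrm{c}(f)$ is the ideal of $R_0$ generated by all the coefficients $a_\lambda$. For an ideal $J\subset S$, the content $\mathrm{c}(J)$ is the ideal of $R_0$ generated by the contents of all elements of $J$. (If $\mathrm{c}(I)R+R_+=R$, it has no minimal primes.) *)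

theory Defs
  imports "HOL-Algebra.Algebra" "HOL-Algebra.Algebraic_Closure_Type"
    "HOL-Library.Poly_Mapping" "HOL-Library.Cardinality"
begin

section \<open>Prime ideals and modules\<close>

definition minimal_primes :: "('r, 'x) ring_scheme \<Rightarrow> 'r set \<Rightarrow> 'r set set" where
  "minimal_primes R J = {P. primeideal P R \<and> J \<subseteq> P \<and>
     (\<forall>Q. primeideal Q R \<and> J \<subseteq> Q \<and> Q \<subseteq> P \<longrightarrow> Q = P)}"

definition associated_primes ::
    "('r, 'x) ring_scheme \<Rightarrow> ('r, 'm, 'y) module_scheme \<Rightarrow> 'r set set" where
  "associated_primes R M = {P. primeideal P R \<and>
     (\<exists>x \<in> carrier M. P = {r \<in> carrier R. r \<odot>\<^bsub>M\<^esub> x = \<zero>\<^bsub>M\<^esub>})}"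

definition minimal_associated_primes ::
    "('r, 'x) ring_scheme \<Rightarrow> ('r, 'm, 'y) module_scheme \<Rightarrow> 'r set set" where
  "minimal_associated_primes R M =
     {P \<in> associated_primes R M. \<forall>Q \<in> associated_primes R M. Q \<subseteq> P \<longrightarrow> Q = P}"

definition regular_module :: "('r, 'x) ring_scheme \<Rightarrow> ('r, 'r) module" where
  "regular_module R = \<lparr>carrier = carrier R, monoid.mult = monoid.mult R, one = \<one>\<^bsub>R\<^esub>,
     ring.zero = \<zero>\<^bsub>R\<^esub>, add = add R, module.smult = monoid.mult R\<rparr>"

definition module_hom ::
    "('r, 'x) ring_scheme \<Rightarrow> ('r, 'm, 'y) module_scheme \<Rightarrow> ('r, 'n, 'z) module_scheme
      \<Rightarrow> ('m \<Rightarrow> 'n) set" where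
  "module_hom R M N = {h \<in> carrier M \<rightarrow> carrier N.
     (\<forall>x \<in> carrier M. \<forall>y \<in> carrier M. h (x \<oplus>\<^bsub>M\<^esub> y) = h x \<oplus>\<^bsub>N\<^esub> h y) \<and>
     (\<forall>r \<in> carrier R. \<forall>x \<in> carrier M. h (r \<odot>\<^bsub>M\<^esub> x) = r \<odot>\<^bsub>N\<^esub> h x)}"

text \<open>The fields \<open>mult\<close> and \<open>one\<close>, which module records inherit from ring records,
  play no role in the locale \<^locale>\<open>module\<close>.\<close>

definition quotient_module ::
    "('r, 'm, 'y) module_scheme \<Rightarrow> 'm set \<Rightarrow> ('r, 'm set) module" where
  "quotient_module M N = \<lparr>carrier = a_rcosets\<^bsub>M\<^esub> N, monoid.mult = undefined, one = undefined,
     ring.zero = N, add = set_add M, module.smult = (\<lambda>r C. \<Union>x\<in>C. N +>\<^bsub>M\<^esub> (r \<odot>\<^bsub>M\<^esub> x))\<rparr>"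


section \<open>Local cohomology\<close>

text \<open>HOL cannot quantify over all types inside a definition, so the test modules \<open>A\<close>, \<open>B\<close>
  below have their elements in the type of the elements of \<open>R\<close>. Since \<open>R\<close> itself and all its
  ideals are among them, Baer's criterion shows that this is injectivity with respect to
  arbitrary \<open>R\<close>-modules.\<close>

definition injective_module :: "('r, 'x) ring_scheme \<Rightarrow> ('r, 'm) module \<Rightarrow> bool" where
  "injective_module R E \<longleftrightarrow> module R E \<and>
     (\<forall>(A :: ('r, 'r) module) (B :: ('r, 'r) module) f g.
        module R A \<and> module R B \<and> f \<in> module_hom R A B \<and> inj_on f (carrier A) \<and>
        g \<in> module_hom R A E \<longrightarrow>
        (\<exists>h \<in> module_hom R B E. \<forall>x \<in> carrier A. h (f x) = g x))"

text \<open>Exactness of \<open>0 \<rightarrow> M \<rightarrow> E 0 \<rightarrow> E 1 \<rightarrow> \<dots>\<close> with augmentation \<open>\<epsilon>\<close> and differentials \<open>d i\<close>.\<close>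

definition injective_resolution ::
    "('r, 'x) ring_scheme \<Rightarrow> ('r, 'n) module \<Rightarrow> ('n \<Rightarrow> 'm)
      \<Rightarrow> (nat \<Rightarrow> ('r, 'm) module) \<Rightarrow> (nat \<Rightarrow> 'm \<Rightarrow> 'm) \<Rightarrow> bool" where
  "injective_resolution R M \<epsilon> E d \<longleftrightarrow> module R M \<and>
     (\<forall>i. injective_module R (E i)) \<and>
     \<epsilon> \<in> module_hom R M (E 0) \<and> inj_on \<epsilon> (carrier M) \<and>
     (\<forall>i. d i \<in> module_hom R (E i) (E (Suc i))) \<and>
     \<epsilon> ` carrier M = {x \<in> carrier (E 0). d 0 x = \<zero>\<^bsub>E 1\<^esub>} \<and>
     (\<forall>i. d i ` carrier (E i) =
        {x \<in> carrier (E (Suc i)). d (Suc i) x = \<zero>\<^bsub>E (Suc (Suc i))\<^esub>})"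

definition cohomology ::
    "(nat \<Rightarrow> ('r, 'm) module) \<Rightarrow> (nat \<Rightarrow> 'm \<Rightarrow> 'm) \<Rightarrow> nat \<Rightarrow> ('r, 'm set) module" where
  "cohomology C d i = quotient_module
     ((C i)\<lparr>carrier := {x \<in> carrier (C i). d i x = \<zero>\<^bsub>C (Suc i)\<^esub>}\<rparr>)
     (case i of 0 \<Rightarrow> {\<zero>\<^bsub>C 0\<^esub>} | Suc j \<Rightarrow> d j ` carrier (C j))"

text \<open>The \<open>J\<close>-torsion submodule: the elements annihilated by some power of the ideal \<open>J\<close>. Powers
  of ideals are taken in the semiring \<^const>\<open>ideals_set\<close>, whose multiplication is the product of
  ideals.\<close>

definition torsion_module ::
    "('r, 'x) ring_scheme \<Rightarrow> 'r set \<Rightarrow> ('r, 'm) module \<Rightarrow> ('r, 'm) module" where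
  "torsion_module R J M = M\<lparr>carrier := {x \<in> carrier M. \<exists>n::nat.
     \<forall>a \<in> J [^]\<^bsub>ideals_set R\<^esub> n. a \<odot>\<^bsub>M\<^esub> x = \<zero>\<^bsub>M\<^esub>}\<rparr>"

text \<open>The \<open>i\<close>-th right derived functor of the \<open>J\<close>-torsion functor, computed by means of an injective
  resolution \<open>E\<close>, \<open>d\<close> of the module in question. As with any derived functor, the result depends on
  the resolution only up to isomorphism.\<close>

definition local_cohomology ::
    "('r, 'x) ring_scheme \<Rightarrow> 'r set \<Rightarrow> (nat \<Rightarrow> ('r, 'm) module) \<Rightarrow> (nat \<Rightarrow> 'm \<Rightarrow> 'm)
      \<Rightarrow> nat \<Rightarrow> ('r, 'm set) module" where
  "local_cohomology R J E d i = cohomology (\<lambda>k. torsion_module R J (E k)) d i"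


section \<open>Polynomial rings and contents\<close>

text \<open>Polynomials over \<open>'a\<close> in indeterminates indexed by \<open>'v\<close>; multiplication of
  \<^type>\<open>poly_mapping\<close> is convolution, exponent vectors being added.\<close>

type_synonym ('v, 'a) mpoly = "('v \<Rightarrow>\<^sub>0 nat) \<Rightarrow>\<^sub>0 'a"

abbreviation base_ring :: "'a::comm_ring_1 ring" where
  "base_ring \<equiv> ring_of_type_algebra"

abbreviation mpoly_ring :: "('v, 'a::comm_ring_1) mpoly ring" where
  "mpoly_ring \<equiv> ring_of_type_algebra"

definition mpoly_const :: "'a::comm_ring_1 \<Rightarrow> ('v, 'a) mpoly" where
  "mpoly_const a = Poly_Mapping.single 0 a"

definition mpoly_var :: "'v \<Rightarrow> ('v, 'a::comm_ring_1) mpoly" where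
  "mpoly_var i = Poly_Mapping.single (Poly_Mapping.single i 1) 1"

definition weighted_degree :: "('v::finite \<Rightarrow> nat) \<Rightarrow> ('v \<Rightarrow>\<^sub>0 nat) \<Rightarrow> nat" where
  "weighted_degree w m = (\<Sum>i\<in>UNIV. w i * Poly_Mapping.lookup m i)"

definition homogeneous_component ::
    "('v::finite \<Rightarrow> nat) \<Rightarrow> nat \<Rightarrow> ('v, 'a::comm_ring_1) mpoly \<Rightarrow> ('v, 'a) mpoly" where
  "homogeneous_component w n f =
     (\<Sum>m \<in> {m \<in> Poly_Mapping.keys f. weighted_degree w m = n}.
        Poly_Mapping.single m (Poly_Mapping.lookup f m))"

definition homogeneous_ideal ::
    "('v::finite \<Rightarrow> nat) \<Rightarrow> ('v, 'a::comm_ring_1) mpoly set \<Rightarrow> bool" where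
  "homogeneous_ideal w I \<longleftrightarrow> ideal I mpoly_ring \<and>
     (\<forall>f \<in> I. \<forall>n. homogeneous_component w n f \<in> I)"

definition poly_content :: "('v, 'a::comm_ring_1) mpoly \<Rightarrow> 'a set" where
  "poly_content f = Idl\<^bsub>base_ring\<^esub> (Poly_Mapping.lookup f ` UNIV)"

definition ideal_content :: "('v, 'a::comm_ring_1) mpoly set \<Rightarrow> 'a set" where
  "ideal_content J = Idl\<^bsub>base_ring\<^esub> (\<Union>f\<in>J. poly_content f)"

abbreviation quotient_map ::
    "('v, 'a::comm_ring_1) mpoly set \<Rightarrow> ('v, 'a) mpoly \<Rightarrow> ('v, 'a) mpoly set" where
  "quotient_map I f \<equiv> I +>\<^bsub>mpoly_ring\<^esub> f"

definition irrelevant_ideal ::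
    "('v, 'a::comm_ring_1) mpoly set \<Rightarrow> ('v, 'a) mpoly set set" where
  "irrelevant_ideal I = Idl\<^bsub>mpoly_ring Quot I\<^esub> (range (\<lambda>i. quotient_map I (mpoly_var i)))"

definition extended_content ::
    "('v, 'a::comm_ring_1) mpoly set \<Rightarrow> ('v, 'a) mpoly set set" where
  "extended_content I =
     Idl\<^bsub>mpoly_ring Quot I\<^esub> ((\<lambda>a. quotient_map I (mpoly_const a)) ` ideal_content I)"

end

theory Submission
  imports Defs
begin

text \<open>Write \<open>H\<close> for the top local cohomology module. For a complex of modules that map onto their
  localisations at \<open>u\<close>, exact above degree \<open>k\<close>, the \<open>(k+1)\<close>-st cohomology of its \<open>u\<close>-torsion
  subcomplex is the cokernel of the localisation map \<open>H\<^sup>k \<rightarrow> (H\<^sup>k)\<^sub>u\<close>. Taking torsion with respect to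
  \<open>U\<^sub>1, \<dots>, U\<^sub>s\<close> one after the other identifies the elements of \<open>H\<close> with fractions
  \<open>f / (U\<^sub>1 \<cdots> U\<^sub>s)\<^sup>n\<close>, and such a fraction vanishes iff \<open>(U\<^sub>1 \<cdots> U\<^sub>s)\<^sup>m f\<close> lies in
  \<open>(U\<^sub>1\<^sup>n\<^sup>+\<^sup>m, \<dots>, U\<^sub>s\<^sup>n\<^sup>+\<^sup>m) + I\<close> for some \<open>m\<close>.

  An associated prime \<open>Q\<close> of \<open>H\<close> contains the variables, because \<open>H\<close> is torsion. If a homogeneous
  element of \<open>I\<close> had a coefficient outside \<open>Q\<close>, its multiples would give a system of relations between
  the inverse monomials of a given degree that is triangular modulo \<open>Q\<close>, so every element of \<open>H\<close> would
  be annihilated by something outside \<open>Q\<close>. Hence \<open>Q\<close> contains \<open>c(I)R + R\<^sub>+\<close>. Conversely, comparing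
  coefficients, the annihilator of \<open>1 / (U\<^sub>1 \<cdots> U\<^sub>s)\<close> lies in \<open>c(I)R + R\<^sub>+\<close>, so every prime containing
  \<open>c(I)R + R\<^sub>+\<close> contains an associated prime of \<open>H\<close>.\<close>

section \<open>Chain conditions\<close>

text \<open>No inverse polynomials and no Cech complex are constructed. A class in \<open>H\<close>
  enters only through its annihilator, and a membership condition in \<open>S\<close> computes that
  annihilator. After the cohomological part everything is therefore about ideals of
  \<open>S\<close>, handled as subsets of a type, and \<open>R\<close> is reached through the coset
  map.

  The obstacle in the cohomological part is that an injective module only maps onto its
  localisation: an element can be divided by \<open>u\<close> only after multiplication by some
  power of \<open>u\<close>. A given fraction is thus guaranteed a cocycle only after expansion, and
  exponents grow from step to step. Numerator and exponent are carried along as a relation, so that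
  no maps have to be chosen.

  The chain condition is used three times: to divide in injective modules, to find a prime among the
  annihilators inside a given prime, and to bound the number of minimal primes. The degrees serve to
  keep the relations between inverse monomials finite.\<close>

definition sub_ideal :: "'s::comm_ring_1 set \<Rightarrow> 's set \<Rightarrow> bool" where
  "sub_ideal A J \<longleftrightarrow> J \<subseteq> A \<and> 0 \<in> J \<and> (\<forall>x\<in>J. \<forall>y\<in>J. x + y \<in> J) \<and> (\<forall>a\<in>A. \<forall>x\<in>J. a * x \<in> J)"

definition sub_ring :: "'s::comm_ring_1 set \<Rightarrow> bool" where
  "sub_ring A \<longleftrightarrow> 1 \<in> A \<and> -1 \<in> A \<and> (\<forall>x\<in>A. \<forall>y\<in>A. x + y \<in> A \<and> x * y \<in> A)"

text \<open>The condition is relative to a subset so that the basis theorem can climb through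
  subrings of one fixed type, from the constants up to all polynomials.\<close>

definition acc_on :: "'s::comm_ring_1 set \<Rightarrow> bool" where
  "acc_on A \<longleftrightarrow> (\<forall>f::nat \<Rightarrow> 's set. (\<forall>n. sub_ideal A (f n)) \<and> mono f \<longrightarrow> (\<exists>N. \<forall>n\<ge>N. f n = f N))"

lemma acc_onD:
  fixes f :: "nat \<Rightarrow> 's::comm_ring_1 set"
  assumes "acc_on A" "\<And>n. sub_ideal A (f n)" "mono f"
  shows "\<exists>N. \<forall>n\<ge>N. f n = f N"
  using assms unfolding acc_on_def by simp

lemma sub_ideal_UNIV_iff: "sub_ideal UNIV J \<longleftrightarrow> ideal J ring_of_type_algebra"
proof
  assume J: "sub_ideal UNIV J"
  have neg: "-x \<in> J" if "x \<in> J" for x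
    using J that unfolding sub_ideal_def by (metis UNIV_I mult_minus1)
  show "ideal J ring_of_type_algebra"
  proof (rule idealI)
    show "ring (ring_of_type_algebra :: 'a ring)" by (rule ring_from_type_algebra)
    then interpret ring "ring_of_type_algebra :: 'a ring" .
    show "subgroup J (add_monoid ring_of_type_algebra)"
    proof (rule group.subgroupI)
      show "\<And>a. a \<in> J \<Longrightarrow> inv\<^bsub>add_monoid ring_of_type_algebra\<^esub> a \<in> J"
      proof -
        fix a assume a: "a \<in> J"
        have "inv\<^bsub>add_monoid ring_of_type_algebra\<^esub> a = -a"
          unfolding a_inv_def[symmetric]
          by (rule minus_equality) (auto simp: ring_of_type_algebra_def)
        then show "inv\<^bsub>add_monoid ring_of_type_algebra\<^esub> a \<in> J" using neg[OF a] by simp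
      qed
    qed (use J in \<open>auto simp: sub_ideal_def ring_of_type_algebra_def intro: add.is_group[unfolded ring_of_type_algebra_def, simplified]\<close>)
    fix a x assume "a \<in> J"
    then have "x * a \<in> J" using J by (simp add: sub_ideal_def)
    then show "x \<otimes>\<^bsub>ring_of_type_algebra\<^esub> a \<in> J" "a \<otimes>\<^bsub>ring_of_type_algebra\<^esub> x \<in> J"
      by (simp_all add: ring_of_type_algebra_def mult.commute)
  qed
next
  assume "ideal J ring_of_type_algebra"
  then interpret ideal J ring_of_type_algebra .
  show "sub_ideal UNIV J"
    using additive_subgroup.a_closed[OF is_additive_subgroup]
      additive_subgroup.zero_closed[OF is_additive_subgroup] I_l_closed
    unfolding sub_ideal_def by (simp add: ring_of_type_algebra_def)
qed

lemma sub_idealD: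
  assumes "sub_ideal A J"
  shows "J \<subseteq> A" "0 \<in> J" "x \<in> J \<Longrightarrow> y \<in> J \<Longrightarrow> x + y \<in> J" "a \<in> A \<Longrightarrow> x \<in> J \<Longrightarrow> a * x \<in> J"
  using assms by (auto simp: sub_ideal_def)

lemma sub_ideal_diff:
  assumes "sub_ring A" "sub_ideal A J" "x \<in> J" "y \<in> J"
  shows "x - y \<in> J"
proof -
  have "-1 * y \<in> J" using assms by (auto simp: sub_ring_def sub_ideal_def)
  then have "x + -1 * y \<in> J" using assms(2,3) by (auto simp: sub_ideal_def)
  then show ?thesis by simp
qed

lemma acc_on_maximal:
  assumes "acc_on A" "\<J> \<noteq> {}" "\<And>J. J \<in> \<J> \<Longrightarrow> sub_ideal A J"
  shows "\<exists>M\<in>\<J>. \<forall>J\<in>\<J>. M \<subseteq> J \<longrightarrow> J = M"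
proof (rule ccontr)
  assume nothesis: "\<not> (\<exists>M\<in>\<J>. \<forall>J\<in>\<J>. M \<subseteq> J \<longrightarrow> J = M)"
  have ex: "\<exists>J'\<in>\<J>. J \<subset> J'" if "J \<in> \<J>" for J
  proof -
    have "\<not> (\<forall>J'\<in>\<J>. J \<subseteq> J' \<longrightarrow> J' = J)" using nothesis that by auto
    then obtain J' where "J' \<in> \<J>" "J \<subseteq> J'" "J' \<noteq> J" by auto
    then show ?thesis by (intro bexI[of _ J']) auto
  qed
  have "\<exists>f. \<forall>n. (f n \<in> \<J>) \<and> (f n \<subset> f (Suc n))"
    by (rule dependent_nat_choice) (use assms(2) ex in auto)
  then obtain f where f: "\<And>n. f n \<in> \<J>" "\<And>n. f n \<subset> f (Suc n)" by metis
  have "mono f" unfolding mono_iff_le_Suc using f(2) psubset_imp_subset by metis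
  then obtain N where "\<And>n. n \<ge> N \<Longrightarrow> f n = f N"
    using assms(1,3) f(1) unfolding acc_on_def by meson
  from this[of "Suc N"] have "f (Suc N) = f N" by simp
  then show False using f(2)[of N] by simp
qed

section \<open>Adjoining one element to a subring with the ascending chain condition\<close>

primrec bounded_poly :: "'s::comm_ring_1 set \<Rightarrow> 's \<Rightarrow> nat \<Rightarrow> 's set" where
  "bounded_poly A x 0 = {0}"
| "bounded_poly A x (Suc n) = {a * x ^ n + r |a r. a \<in> A \<and> r \<in> bounded_poly A x n}"

definition adjoin :: "'s::comm_ring_1 set \<Rightarrow> 's \<Rightarrow> 's set" where
  "adjoin A x = (\<Union>n. bounded_poly A x n)"

text \<open>Elements of \<open>adjoin A x\<close> are values of polynomials, not formal polynomials:
  \<open>x\<close> may satisfy relations over \<open>A\<close>, and expressions are not unique. A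
  leading coefficient of degree \<open>n\<close> is therefore one that occurs in some expression;
  \<open>bounded_poly A x n\<close> supplies the terms of degree less than \<open>n\<close>.\<close>

definition leading :: "'s::comm_ring_1 set \<Rightarrow> 's \<Rightarrow> 's set \<Rightarrow> nat \<Rightarrow> 's set" where
  "leading A x J n = {a \<in> A. \<exists>r\<in>bounded_poly A x n. a * x ^ n + r \<in> J}"

context
  fixes A :: "'s::comm_ring_1 set" and x :: 's
  assumes A: "sub_ring A"
begin

lemma sub_ring_closed:
  "1 \<in> A" "-1 \<in> A" "a \<in> A \<Longrightarrow> b \<in> A \<Longrightarrow> a + b \<in> A" "a \<in> A \<Longrightarrow> b \<in> A \<Longrightarrow> a * b \<in> A" "0 \<in> A"
proof -
  show 1: "1 \<in> A" "-1 \<in> A" and p: "a \<in> A \<Longrightarrow> b \<in> A \<Longrightarrow> a + b \<in> A" "a \<in> A \<Longrightarrow> b \<in> A \<Longrightarrow> a * b \<in> A"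
    for a b using A by (auto simp: sub_ring_def)
  have "1 + -1 \<in> A" using p(1)[OF 1] .
  then show "0 \<in> A" by simp
qed

lemma bounded_poly_zero: "0 \<in> bounded_poly A x n"
proof (induction n)
  case (Suc n)
  have "0 = 0 * x ^ n + (0::'s)" by simp
  then show ?case using Suc sub_ring_closed(5) by (simp only: bounded_poly.simps) blast
qed simp

lemma bounded_poly_add:
  "f \<in> bounded_poly A x n \<Longrightarrow> g \<in> bounded_poly A x n \<Longrightarrow> f + g \<in> bounded_poly A x n"
proof (induction n arbitrary: f g)
  case (Suc n)
  obtain a r b s where ab: "f = a * x ^ n + r" "g = b * x ^ n + s" "a \<in> A" "b \<in> A"
    "r \<in> bounded_poly A x n" "s \<in> bounded_poly A x n" using Suc.prems by auto
  have "f + g = (a + b) * x ^ n + (r + s)" unfolding ab by (simp add: algebra_simps)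
  then show ?case using Suc.IH ab sub_ring_closed(3) by (simp only: bounded_poly.simps) blast
qed simp

lemma bounded_poly_scale:
  "a \<in> A \<Longrightarrow> f \<in> bounded_poly A x n \<Longrightarrow> a * f \<in> bounded_poly A x n"
proof (induction n arbitrary: f)
  case (Suc n)
  obtain b r where b: "f = b * x ^ n + r" "b \<in> A" "r \<in> bounded_poly A x n" using Suc.prems by auto
  have "a * f = (a * b) * x ^ n + a * r" unfolding b by (simp add: algebra_simps)
  then show ?case using Suc.IH Suc.prems b sub_ring_closed(4) by (simp only: bounded_poly.simps) blast
qed simp

lemma bounded_poly_Suc: "f \<in> bounded_poly A x n \<Longrightarrow> f \<in> bounded_poly A x (Suc n)"
proof -
  assume f: "f \<in> bounded_poly A x n"
  have "f = 0 * x ^ n + f" by simp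
  then show ?thesis using f sub_ring_closed(5) by (simp only: bounded_poly.simps) blast
qed

lemma bounded_poly_mono: "m \<le> n \<Longrightarrow> bounded_poly A x m \<subseteq> bounded_poly A x n"
  by (rule lift_Suc_mono_le[of "bounded_poly A x"]) (use bounded_poly_Suc in blast)+

lemma bounded_poly_shift: "f \<in> bounded_poly A x n \<Longrightarrow> x * f \<in> bounded_poly A x (Suc n)"
proof (induction n arbitrary: f)
  case 0
  then show ?case using bounded_poly_zero[of "Suc 0"] by (simp del: bounded_poly.simps(2))
next
  case (Suc n)
  obtain b r where b: "f = b * x ^ n + r" "b \<in> A" "r \<in> bounded_poly A x n" using Suc.prems by auto
  have "x * f = b * x ^ Suc n + x * r" unfolding b by (simp add: algebra_simps)
  then show ?case using Suc.IH b
    by (subst bounded_poly.simps) blast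
qed

lemma adjoin_closed:
  "f \<in> adjoin A x \<Longrightarrow> g \<in> adjoin A x \<Longrightarrow> f + g \<in> adjoin A x"
  "a \<in> A \<Longrightarrow> f \<in> adjoin A x \<Longrightarrow> a * f \<in> adjoin A x"
  "f \<in> adjoin A x \<Longrightarrow> x * f \<in> adjoin A x"
proof -
  assume "f \<in> adjoin A x" "g \<in> adjoin A x"
  then obtain m n where "f \<in> bounded_poly A x m" "g \<in> bounded_poly A x n" by (auto simp: adjoin_def)
  then have "f \<in> bounded_poly A x (max m n)" "g \<in> bounded_poly A x (max m n)"
    using bounded_poly_mono by (meson max.cobounded1 max.cobounded2 subsetD)+
  then show "f + g \<in> adjoin A x" using bounded_poly_add by (auto simp: adjoin_def)
qed (use bounded_poly_scale bounded_poly_shift in \<open>auto simp only: adjoin_def UN_iff, blast+\<close>)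

lemma subset_adjoin: "A \<subseteq> adjoin A x"
proof
  fix a assume "a \<in> A"
  then have "a \<in> bounded_poly A x (Suc 0)" by simp
  then show "a \<in> adjoin A x" unfolding adjoin_def by blast
qed

lemma mem_adjoin: "x \<in> adjoin A x"
  using adjoin_closed(3)[of 1] subset_adjoin sub_ring_closed(1) by auto

lemma adjoin_mult: "f \<in> adjoin A x \<Longrightarrow> g \<in> adjoin A x \<Longrightarrow> f * g \<in> adjoin A x"
proof -
  assume f: "f \<in> adjoin A x" and g: "g \<in> adjoin A x"
  have xg: "x ^ n * g \<in> adjoin A x" for n
    by (induction n) (use g adjoin_closed(3) in \<open>auto simp: mult.assoc\<close>)
  obtain n where "f \<in> bounded_poly A x n" using f by (auto simp: adjoin_def)
  then show ?thesis
  proof (induction n arbitrary: f)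
    case 0
    then show ?case using sub_ring_closed(5) subset_adjoin by auto
  next
    case (Suc n)
    obtain b r where b: "f = b * x ^ n + r" "b \<in> A" "r \<in> bounded_poly A x n" using Suc.prems by auto
    have "f * g = b * (x ^ n * g) + r * g" unfolding b by (simp add: algebra_simps)
    then show ?case using Suc.IH b adjoin_closed(1,2) xg by auto
  qed
qed

lemma sub_ring_adjoin: "sub_ring (adjoin A x)"
  unfolding sub_ring_def using adjoin_mult adjoin_closed(1) subset_adjoin sub_ring_closed by blast

lemma leading_ideal:
  assumes J: "sub_ideal (adjoin A x) J"
  shows "sub_ideal A (leading A x J n)"
  unfolding sub_ideal_def
proof (intro conjI ballI)
  show "leading A x J n \<subseteq> A" by (auto simp: leading_def)
  show "0 \<in> leading A x J n"
    using bounded_poly_zero[of n] sub_idealD(2)[OF J] sub_ring_closed(5) by (force simp: leading_def)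
next
  fix a b assume "a \<in> leading A x J n" "b \<in> leading A x J n"
  then obtain r s where rs: "a \<in> A" "b \<in> A" "r \<in> bounded_poly A x n" "a * x ^ n + r \<in> J"
    "s \<in> bounded_poly A x n" "b * x ^ n + s \<in> J" by (auto simp: leading_def)
  have "(a + b) * x ^ n + (r + s) = (a * x ^ n + r) + (b * x ^ n + s)" by (simp add: algebra_simps)
  then have "(a + b) * x ^ n + (r + s) \<in> J" using sub_idealD(3)[OF J rs(4,6)] by (simp only:)
  then show "a + b \<in> leading A x J n"
    unfolding leading_def using rs bounded_poly_add sub_ring_closed(3) by blast
next
  fix a b assume "a \<in> A" "b \<in> leading A x J n"
  then obtain r where rs: "a \<in> A" "b \<in> A" "r \<in> bounded_poly A x n" "b * x ^ n + r \<in> J"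
    by (auto simp: leading_def)
  have "(a * b) * x ^ n + a * r = a * (b * x ^ n + r)" by (simp add: algebra_simps)
  then have "(a * b) * x ^ n + a * r \<in> J" using sub_idealD(4)[OF J subsetD[OF subset_adjoin rs(1)] rs(4)] by (simp only:)
  then show "a * b \<in> leading A x J n"
    unfolding leading_def using rs bounded_poly_scale sub_ring_closed(4) by blast
qed

lemma leading_mono_right:
  assumes J: "sub_ideal (adjoin A x) J" and "m \<le> n"
  shows "leading A x J m \<subseteq> leading A x J n"
proof (rule lift_Suc_mono_le[OF _ \<open>m \<le> n\<close>])
  fix n show "leading A x J n \<subseteq> leading A x J (Suc n)"
  proof
    fix a assume "a \<in> leading A x J n"
    then obtain r where r: "a \<in> A" "r \<in> bounded_poly A x n" "a * x ^ n + r \<in> J" by (auto simp: leading_def)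
    have "a * x ^ Suc n + x * r = x * (a * x ^ n + r)" by (simp add: algebra_simps)
    then have "a * x ^ Suc n + x * r \<in> J" using sub_idealD(4)[OF J mem_adjoin r(3)] by (simp only:)
    then show "a \<in> leading A x J (Suc n)"
      unfolding leading_def using r bounded_poly_shift by blast
  qed
qed

lemma leading_mono_left: "J \<subseteq> J' \<Longrightarrow> leading A x J n \<subseteq> leading A x J' n"
  by (auto simp: leading_def)

text \<open>From an element of \<open>J'\<close> subtract an element of \<open>J\<close> with the
  same leading coefficient: the degree bound drops, and the difference stays in \<open>J'\<close>
  because \<open>J\<close> is contained in \<open>J'\<close>. Induction puts the difference into
  \<open>J\<close>.\<close>

lemma eq_if_leading_eq:
  assumes J: "sub_ideal (adjoin A x) J" and J': "sub_ideal (adjoin A x) J'" and "J \<subseteq> J'"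
    and eq: "\<And>n. leading A x J n = leading A x J' n"
  shows "J = J'"
proof -
  have "f \<in> J" if "f \<in> bounded_poly A x n" "f \<in> J'" for f n
    using that
  proof (induction n arbitrary: f)
    case 0
    then show ?case using sub_idealD(2)[OF J] by simp
  next
    case (Suc n)
    obtain b r where b: "f = b * x ^ n + r" "b \<in> A" "r \<in> bounded_poly A x n" using Suc.prems by auto
    then have "b \<in> leading A x J n" using Suc.prems eq by (auto simp: leading_def)
    then obtain s where s: "s \<in> bounded_poly A x n" "b * x ^ n + s \<in> J" by (auto simp: leading_def)
    have "f - (b * x ^ n + s) = r + -1 * s" unfolding b by simp
    moreover have "r + -1 * s \<in> bounded_poly A x n"
      using b s bounded_poly_add bounded_poly_scale sub_ring_closed(2) by blast
    moreover have "f - (b * x ^ n + s) \<in> J'"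
      by (rule sub_ideal_diff[OF sub_ring_adjoin J' Suc.prems(2)]) (use s \<open>J \<subseteq> J'\<close> in blast)
    ultimately have "f - (b * x ^ n + s) \<in> J" using Suc.IH by metis
    from sub_idealD(3)[OF J this s(2)] show ?case by simp
  qed
  then show ?thesis using \<open>J \<subseteq> J'\<close> sub_idealD(1)[OF J'] by (auto simp: adjoin_def)
qed

text \<open>The ideals of leading coefficients of degree \<open>n\<close> of the \<open>k\<close>-th member of a chain increase in
  both \<open>n\<close> and \<open>k\<close>, so the diagonal controls all but finitely many \<open>n\<close>.\<close>

lemma acc_on_adjoin:
  assumes acc: "acc_on A"
  shows "acc_on (adjoin A x)"
  unfolding acc_on_def
proof (intro allI impI)
  fix f :: "nat \<Rightarrow> 's set"
  assume f: "(\<forall>n. sub_ideal (adjoin A x) (f n)) \<and> mono f"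
  let ?L = "\<lambda>k n. leading A x (f k) n"
  have id: "sub_ideal A (?L k n)" for k n using f leading_ideal by blast
  have mono: "?L k n \<subseteq> ?L k' n'" if "k \<le> k'" "n \<le> n'" for k k' n n'
    using leading_mono_left leading_mono_right f that by (meson monoD subset_trans)
  have "mono (\<lambda>k. ?L k k)" using mono by (intro monoI) blast
  then obtain K where K: "\<And>k. k \<ge> K \<Longrightarrow> ?L k k = ?L K K"
    using acc id unfolding acc_on_def by (metis (no_types, lifting))
  have "\<exists>N. \<forall>k\<ge>N. ?L k n = ?L N n" for n
  proof -
    have "mono (\<lambda>k. ?L k n)" using mono by (intro monoI) blast
    then show ?thesis using acc id unfolding acc_on_def by (metis (no_types, lifting))
  qed
  then obtain N where N: "\<And>n k. k \<ge> N n \<Longrightarrow> ?L k n = ?L (N n) n" by metis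
  \<comment> \<open>Only the degrees below \<open>K\<close> need a bound of their own; from degree
    \<open>K\<close> on, every ideal is squeezed between two equal diagonal terms.\<close>
  define M where "M = Max (insert K (N ` {..<K}))"
  have MN: "M \<ge> N n" if "n < K" for n
    using that unfolding M_def by (auto intro!: Max_ge)
  have MK: "M \<ge> K" unfolding M_def by (auto intro!: Max_ge)
  have "f k = f M" if k: "k \<ge> M" for k
  proof -
    have "?L M n = ?L k n" for n
    proof (cases "n < K")
      case True
      then show ?thesis using N[of n] MN[of n] k by (metis le_trans)
    next
      case False
      let ?m = "max k n"
      have "?L K K \<subseteq> ?L M n" by (rule mono) (use False MK in auto)
      moreover have "?L M n \<subseteq> ?L k n" by (rule mono) (use k in auto)
      moreover have "?L k n \<subseteq> ?L ?m ?m" by (rule mono) auto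
      moreover have "?L ?m ?m = ?L K K" by (rule K) (use k MK in auto)
      ultimately have "?L k n \<subseteq> ?L M n" by (simp only:)
      with \<open>?L M n \<subseteq> ?L k n\<close> show ?thesis by (rule subset_antisym)
    qed
    moreover have "f M \<subseteq> f k" by (rule monoD[OF conjunct2[OF f] k])
    ultimately have "f M = f k"
      using eq_if_leading_eq conjunct1[OF f] by meson
    then show ?thesis by simp
  qed
  then show "\<exists>N. \<forall>n\<ge>N. f n = f N" by blast
qed

end

section \<open>Hilbert's basis theorem for polynomials in finitely many variables\<close>

lemma range_mpoly_const_sub_ring: "sub_ring (range (mpoly_const :: 'a \<Rightarrow> ('v, 'a::comm_ring_1) mpoly))"
  unfolding sub_ring_def
proof (intro conjI ballI)
  show "1 \<in> range (mpoly_const :: 'a \<Rightarrow> ('v, 'a) mpoly)"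
    by (rule range_eqI[of _ _ 1]) (simp add: mpoly_const_def)
  show "-1 \<in> range (mpoly_const :: 'a \<Rightarrow> ('v, 'a) mpoly)"
    by (rule range_eqI[of _ _ "-1"]) (simp add: mpoly_const_def single_uminus)
qed (auto simp: mpoly_const_def mult_single simp flip: single_add)

text \<open>A chain of ideals inside the constants is the image of the chain of its preimages in the
  base ring, where the union of a nonempty chain of ideals is a member of the chain.\<close>

lemma acc_on_range_mpoly_const:
  assumes "noetherian_ring (base_ring :: 'a::comm_ring_1 ring)"
  shows "acc_on (range (mpoly_const :: 'a \<Rightarrow> ('v, 'a) mpoly))"
  unfolding acc_on_def
proof (intro allI impI)
  interpret noetherian_ring "base_ring :: 'a ring" by fact
  let ?c = "mpoly_const :: 'a \<Rightarrow> ('v, 'a) mpoly"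
  fix f :: "nat \<Rightarrow> ('v, 'a) mpoly set"
  assume f: "(\<forall>n. sub_ideal (range ?c) (f n)) \<and> mono f"
  have c: "?c (a + b) = ?c a + ?c b" "?c (a * b) = ?c a * ?c b" "?c 0 = 0" for a b
    by (auto simp: mpoly_const_def mult_single single_add)
  define g where "g n = {a. ?c a \<in> f n}" for n
  have fg: "f n = ?c ` g n" for n using f unfolding sub_ideal_def g_def by blast
  have "ideal (g n) base_ring" for n
    using f unfolding sub_ideal_UNIV_iff[symmetric] by (auto simp: sub_ideal_def g_def c)
  moreover have gm: "g m \<subseteq> g n" if "m \<le> n" for m n using f that by (auto simp: g_def dest: monoD)
  moreover have "g m \<subseteq> g n \<or> g n \<subseteq> g m" for m n using gm nat_le_linear by meson
  ultimately have "subset.chain {J. ideal J base_ring} (range g)"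
    by (simp add: subset_chain_def image_subset_iff)
  then have "\<Union>(range g) \<in> range g" by (intro ideal_chain_is_trivial) auto
  then obtain N where N: "\<Union>(range g) = g N" by auto
  have "g n = g N" if "n \<ge> N" for n using gm[OF that] N by blast
  then show "\<exists>N. \<forall>n\<ge>N. f n = f N" unfolding fg by metis
qed

lemma poly_mapping_add_induct [case_names zero plus]:
  fixes f :: "'k \<Rightarrow>\<^sub>0 'b::comm_monoid_add"
  assumes "P 0" and "\<And>k b g. P g \<Longrightarrow> P (Poly_Mapping.single k b + g)"
  shows "P f"
proof (induction f rule: update_induct)
  case const
  then show ?case by (rule assms(1))
next
  case (update f k b)
  have "Poly_Mapping.update k b f = Poly_Mapping.single k b + f"
    using update(1) by (intro poly_mapping_eqI)
      (auto simp: lookup_update lookup_add lookup_single when_def in_keys_iff)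
  then show ?case using assms(2) update by simp
qed

lemma mpoly_generated:
  fixes A :: "('v::finite, 'a::comm_ring_1) mpoly set"
  assumes A: "sub_ring A" and c: "range mpoly_const \<subseteq> A" and v: "range mpoly_var \<subseteq> A"
  shows "A = UNIV"
proof -
  note cl = sub_ring_closed[OF A]
  \<comment> \<open>Exponent vectors are finitely supported maps as well, so the same induction rule
    serves for \<open>m\<close> here and for \<open>f\<close> below.\<close>
  have "Poly_Mapping.single m 1 \<in> A" for m :: "'v \<Rightarrow>\<^sub>0 nat"
  proof (induction m rule: poly_mapping_add_induct)
    case zero
    then show ?case using cl(1) by simp
  next
    case (plus v k g)
    have "Poly_Mapping.single (Poly_Mapping.single v k) (1::'a) \<in> A"
    proof (induction k)
      case 0
      then show ?case using cl(1) by simp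
    next
      case (Suc k)
      have "Poly_Mapping.single (Poly_Mapping.single v (Suc k)) (1::'a) =
         mpoly_var v * Poly_Mapping.single (Poly_Mapping.single v k) 1"
        using single_add[of v 1 k] by (simp add: mpoly_var_def mult_single)
      then show ?case using cl(4)[OF subsetD[OF v rangeI] Suc] by simp
    qed
    moreover have "Poly_Mapping.single (Poly_Mapping.single v k + g) (1::'a) =
        Poly_Mapping.single (Poly_Mapping.single v k) 1 * Poly_Mapping.single g 1"
      by (simp add: mult_single)
    ultimately show ?case using cl(4) plus by (simp only:)
  qed
  then have "mpoly_const a * Poly_Mapping.single m 1 \<in> A" for m :: "'v \<Rightarrow>\<^sub>0 nat" and a :: 'a
    by (rule cl(4)[OF subsetD[OF c rangeI]])
  then have single: "Poly_Mapping.single m a \<in> A" for m a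
    by (simp add: mpoly_const_def mult_single)
  have "f \<in> A" for f
    by (induction f rule: poly_mapping_add_induct) (simp_all add: single cl(3,5))
  then show ?thesis by blast
qed

text \<open>The variables are adjoined to the constants one at a time; every intermediate ring is a
  subset of the final polynomial type.\<close>

theorem hilbert_basis_mpoly:
  assumes "noetherian_ring (base_ring :: 'a::comm_ring_1 ring)"
  shows "acc_on (UNIV :: ('v::finite, 'a) mpoly set)"
proof -
  have "\<exists>A :: ('v, 'a) mpoly set. sub_ring A \<and> acc_on A \<and> range mpoly_const \<subseteq> A \<and> mpoly_var ` V \<subseteq> A"
    if "finite V" for V :: "'v set"
    using that
  proof (induction V)
    case empty
    then show ?case
      using acc_on_range_mpoly_const[OF assms] range_mpoly_const_sub_ring by blast
  next
    case (insert v V)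
    then obtain A :: "('v, 'a) mpoly set" where A: "sub_ring A" "acc_on A" "range mpoly_const \<subseteq> A" "mpoly_var ` V \<subseteq> A"
      by blast
    show ?case
    proof (intro exI conjI)
      show "sub_ring (adjoin A (mpoly_var v))" by (rule sub_ring_adjoin[OF A(1)])
      show "acc_on (adjoin A (mpoly_var v))" by (rule acc_on_adjoin[OF A(1,2)])
      show "range mpoly_const \<subseteq> adjoin A (mpoly_var v)"
        by (rule subset_trans[OF A(3) subset_adjoin[OF A(1)]])
      show "mpoly_var ` insert v V \<subseteq> adjoin A (mpoly_var v)"
        using subset_trans[OF A(4) subset_adjoin[OF A(1)]] mem_adjoin[OF A(1)] by simp
    qed
  qed
  from this[of UNIV] obtain A :: "('v, 'a) mpoly set"
    where "sub_ring A" "acc_on A" "range mpoly_const \<subseteq> A" "range mpoly_var \<subseteq> A" by auto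
  then show ?thesis using mpoly_generated by metis
qed

section \<open>Finiteness of the set of minimal primes\<close>

definition prime_set :: "'s::comm_ring_1 set \<Rightarrow> bool" where
  "prime_set P \<longleftrightarrow> sub_ideal UNIV P \<and> 1 \<notin> P \<and> (\<forall>a b. a * b \<in> P \<longrightarrow> a \<in> P \<or> b \<in> P)"

text \<open>A maximal counterexample \<open>J\<close> is not prime, and any prime containing \<open>J\<close> contains \<open>J + (a)\<close>
  or \<open>J + (b)\<close> whenever \<open>ab \<in> J\<close>.\<close>

lemma finite_primes_below:
  fixes J :: "'s::comm_ring_1 set"
  assumes acc: "acc_on (UNIV :: 's set)" and J: "sub_ideal UNIV J"
  shows "\<exists>F. finite F \<and> (\<forall>P\<in>F. prime_set P \<and> J \<subseteq> P) \<and>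
    (\<forall>P. prime_set P \<and> J \<subseteq> P \<longrightarrow> (\<exists>Q\<in>F. Q \<subseteq> P))"
proof -
  define good where "good J \<longleftrightarrow> (\<exists>F. finite F \<and> (\<forall>P\<in>F. prime_set P \<and> J \<subseteq> P) \<and>
    (\<forall>P. prime_set P \<and> J \<subseteq> P \<longrightarrow> (\<exists>Q\<in>F. Q \<subseteq> P)))" for J :: "'s set"
  have "good J"
  proof (rule ccontr)
    assume bad: "\<not> good J"
    let ?B = "{J. sub_ideal UNIV J \<and> \<not> good J}"
    have "\<exists>M\<in>?B. \<forall>J\<in>?B. M \<subseteq> J \<longrightarrow> J = M"
      by (rule acc_on_maximal[OF acc]) (use bad J in auto)
    then obtain M where MB: "M \<in> ?B" and maxB: "\<forall>J\<in>?B. M \<subseteq> J \<longrightarrow> J = M" by (rule bexE)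
    have M: "sub_ideal UNIV M" "\<not> good M" using MB by simp_all
    have max: "J = M" if "sub_ideal UNIV J" "\<not> good J" "M \<subseteq> J" for J
      using maxB that by simp
    have "\<not> prime_set M"
    proof
      assume "prime_set M"
      then have "good M" unfolding good_def by (intro exI[of _ "{M}"]) simp
      then show False using M by simp
    qed
    moreover have "1 \<notin> M"
    proof
      assume "1 \<in> M"
      then have "M \<subseteq> P \<Longrightarrow> \<not> prime_set P" for P by (auto simp: prime_set_def)
      then have "good M" unfolding good_def by (intro exI[of _ "{}"]) auto
      then show False using M by simp
    qed
    ultimately obtain a b where ab: "a * b \<in> M" "a \<notin> M" "b \<notin> M"
      using M by (auto simp: prime_set_def)
    define N where "N c = {m + r * c |m r. m \<in> M}" for c
    have NI: "m + r * c \<in> N c" if "m \<in> M" for m r c using that unfolding N_def by blast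
    have Nid: "sub_ideal UNIV (N c)" for c
      unfolding sub_ideal_def
    proof (intro conjI ballI)
      show "0 \<in> N c" using NI[OF sub_idealD(2)[OF M(1)], of 0 c] by simp
    next
      fix y z assume "y \<in> N c" "z \<in> N c"
      then obtain m r n s where "y = m + r * c" "z = n + s * c" "m \<in> M" "n \<in> M" by (auto simp: N_def)
      moreover have "m + r * c + (n + s * c) = (m + n) + (r + s) * c" by (simp add: algebra_simps)
      ultimately show "y + z \<in> N c" using NI sub_idealD(3)[OF M(1)] by (simp only:)
    next
      fix y z :: 's assume "z \<in> N c"
      then obtain m r where "z = m + r * c" "m \<in> M" by (auto simp: N_def)
      moreover have "y * (m + r * c) = y * m + (y * r) * c" by (simp add: algebra_simps)
      ultimately show "y * z \<in> N c" using NI sub_idealD(4)[OF M(1)] by (simp only: UNIV_I)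
    qed auto
    have MN: "M \<subseteq> N c" for c using NI[of _ 0 c] by auto
    have cN: "c \<in> N c" for c using NI[OF sub_idealD(2)[OF M(1)], of 1 c] by simp
    have goodN: "good (N c)" if "c \<notin> M" for c
    proof (rule ccontr)
      assume "\<not> good (N c)"
      from max[OF Nid this MN] cN[of c] that show False by simp
    qed
    obtain F where F: "finite F" "\<forall>P\<in>F. prime_set P \<and> N a \<subseteq> P"
      "\<forall>P. prime_set P \<and> N a \<subseteq> P \<longrightarrow> (\<exists>Q\<in>F. Q \<subseteq> P)"
      using goodN[OF ab(2)] unfolding good_def by (elim exE conjE)
    obtain G where G: "finite G" "\<forall>P\<in>G. prime_set P \<and> N b \<subseteq> P"
      "\<forall>P. prime_set P \<and> N b \<subseteq> P \<longrightarrow> (\<exists>Q\<in>G. Q \<subseteq> P)"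
      using goodN[OF ab(3)] unfolding good_def by (elim exE conjE)
    have NP: "N c \<subseteq> P" if "prime_set P" "M \<subseteq> P" "c \<in> P" for P c
      using that unfolding N_def prime_set_def sub_ideal_def by (auto simp: subset_iff)
    have "\<exists>Q\<in>F \<union> G. Q \<subseteq> P" if P: "prime_set P" "M \<subseteq> P" for P
    proof -
      have "a \<in> P \<or> b \<in> P" using subsetD[OF P(2) ab(1)] P(1) by (simp add: prime_set_def)
      then show ?thesis
      proof
        assume "a \<in> P"
        then have "\<exists>Q\<in>F. Q \<subseteq> P" using F(3) NP[OF P] P(1) by simp
        then show ?thesis by (simp add: bex_Un)
      next
        assume "b \<in> P"
        then have "\<exists>Q\<in>G. Q \<subseteq> P" using G(3) NP[OF P] P(1) by simp
        then show ?thesis by (simp add: bex_Un)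
      qed
    qed
    moreover have "prime_set P \<and> M \<subseteq> P" if "P \<in> F \<union> G" for P
      using that F(2) G(2) subset_trans[OF MN] by fastforce
    ultimately have "good M"
      unfolding good_def using F(1) G(1) by (intro exI[of _ "F \<union> G"]) simp
    then show False using M by simp
  qed
  then show ?thesis unfolding good_def .
qed

section \<open>Top cohomology of iterated torsion complexes\<close>

text \<open>Subtraction through the scalar \<open>-1\<close>: submodules and linear maps then
  respect it by their closure under addition and scalars alone.\<close>

definition mdiff :: "('s::comm_ring_1, 'e) module \<Rightarrow> 'e \<Rightarrow> 'e \<Rightarrow> 'e" where
  "mdiff M x y = x \<oplus>\<^bsub>M\<^esub> (-1) \<odot>\<^bsub>M\<^esub> y"

locale type_module =
  fixes M :: "('s::comm_ring_1, 'e) module"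
  assumes module_M: "module ring_of_type_algebra M"
begin

lemma smult_closed [simp]: "x \<in> carrier M \<Longrightarrow> r \<odot>\<^bsub>M\<^esub> x \<in> carrier M"
  using module.smult_closed[OF module_M, of r] by (simp add: ring_of_type_algebra_def)

lemma smult_smult: "x \<in> carrier M \<Longrightarrow> r \<odot>\<^bsub>M\<^esub> (s \<odot>\<^bsub>M\<^esub> x) = (r * s) \<odot>\<^bsub>M\<^esub> x"
  using module.smult_assoc1[OF module_M, of r s] by (simp add: ring_of_type_algebra_def)

lemma smult_one [simp]: "x \<in> carrier M \<Longrightarrow> 1 \<odot>\<^bsub>M\<^esub> x = x"
  using module.smult_one[OF module_M] by (simp add: ring_of_type_algebra_def)

lemma smult_zero [simp]: "r \<odot>\<^bsub>M\<^esub> \<zero>\<^bsub>M\<^esub> = \<zero>\<^bsub>M\<^esub>"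
  using module.smult_r_null[OF module_M, of r] by (simp add: ring_of_type_algebra_def)

lemma zero_smult [simp]: "x \<in> carrier M \<Longrightarrow> 0 \<odot>\<^bsub>M\<^esub> x = \<zero>\<^bsub>M\<^esub>"
  using module.smult_l_null[OF module_M] by (simp add: ring_of_type_algebra_def)

lemma smult_add_left: "x \<in> carrier M \<Longrightarrow>
    (r + s) \<odot>\<^bsub>M\<^esub> x = r \<odot>\<^bsub>M\<^esub> x \<oplus>\<^bsub>M\<^esub> s \<odot>\<^bsub>M\<^esub> x"
  using module.smult_l_distr[OF module_M, of r s] by (simp add: ring_of_type_algebra_def)

lemma smult_add_right: "x \<in> carrier M \<Longrightarrow> y \<in> carrier M \<Longrightarrow>
    r \<odot>\<^bsub>M\<^esub> (x \<oplus>\<^bsub>M\<^esub> y) = r \<odot>\<^bsub>M\<^esub> x \<oplus>\<^bsub>M\<^esub> r \<odot>\<^bsub>M\<^esub> y"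
  using module.smult_r_distr[OF module_M, of r] by (simp add: ring_of_type_algebra_def)

lemma abelian_group_M: "abelian_group M"
  using module_M by (rule module.axioms(2))

lemma zero_closed [simp]: "\<zero>\<^bsub>M\<^esub> \<in> carrier M"
  by (rule abelian_monoid.zero_closed[OF abelian_group.axioms(1)[OF abelian_group_M]])

lemma add_closed [simp]:
  "x \<in> carrier M \<Longrightarrow> y \<in> carrier M \<Longrightarrow> x \<oplus>\<^bsub>M\<^esub> y \<in> carrier M"
  by (rule abelian_monoid.a_closed[OF abelian_group.axioms(1)[OF abelian_group_M]])

lemma add_zero [simp]:
  "x \<in> carrier M \<Longrightarrow> x \<oplus>\<^bsub>M\<^esub> \<zero>\<^bsub>M\<^esub> = x"
  by (rule abelian_monoid.r_zero[OF abelian_group.axioms(1)[OF abelian_group_M]])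

lemma diff_closed [simp]:
  "x \<in> carrier M \<Longrightarrow> y \<in> carrier M \<Longrightarrow> mdiff M x y \<in> carrier M"
  by (simp add: mdiff_def)

lemma diff_self [simp]: "x \<in> carrier M \<Longrightarrow> mdiff M x x = \<zero>\<^bsub>M\<^esub>"
  using smult_add_left[of x 1 "-1"] by (simp add: mdiff_def)

lemma diff_zero [simp]: "x \<in> carrier M \<Longrightarrow> mdiff M x \<zero>\<^bsub>M\<^esub> = x"
  by (simp add: mdiff_def)

lemma smult_diff: "x \<in> carrier M \<Longrightarrow> y \<in> carrier M \<Longrightarrow>
    r \<odot>\<^bsub>M\<^esub> mdiff M x y = mdiff M (r \<odot>\<^bsub>M\<^esub> x) (r \<odot>\<^bsub>M\<^esub> y)"
  by (simp add: mdiff_def smult_add_right smult_smult)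

end

text \<open>The ideal \<open>(u_1^n, ..., u_s^n) + I\<close>, in a recursive form that unfolds one
  element at a time, in step with \<open>represents\<close>.\<close>

primrec power_ideal :: "'s::comm_ring_1 set \<Rightarrow> 's list \<Rightarrow> nat \<Rightarrow> 's set" where
  "power_ideal I [] n = I"
| "power_ideal I (u # us) n = {u ^ n * g + h |g h. h \<in> power_ideal I us n}"

lemma power_ideal_closed:
  assumes I: "sub_ideal UNIV I"
  shows power_ideal_zero: "0 \<in> power_ideal I us n"
    and power_ideal_add: "f \<in> power_ideal I us n \<Longrightarrow> g \<in> power_ideal I us n \<Longrightarrow> f + g \<in> power_ideal I us n"
    and power_ideal_mult: "f \<in> power_ideal I us n \<Longrightarrow> r * f \<in> power_ideal I us n"
proof -
  have "0 \<in> power_ideal I us n \<and>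
      (\<forall>f\<in>power_ideal I us n. \<forall>g\<in>power_ideal I us n. f + g \<in> power_ideal I us n) \<and>
      (\<forall>f\<in>power_ideal I us n. \<forall>r. r * f \<in> power_ideal I us n)" (is "?P us")
  proof (induction us)
    case Nil
    show ?case using I by (simp add: sub_ideal_def)
  next
    case (Cons u us)
    have PI: "u ^ n * g + h \<in> power_ideal I (u # us) n" if "h \<in> power_ideal I us n" for g h
      using that by auto
    show ?case
    proof (intro conjI ballI allI)
      show "0 \<in> power_ideal I (u # us) n" using PI[of 0 0] Cons by simp
    next
      fix f g assume "f \<in> power_ideal I (u # us) n" "g \<in> power_ideal I (u # us) n"
      then obtain f1 f2 g1 g2 where "f = u ^ n * f1 + f2" "g = u ^ n * g1 + g2"
        "f2 \<in> power_ideal I us n" "g2 \<in> power_ideal I us n" by auto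
      then show "f + g \<in> power_ideal I (u # us) n"
        using PI[of "f2 + g2" "f1 + g1"] Cons by (simp add: algebra_simps del: power_ideal.simps)
    next
      fix f r assume "f \<in> power_ideal I (u # us) n"
      then obtain f1 f2 where "f = u ^ n * f1 + f2" "f2 \<in> power_ideal I us n" by auto
      then show "r * f \<in> power_ideal I (u # us) n"
        using PI[of "r * f2" "r * f1"] Cons by (simp add: algebra_simps del: power_ideal.simps)
    qed
  qed
  then show "0 \<in> power_ideal I us n"
    "f \<in> power_ideal I us n \<Longrightarrow> g \<in> power_ideal I us n \<Longrightarrow> f + g \<in> power_ideal I us n"
    "f \<in> power_ideal I us n \<Longrightarrow> r * f \<in> power_ideal I us n" by simp_all
qed

text \<open>Each generator \<open>u^n\<close> picks up its own factor \<open>u^m\<close> from the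
  product. Hence the vanishing criterion for a fraction persists when the fraction is
  expanded.\<close>

lemma power_ideal_shift:
  assumes I: "sub_ideal UNIV I"
  shows "f \<in> power_ideal I us n \<Longrightarrow> prod_list us ^ m * f \<in> power_ideal I us (n + m)"
proof (induction us arbitrary: f)
  case (Cons u us)
  then obtain g h where gh: "f = u ^ n * g + h" "h \<in> power_ideal I us n" by auto
  have "prod_list (u # us) ^ m * f = u ^ (n + m) * (prod_list us ^ m * g) + u ^ m * (prod_list us ^ m * h)"
    unfolding gh(1) by (simp add: algebra_simps power_mult_distrib power_add)
  then show ?case using power_ideal_mult[OF I Cons.IH[OF gh(2)], of "u ^ m"] by auto
qed (use I in \<open>simp add: sub_ideal_def\<close>)

text \<open>An exact complex \<open>0 \<rightarrow> S/I \<rightarrow> E 0 \<rightarrow> E 1 \<rightarrow> \<dots>\<close> whose terms map onto their localisations at every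
  element \<open>u\<close>, compatibly with annihilators: the only property of injective modules over a Noetherian
  ring that is used.\<close>

locale divisible_resolution =
  fixes E :: "nat \<Rightarrow> ('s::comm_ring_1, 'e) module" and d :: "nat \<Rightarrow> 'e \<Rightarrow> 'e"
    and \<epsilon> :: "'s \<Rightarrow> 'e" and I :: "'s set"
  assumes module_E: "module ring_of_type_algebra (E k)"
    and d_closed [simp]: "x \<in> carrier (E k) \<Longrightarrow> d k x \<in> carrier (E (Suc k))"
    and d_add: "x \<in> carrier (E k) \<Longrightarrow> y \<in> carrier (E k) \<Longrightarrow>
      d k (x \<oplus>\<^bsub>E k\<^esub> y) = d k x \<oplus>\<^bsub>E (Suc k)\<^esub> d k y"
    and d_smult: "x \<in> carrier (E k) \<Longrightarrow> d k (r \<odot>\<^bsub>E k\<^esub> x) = r \<odot>\<^bsub>E (Suc k)\<^esub> d k x"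
    and exact: "y \<in> carrier (E (Suc k)) \<Longrightarrow> d (Suc k) y = \<zero>\<^bsub>E (Suc (Suc k))\<^esub> \<Longrightarrow>
      \<exists>x\<in>carrier (E k). d k x = y"
    and d_d: "x \<in> carrier (E k) \<Longrightarrow> d (Suc k) (d k x) = \<zero>\<^bsub>E (Suc (Suc k))\<^esub>"
    and eps_closed [simp]: "\<epsilon> f \<in> carrier (E 0)"
    and eps_add: "\<epsilon> (f + g) = \<epsilon> f \<oplus>\<^bsub>E 0\<^esub> \<epsilon> g"
    and eps_mult: "\<epsilon> (r * f) = r \<odot>\<^bsub>E 0\<^esub> \<epsilon> f"
    and eps_kernel: "\<epsilon> f = \<zero>\<^bsub>E 0\<^esub> \<longleftrightarrow> f \<in> I"
    and eps_exact: "x \<in> carrier (E 0) \<Longrightarrow> d 0 x = \<zero>\<^bsub>E (Suc 0)\<^esub> \<Longrightarrow> \<exists>f. \<epsilon> f = x"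
    and d_eps: "d 0 (\<epsilon> f) = \<zero>\<^bsub>E (Suc 0)\<^esub>"
    and divisible: "x \<in> carrier (E k) \<Longrightarrow> \<exists>m. \<exists>y\<in>carrier (E k).
      u ^ m \<odot>\<^bsub>E k\<^esub> x = u ^ Suc m \<odot>\<^bsub>E k\<^esub> y \<and>
      (\<forall>r. r \<odot>\<^bsub>E k\<^esub> x = \<zero>\<^bsub>E k\<^esub> \<longrightarrow> r \<odot>\<^bsub>E k\<^esub> y = \<zero>\<^bsub>E k\<^esub>)"
begin

sublocale type_module "E k" for k
  by (rule type_module.intro[OF module_E])

lemma sub_ideal_I: "sub_ideal UNIV I"
proof -
  have "\<epsilon> 0 = \<zero>\<^bsub>E 0\<^esub>" using eps_mult[of 0 0] by simp
  then show ?thesis by (simp add: sub_ideal_def eps_add eps_mult flip: eps_kernel)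
qed

lemma d_diff: "x \<in> carrier (E k) \<Longrightarrow> y \<in> carrier (E k) \<Longrightarrow>
    d k (mdiff (E k) x y) = mdiff (E (Suc k)) (d k x) (d k y)"
  by (simp add: mdiff_def d_add d_smult)

lemma d_zero: "d k \<zero>\<^bsub>E k\<^esub> = \<zero>\<^bsub>E (Suc k)\<^esub>"
  using d_smult[of "\<zero>\<^bsub>E k\<^esub>" k 0] by simp

text \<open>In the localisation at \<open>u\<close>, the fraction \<open>x / u^n\<close> is the
  image of \<open>y\<close>. The powers of \<open>u\<close> needed in the successive divisions add
  up to \<open>m\<close>.\<close>

lemma divisible_power:
  assumes "x \<in> carrier (E k)"
  shows "\<exists>m. \<exists>y\<in>carrier (E k). u ^ m \<odot>\<^bsub>E k\<^esub> x = u ^ (m + n) \<odot>\<^bsub>E k\<^esub> y \<and>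
      (\<forall>r. r \<odot>\<^bsub>E k\<^esub> x = \<zero>\<^bsub>E k\<^esub> \<longrightarrow> r \<odot>\<^bsub>E k\<^esub> y = \<zero>\<^bsub>E k\<^esub>)"
proof (induction n)
  case 0
  then show ?case using assms by (intro exI[of _ 0] bexI[of _ x]) auto
next
  case (Suc n)
  then obtain m y where y: "y \<in> carrier (E k)" "u ^ m \<odot>\<^bsub>E k\<^esub> x = u ^ (m + n) \<odot>\<^bsub>E k\<^esub> y"
    "\<forall>r. r \<odot>\<^bsub>E k\<^esub> x = \<zero>\<^bsub>E k\<^esub> \<longrightarrow> r \<odot>\<^bsub>E k\<^esub> y = \<zero>\<^bsub>E k\<^esub>" by (elim exE bexE conjE)
  obtain l v where v: "v \<in> carrier (E k)" "u ^ l \<odot>\<^bsub>E k\<^esub> y = u ^ Suc l \<odot>\<^bsub>E k\<^esub> v"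
    "\<forall>r. r \<odot>\<^bsub>E k\<^esub> y = \<zero>\<^bsub>E k\<^esub> \<longrightarrow> r \<odot>\<^bsub>E k\<^esub> v = \<zero>\<^bsub>E k\<^esub>"
    using divisible[OF y(1), of u] by (elim exE bexE conjE)
  have "u ^ (m + l) \<odot>\<^bsub>E k\<^esub> x = u ^ l \<odot>\<^bsub>E k\<^esub> (u ^ m \<odot>\<^bsub>E k\<^esub> x)"
    using assms by (simp add: smult_smult power_add mult.commute)
  also have "\<dots> = u ^ (m + n) \<odot>\<^bsub>E k\<^esub> (u ^ l \<odot>\<^bsub>E k\<^esub> y)"
    using y(1) unfolding y(2) by (simp add: smult_smult power_add mult_ac)
  also have "\<dots> = u ^ (m + l + Suc n) \<odot>\<^bsub>E k\<^esub> v"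
    using v(1) unfolding v(2) by (simp add: smult_smult power_add mult_ac)
  finally show ?case using v y(3) by (intro exI[of _ "m + l"] bexI[of _ v]) simp_all
qed

text \<open>Torsion with respect to each element separately, which suits induction on the list;
  \<open>torsion_module_carrier\<close> identifies it with the torsion of the generated
  ideal.\<close>

definition tors :: "'s list \<Rightarrow> nat \<Rightarrow> 'e set" where
  "tors us k = {x \<in> carrier (E k). \<forall>u\<in>set us. \<exists>n. u ^ n \<odot>\<^bsub>E k\<^esub> x = \<zero>\<^bsub>E k\<^esub>}"

lemma tors_carrier: "x \<in> tors us k \<Longrightarrow> x \<in> carrier (E k)"
  by (simp add: tors_def)

lemma tors_Nil [simp]: "tors [] k = carrier (E k)"
  by (simp add: tors_def)

lemma tors_Cons: "x \<in> tors (u # us) k \<longleftrightarrow>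
    x \<in> tors us k \<and> (\<exists>n. u ^ n \<odot>\<^bsub>E k\<^esub> x = \<zero>\<^bsub>E k\<^esub>)"
  by (auto simp: tors_def)

lemma smult_eq_zero_mono:
  assumes "x \<in> carrier (E k)" "r \<odot>\<^bsub>E k\<^esub> x = \<zero>\<^bsub>E k\<^esub>" "r dvd s"
  shows "s \<odot>\<^bsub>E k\<^esub> x = \<zero>\<^bsub>E k\<^esub>"
proof -
  obtain t where "s = t * r" using assms(3) by (metis dvdE mult.commute)
  then have "s \<odot>\<^bsub>E k\<^esub> x = t \<odot>\<^bsub>E k\<^esub> (r \<odot>\<^bsub>E k\<^esub> x)" using assms(1) by (simp add: smult_smult)
  then show ?thesis using assms(2) by simp
qed

lemma tors_add: "x \<in> tors us k \<Longrightarrow> y \<in> tors us k \<Longrightarrow> x \<oplus>\<^bsub>E k\<^esub> y \<in> tors us k"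
proof (induction us)
  case (Cons u us)
  then obtain m n where mn: "u ^ m \<odot>\<^bsub>E k\<^esub> x = \<zero>\<^bsub>E k\<^esub>" "u ^ n \<odot>\<^bsub>E k\<^esub> y = \<zero>\<^bsub>E k\<^esub>"
    by (auto simp: tors_Cons)
  have "u ^ (m + n) \<odot>\<^bsub>E k\<^esub> x = \<zero>\<^bsub>E k\<^esub>" "u ^ (m + n) \<odot>\<^bsub>E k\<^esub> y = \<zero>\<^bsub>E k\<^esub>"
    using smult_eq_zero_mono[OF tors_carrier[OF Cons.prems(1)] mn(1)]
      smult_eq_zero_mono[OF tors_carrier[OF Cons.prems(2)] mn(2)] by (simp_all add: le_imp_power_dvd)
  then have "u ^ (m + n) \<odot>\<^bsub>E k\<^esub> (x \<oplus>\<^bsub>E k\<^esub> y) = \<zero>\<^bsub>E k\<^esub>"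
    using Cons.prems by (simp add: smult_add_right tors_carrier)
  then show ?case using Cons by (auto simp: tors_Cons)
qed simp

lemma tors_smult: "x \<in> tors us k \<Longrightarrow> r \<odot>\<^bsub>E k\<^esub> x \<in> tors us k"
proof (induction us)
  case (Cons u us)
  then obtain m where m: "u ^ m \<odot>\<^bsub>E k\<^esub> x = \<zero>\<^bsub>E k\<^esub>" by (auto simp: tors_Cons)
  have "u ^ m \<odot>\<^bsub>E k\<^esub> (r \<odot>\<^bsub>E k\<^esub> x) = r \<odot>\<^bsub>E k\<^esub> (u ^ m \<odot>\<^bsub>E k\<^esub> x)"
    using Cons.prems by (simp add: smult_smult tors_carrier mult.commute)
  then have "u ^ m \<odot>\<^bsub>E k\<^esub> (r \<odot>\<^bsub>E k\<^esub> x) = \<zero>\<^bsub>E k\<^esub>" using m by simp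
  then show ?case using Cons by (auto simp: tors_Cons)
qed simp

lemma tors_diff: "x \<in> tors us k \<Longrightarrow> y \<in> tors us k \<Longrightarrow> mdiff (E k) x y \<in> tors us k"
  by (simp add: mdiff_def tors_add tors_smult)

lemma tors_zero: "\<zero>\<^bsub>E k\<^esub> \<in> tors us k"
  by (simp add: tors_def)

lemma tors_d: "x \<in> tors us k \<Longrightarrow> d k x \<in> tors us (Suc k)"
proof (induction us)
  case (Cons u us)
  then obtain m where m: "u ^ m \<odot>\<^bsub>E k\<^esub> x = \<zero>\<^bsub>E k\<^esub>" by (auto simp: tors_Cons)
  then have "u ^ m \<odot>\<^bsub>E (Suc k)\<^esub> d k x = \<zero>\<^bsub>E (Suc k)\<^esub>"
    using Cons.prems d_smult[of x k "u ^ m"] by (simp add: tors_carrier d_zero)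
  then show ?case using Cons by (auto simp: tors_Cons)
qed simp

text \<open>This is the purpose of the annihilator clause in \<open>divisible\<close>: the powers
  that kill \<open>x\<close> also kill the quotient \<open>y\<close>, so division does not leave the
  torsion submodule.\<close>

lemma tors_divisible:
  assumes "x \<in> tors us k"
  shows "\<exists>m. \<exists>y\<in>tors us k. u ^ m \<odot>\<^bsub>E k\<^esub> x = u ^ (m + n) \<odot>\<^bsub>E k\<^esub> y"
proof -
  obtain m y where y: "y \<in> carrier (E k)" "u ^ m \<odot>\<^bsub>E k\<^esub> x = u ^ (m + n) \<odot>\<^bsub>E k\<^esub> y"
    "\<forall>r. r \<odot>\<^bsub>E k\<^esub> x = \<zero>\<^bsub>E k\<^esub> \<longrightarrow> r \<odot>\<^bsub>E k\<^esub> y = \<zero>\<^bsub>E k\<^esub>"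
    using divisible_power[OF tors_carrier[OF assms], of u n] by (elim exE bexE conjE)
  have "\<exists>n. v ^ n \<odot>\<^bsub>E k\<^esub> y = \<zero>\<^bsub>E k\<^esub>" if v: "v \<in> set us" for v
  proof -
    obtain n where "v ^ n \<odot>\<^bsub>E k\<^esub> x = \<zero>\<^bsub>E k\<^esub>" using assms v by (auto simp: tors_def)
    then show ?thesis using y(3) by (intro exI[of _ n]) simp
  qed
  then have "y \<in> tors us k" using y(1) by (simp add: tors_def)
  then show ?thesis using y(2) by (intro exI[of _ m] bexI[of _ y])
qed

text \<open>If \<open>u^n y\<close> is the coboundary of \<open>b\<close>, then \<open>y\<close>
  minus the coboundary of \<open>b / u^n\<close> is killed by a power of \<open>u\<close>.
  Subtracting a coboundary does not change the differential of \<open>y\<close>.\<close>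

lemma torsion_correction:
  assumes b: "b \<in> tors us j" and y: "y \<in> tors us (Suc j)"
    and eq: "u ^ n \<odot>\<^bsub>E (Suc j)\<^esub> y = d j b"
  shows "\<exists>y'\<in>tors (u # us) (Suc j). d (Suc j) y' = d (Suc j) y"
proof -
  \<comment> \<open>\<open>b'\<close> plays the role of \<open>b / u^n\<close>; the identity holds
    up to the factor \<open>u^m\<close>.\<close>
  obtain m b' where b': "b' \<in> tors us j" "u ^ m \<odot>\<^bsub>E j\<^esub> b = u ^ (m + n) \<odot>\<^bsub>E j\<^esub> b'"
    using tors_divisible[OF b, of u n] by (elim exE bexE)
  note carr = tors_carrier[OF b] tors_carrier[OF y] tors_carrier[OF b'(1)]
  let ?y = "mdiff (E (Suc j)) y (d j b')"
  have "u ^ (m + n) \<odot>\<^bsub>E (Suc j)\<^esub> ?y = mdiff (E (Suc j)) (u ^ m \<odot>\<^bsub>E (Suc j)\<^esub> (u ^ n \<odot>\<^bsub>E (Suc j)\<^esub> y))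
      (d j (u ^ (m + n) \<odot>\<^bsub>E j\<^esub> b'))"
    using carr by (simp add: smult_diff smult_smult d_smult power_add)
  also have "\<dots> = \<zero>\<^bsub>E (Suc j)\<^esub>"
    unfolding eq b'(2)[symmetric] using carr by (simp add: d_smult)
  finally have "?y \<in> tors (u # us) (Suc j)"
    using y b'(1) by (auto simp: tors_Cons tors_diff tors_d)
  moreover have "d (Suc j) ?y = d (Suc j) y"
    using carr by (simp add: d_diff d_d)
  ultimately show ?thesis by (intro bexI[of _ ?y])
qed

text \<open>Each element of the list costs one degree of exactness, because the induction hypothesis
  is used in two consecutive degrees: to write \<open>z\<close> as the differential of some
  \<open>y\<close>, and then to write the cocycle \<open>u^n y\<close> as a coboundary, after which
  \<open>y\<close> can be corrected.\<close>

lemma tors_exact: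
  assumes "z \<in> tors us (Suc k)" "length us \<le> k" "d (Suc k) z = \<zero>\<^bsub>E (Suc (Suc k))\<^esub>"
  shows "\<exists>y\<in>tors us k. d k y = z"
  using assms
proof (induction us arbitrary: k z)
  case Nil
  then show ?case using exact by simp
next
  case (Cons u us)
  obtain j where k: "k = Suc j" and j: "length us \<le> j" using Cons.prems(2) by (cases k) auto
  have z: "z \<in> tors us (Suc k)" using Cons.prems(1) by (simp add: tors_Cons)
  obtain n where n: "u ^ n \<odot>\<^bsub>E (Suc k)\<^esub> z = \<zero>\<^bsub>E (Suc k)\<^esub>"
    using Cons.prems(1) by (auto simp: tors_Cons)
  obtain y where y: "y \<in> tors us k" "d k y = z"
    using Cons.IH[OF z _ Cons.prems(3)] j k by auto
  have "d k (u ^ n \<odot>\<^bsub>E k\<^esub> y) = \<zero>\<^bsub>E (Suc k)\<^esub>"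
    using y n by (simp add: d_smult tors_carrier)
  then obtain b where b: "b \<in> tors us j" "d j b = u ^ n \<odot>\<^bsub>E k\<^esub> y"
    using Cons.IH[OF tors_smult[OF y(1)[unfolded k]] j, of "u ^ n"] unfolding k by auto
  show ?case
    using torsion_correction[OF b(1) y(1)[unfolded k] b(2)[symmetric, unfolded k]] y(2) k by simp
qed

section \<open>Fractions as names for top cohomology classes\<close>

text \<open>The cocycle \<open>z\<close> of the torsion complex stands for the fraction \<open>f / (u\<^sub>1 \<cdots> u\<^sub>s)\<^sup>n\<close>. Each step
  is the isomorphism of the top cohomology for \<open>u # us\<close> with the cokernel of the localisation map
  \<open>H \<rightarrow> H\<^sub>u\<close> on the top cohomology \<open>H\<close> for \<open>us\<close>: if \<open>z = d y\<close> then \<open>z\<close> corresponds to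
  \<open>u\<^sup>n y / u\<^sup>n\<close>.\<close>

primrec represents :: "'s list \<Rightarrow> nat \<Rightarrow> 'e \<Rightarrow> 's \<Rightarrow> bool" where
  "represents [] n z f \<longleftrightarrow> z = \<epsilon> f"
| "represents (u # us) n z f \<longleftrightarrow> (\<exists>y\<in>tors us (length us). z = d (length us) y \<and>
     represents us n (u ^ n \<odot>\<^bsub>E (length us)\<^esub> y) f)"

definition bound :: "'s list \<Rightarrow> nat \<Rightarrow> 'e set" where
  "bound us k = (case k of 0 \<Rightarrow> {\<zero>\<^bsub>E 0\<^esub>} | Suc j \<Rightarrow> d j ` tors us j)"

lemma bound_0 [simp]: "bound us 0 = {\<zero>\<^bsub>E 0\<^esub>}"
  and bound_Suc [simp]: "bound us (Suc j) = d j ` tors us j"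
  by (simp_all add: bound_def)

lemma zero_bound: "\<zero>\<^bsub>E k\<^esub> \<in> bound us k"
proof (cases k)
  case (Suc j)
  have "\<zero>\<^bsub>E (Suc j)\<^esub> = d j \<zero>\<^bsub>E j\<^esub>" by (simp add: d_zero)
  then show ?thesis using tors_zero Suc by simp
qed simp

text \<open>If \<open>z\<close> is the differential of \<open>y\<close>, then \<open>u^n z\<close>
  is the differential of \<open>u^n y\<close>, which is a cocycle by induction. Hence
  \<open>u^n\<close> kills \<open>z\<close>.\<close>

lemma represents_cocycle:
  assumes "represents us n z f"
  shows "z \<in> tors us (length us)" "d (length us) z = \<zero>\<^bsub>E (Suc (length us))\<^esub>"
proof -
  have "z \<in> tors us (length us) \<and> d (length us) z = \<zero>\<^bsub>E (Suc (length us))\<^esub>"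
    using assms
  proof (induction us arbitrary: z)
    case Nil
    then show ?case by (simp add: d_eps)
  next
    case (Cons u us)
    then obtain y where y: "y \<in> tors us (length us)" "z = d (length us) y"
      "represents us n (u ^ n \<odot>\<^bsub>E (length us)\<^esub> y) f" by auto
    have "u ^ n \<odot>\<^bsub>E (Suc (length us))\<^esub> z = \<zero>\<^bsub>E (Suc (length us))\<^esub>"
      using conjunct2[OF Cons.IH[OF y(3)]] y by (simp add: d_smult tors_carrier)
    then show ?case using y by (auto simp: tors_Cons tors_d d_d tors_carrier)
  qed
  then show "z \<in> tors us (length us)" "d (length us) z = \<zero>\<^bsub>E (Suc (length us))\<^esub>" by simp_all
qed

lemma represents_add:
  "represents us n z f \<Longrightarrow> represents us n z' f' \<Longrightarrow>
    represents us n (z \<oplus>\<^bsub>E (length us)\<^esub> z') (f + f')"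
proof (induction us arbitrary: z z')
  case Nil
  then show ?case by (simp add: eps_add)
next
  case (Cons u us)
  obtain y where y: "y \<in> tors us (length us)" "z = d (length us) y"
    "represents us n (u ^ n \<odot>\<^bsub>E (length us)\<^esub> y) f" using Cons.prems(1) by auto
  obtain y' where y': "y' \<in> tors us (length us)" "z' = d (length us) y'"
    "represents us n (u ^ n \<odot>\<^bsub>E (length us)\<^esub> y') f'" using Cons.prems(2) by auto
  note carr = tors_carrier[OF y(1)] tors_carrier[OF y'(1)]
  show ?case
    using Cons.IH[OF y(3) y'(3)] tors_add[OF y(1) y'(1)] carr y(2) y'(2)
    by (auto simp: d_add smult_add_right intro!: bexI[of _ "y \<oplus>\<^bsub>E (length us)\<^esub> y'"])
qed

lemma represents_smult:
  "represents us n z f \<Longrightarrow> represents us n (r \<odot>\<^bsub>E (length us)\<^esub> z) (r * f)"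
proof (induction us arbitrary: z)
  case Nil
  then show ?case by (simp add: eps_mult)
next
  case (Cons u us)
  obtain y where y: "y \<in> tors us (length us)" "z = d (length us) y"
    "represents us n (u ^ n \<odot>\<^bsub>E (length us)\<^esub> y) f" using Cons.prems(1) by auto
  note carr = tors_carrier[OF y(1)]
  show ?case
    using Cons.IH[OF y(3)] tors_smult[OF y(1), of r] carr y(2)
    by (auto simp: d_smult smult_smult mult.commute intro!: bexI[of _ "r \<odot>\<^bsub>E (length us)\<^esub> y"])
qed

lemma represents_diff:
  assumes "represents us n z f" "represents us n z' f'"
  shows "represents us n (mdiff (E (length us)) z z') (f - f')"
  using represents_add[OF assms(1) represents_smult[OF assms(2), of "-1"]] by (simp add: mdiff_def)

lemma represents_Suc:
  "represents us n z f \<Longrightarrow> represents us (Suc n) z (prod_list us * f)"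
proof (induction us arbitrary: z)
  case Nil
  then show ?case by simp
next
  case (Cons u us)
  obtain y where y: "y \<in> tors us (length us)" "z = d (length us) y"
    "represents us n (u ^ n \<odot>\<^bsub>E (length us)\<^esub> y) f" using Cons.prems(1) by auto
  show ?case
    using represents_smult[OF Cons.IH[OF y(3)], of u] tors_carrier[OF y(1)] y(1,2)
    by (auto simp: smult_smult mult.assoc intro!: bexI[of _ y])
qed

lemma represents_shift:
  "represents us n z f \<Longrightarrow> represents us (n + m) z (prod_list us ^ m * f)"
proof (induction m)
  case (Suc m)
  then show ?case using represents_Suc[OF Suc.IH[OF Suc.prems]] by (simp add: mult.assoc)
qed simp

text \<open>Division inside \<open>tors us\<close> works only up to a power of \<open>u\<close>, so
  the given exponent \<open>n\<close> may be too small. Expanding the fraction makes room for that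
  power.\<close>

lemma represents_total: "\<exists>m z. represents us (n + m) z (prod_list us ^ m * f)"
proof (induction us arbitrary: f)
  case Nil
  then show ?case by simp
next
  case (Cons u us)
  obtain l w where w: "represents us (n + l) w (prod_list us ^ l * f)"
    using Cons.IH[of f] by (elim exE)
  \<comment> \<open>The induction hypothesis expands by the product of \<open>us\<close> only; the
    factor \<open>u^l\<close> completes this to an expansion by the product of
    \<open>u # us\<close>.\<close>
  define w' where "w' = u ^ l \<odot>\<^bsub>E (length us)\<^esub> w"
  have w': "represents us (n + l) w' (u ^ l * (prod_list us ^ l * f))"
    unfolding w'_def by (rule represents_smult[OF w])
  obtain m y where y: "y \<in> tors us (length us)"
    "u ^ m \<odot>\<^bsub>E (length us)\<^esub> w' = u ^ (m + (n + l)) \<odot>\<^bsub>E (length us)\<^esub> y"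
    using tors_divisible[OF represents_cocycle(1)[OF w'], of u "n + l"] by (elim exE bexE)
  have "represents us (n + l + m) (u ^ m \<odot>\<^bsub>E (length us)\<^esub> w')
      (u ^ m * (prod_list us ^ m * (u ^ l * (prod_list us ^ l * f))))"
    by (rule represents_smult[OF represents_shift[OF w']])
  moreover have "u ^ m * (prod_list us ^ m * (u ^ l * (prod_list us ^ l * f))) =
      prod_list (u # us) ^ (l + m) * f"
    by (simp add: power_add power_mult_distrib mult_ac)
  ultimately have "represents us (n + (l + m)) (u ^ (n + (l + m)) \<odot>\<^bsub>E (length us)\<^esub> y)
      (prod_list (u # us) ^ (l + m) * f)"
    unfolding y(2) by (simp only: ac_simps)
  then have "represents (u # us) (n + (l + m)) (d (length us) y) (prod_list (u # us) ^ (l + m) * f)"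
    unfolding represents.simps using y(1) by (intro bexI[of _ y]) simp_all
  then show ?case by (intro exI)
qed

text \<open>The lower bound \<open>n0\<close> gives freedom in the exponent: the induction needs one
  that also covers the power of \<open>u\<close> killing \<open>z\<close>, and
  \<open>represents_bound_iff\<close> needs a common denominator for two fractions.\<close>

lemma represents_surj:
  "z \<in> tors us (length us) \<Longrightarrow> d (length us) z = \<zero>\<^bsub>E (Suc (length us))\<^esub> \<Longrightarrow>
    \<exists>n\<ge>n0. \<exists>f. represents us n z f"
proof (induction us arbitrary: z n0)
  case Nil
  then show ?case using eps_exact[of z] by auto
next
  case (Cons u us)
  have z: "z \<in> tors us (Suc (length us))" using Cons.prems(1) by (simp add: tors_Cons)
  obtain n where n: "u ^ n \<odot>\<^bsub>E (Suc (length us))\<^esub> z = \<zero>\<^bsub>E (Suc (length us))\<^esub>"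
    using Cons.prems(1) by (auto simp: tors_Cons)
  obtain y where y: "y \<in> tors us (length us)" "d (length us) y = z"
    using tors_exact[OF z] Cons.prems(2) by auto
  have "d (length us) (u ^ n \<odot>\<^bsub>E (length us)\<^esub> y) = \<zero>\<^bsub>E (Suc (length us))\<^esub>"
    using y n by (simp add: d_smult tors_carrier)
  from Cons.IH[OF tors_smult[OF y(1)] this, of "max n n0"] obtain N f where
    N: "N \<ge> max n n0" "represents us N (u ^ n \<odot>\<^bsub>E (length us)\<^esub> y) f" by (elim exE conjE)
  have "u ^ (N - n) \<odot>\<^bsub>E (length us)\<^esub> (u ^ n \<odot>\<^bsub>E (length us)\<^esub> y) = u ^ N \<odot>\<^bsub>E (length us)\<^esub> y"
    using N(1) tors_carrier[OF y(1)] by (simp add: smult_smult flip: power_add)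
  then have "represents us N (u ^ N \<odot>\<^bsub>E (length us)\<^esub> y) (u ^ (N - n) * f)"
    using represents_smult[OF N(2), of "u ^ (N - n)"] by simp
  then have "represents (u # us) N z (u ^ (N - n) * f)" using y by auto
  then show ?case using N(1) by (intro exI[of _ N] conjI exI[of _ "u ^ (N - n) * f"]) simp_all
qed

text \<open>The class of \<open>z\<close> vanishes iff \<open>y\<close> agrees, up to an element
  killed by a power of \<open>u\<close>, with a cocycle for \<open>us\<close>. The numerator of that
  cocycle accounts for the multiple of \<open>u^(n + m)\<close> in \<open>power_ideal\<close>; the
  remaining summand is the criterion for the shorter list.\<close>

lemma represents_bound_iff:
  "represents us n z f \<Longrightarrow>
    z \<in> bound us (length us) \<longleftrightarrow> (\<exists>m. prod_list us ^ m * f \<in> power_ideal I us (n + m))"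
proof (induction us arbitrary: n z f)
  case Nil
  then show ?case by (simp add: eps_kernel)
next
  case (Cons u us)
  let ?k = "length us" and ?Q = "prod_list us"
  obtain y where y: "y \<in> tors us ?k" "z = d ?k y" "represents us n (u ^ n \<odot>\<^bsub>E ?k\<^esub> y) f"
    using Cons.prems by auto
  note yc = tors_carrier[OF y(1)]
  show ?case
  proof
    assume "z \<in> bound (u # us) (length (u # us))"
    then obtain b where b: "b \<in> tors (u # us) ?k" "z = d ?k b" by auto
    then obtain m where m: "u ^ m \<odot>\<^bsub>E ?k\<^esub> b = \<zero>\<^bsub>E ?k\<^esub>" and b': "b \<in> tors us ?k"
      by (auto simp: tors_Cons)
    note bc = tors_carrier[OF b']
    have "d ?k (mdiff (E ?k) y b) = \<zero>\<^bsub>E (Suc ?k)\<^esub>"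
      using y(2) b(2) yc bc by (simp add: d_diff)
    from represents_surj[OF tors_diff[OF y(1) b'] this, of n] obtain N g
      where N: "N \<ge> n" "represents us N (mdiff (E ?k) y b) g" by (elim exE conjE)
    have "u ^ (n + m) \<odot>\<^bsub>E ?k\<^esub> mdiff (E ?k) y b = u ^ (n + m) \<odot>\<^bsub>E ?k\<^esub> y"
      using yc bc smult_eq_zero_mono[OF bc m, of "u ^ (n + m)"]
      by (simp add: smult_diff le_imp_power_dvd)
    then have r1: "represents us N (u ^ (n + m) \<odot>\<^bsub>E ?k\<^esub> y) (u ^ (n + m) * g)"
      using represents_smult[OF N(2), of "u ^ (n + m)"] by simp
    have r2: "represents us N (u ^ (n + m) \<odot>\<^bsub>E ?k\<^esub> y) (u ^ m * (?Q ^ (N - n) * f))"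
      using represents_smult[OF represents_shift[OF y(3), of "N - n"], of "u ^ m"] N(1) yc
      by (simp add: smult_smult power_add mult.commute)
    \<comment> \<open>Two numerators of the same cocycle: their difference is a numerator of zero,
      which is a coboundary, so the induction hypothesis turns it into ideal membership.\<close>
    have "represents us N \<zero>\<^bsub>E ?k\<^esub> (u ^ m * (?Q ^ (N - n) * f) - u ^ (n + m) * g)"
      using represents_diff[OF r2 r1] yc by simp
    then obtain M where M: "?Q ^ M * (u ^ m * (?Q ^ (N - n) * f) - u ^ (n + m) * g) \<in> power_ideal I us (N + M)"
      using Cons.IH zero_bound by blast
    define t where "t = M + (N - n)"
    have NM: "N + M = n + t" using N(1) by (simp add: t_def)
    let ?h = "?Q ^ M * (u ^ m * (?Q ^ (N - n) * f) - u ^ (n + m) * g)"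
    have h: "?h \<in> power_ideal I us (n + t)" using M NM by simp
    \<comment> \<open>Multiplying \<open>?h\<close> by \<open>?Q ^ m\<close> raises the exponents
      for \<open>us\<close> to the exponent \<open>n + (t + m)\<close> that \<open>u\<close> has
      reached.\<close>
    have "prod_list (u # us) ^ (t + m) * f =
        u ^ (n + (t + m)) * (?Q ^ m * ?Q ^ M * g) + u ^ t * (?Q ^ m * ?h)"
      by (simp add: algebra_simps power_mult_distrib power_add t_def)
    moreover have "u ^ t * (?Q ^ m * ?h) \<in> power_ideal I us (n + (t + m))"
      using power_ideal_mult[OF sub_ideal_I power_ideal_shift[OF sub_ideal_I h, of m]] by (simp add: add.assoc)
    ultimately have "prod_list (u # us) ^ (t + m) * f \<in> power_ideal I (u # us) (n + (t + m))"
      by auto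
    then show "\<exists>m. prod_list (u # us) ^ m * f \<in> power_ideal I (u # us) (n + m)" by (rule exI)
  next
    assume "\<exists>m. prod_list (u # us) ^ m * f \<in> power_ideal I (u # us) (n + m)"
    then obtain m g h where m: "prod_list (u # us) ^ m * f = u ^ (n + m) * g + h"
      "h \<in> power_ideal I us (n + m)" by auto
    \<comment> \<open>\<open>w\<close> is the cocycle for the fraction with numerator
      \<open>g\<close> and exponent \<open>n + m\<close>; subtracting it from \<open>y\<close>
      leaves only \<open>h\<close> to be treated.\<close>
    obtain l w where w: "represents us (n + m + l) w (?Q ^ l * g)"
      using represents_total[of us "n + m" g] by (elim exE)
    have wt: "w \<in> tors us ?k" and dw: "d ?k w = \<zero>\<^bsub>E (Suc ?k)\<^esub>"
      using represents_cocycle[OF w] by simp_all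
    note wc = tors_carrier[OF wt]
    have r1: "represents us (n + m + l) (u ^ (n + m) \<odot>\<^bsub>E ?k\<^esub> y) (u ^ m * (?Q ^ (m + l) * f))"
      using represents_smult[OF represents_shift[OF y(3), of "m + l"], of "u ^ m"] yc
      by (simp add: smult_smult power_add mult.commute add.assoc)
    have r2: "represents us (n + m + l) (u ^ (n + m) \<odot>\<^bsub>E ?k\<^esub> w) (u ^ (n + m) * (?Q ^ l * g))"
      by (rule represents_smult[OF w])
    have "u ^ m * (?Q ^ (m + l) * f) - u ^ (n + m) * (?Q ^ l * g) =
        ?Q ^ l * (prod_list (u # us) ^ m * f - u ^ (n + m) * g)"
      by (simp add: algebra_simps power_mult_distrib power_add)
    also have "\<dots> = ?Q ^ l * h" unfolding m(1) by simp
    finally have "represents us (n + m + l) (u ^ (n + m) \<odot>\<^bsub>E ?k\<^esub> mdiff (E ?k) y w) (?Q ^ l * h)"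
      using represents_diff[OF r1 r2] yc wc by (simp add: smult_diff)
    moreover have "?Q ^ 0 * (?Q ^ l * h) \<in> power_ideal I us (n + m + l + 0)"
      using power_ideal_shift[OF sub_ideal_I m(2), of l] by simp
    ultimately have bd: "u ^ (n + m) \<odot>\<^bsub>E ?k\<^esub> mdiff (E ?k) y w \<in> bound us ?k"
      using Cons.IH by blast
    have yw: "mdiff (E ?k) y w \<in> tors us ?k" by (rule tors_diff[OF y(1) wt])
    have zd: "z = d ?k (mdiff (E ?k) y w)" using y(2) dw yc wc by (simp add: d_diff)
    \<comment> \<open>In degree 0 zero is the only coboundary, so \<open>y - w\<close> is already
      killed by a power of \<open>u\<close>; in higher degrees it has to be corrected by a
      coboundary.\<close>
    have "\<exists>y'\<in>tors (u # us) ?k. d ?k (mdiff (E ?k) y w) = d ?k y'"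
    proof (cases ?k)
      case 0
      then have "u ^ (n + m) \<odot>\<^bsub>E ?k\<^esub> mdiff (E ?k) y w = \<zero>\<^bsub>E ?k\<^esub>" using bd by simp
      then have "mdiff (E ?k) y w \<in> tors (u # us) ?k" using yw unfolding tors_Cons by (intro conjI exI)
      then show ?thesis by (intro bexI) simp_all
    next
      case (Suc j)
      then obtain b where "b \<in> tors us j" "u ^ (n + m) \<odot>\<^bsub>E ?k\<^esub> mdiff (E ?k) y w = d j b"
        using bd by auto
      then show ?thesis using torsion_correction[of b us j "mdiff (E ?k) y w" u "n + m"] yw
        unfolding Suc by (simp add: eq_commute)
    qed
    then show "z \<in> bound (u # us) (length (u # us))" unfolding zd by (simp add: image_iff)
  qed
qed

end

section \<open>Injective modules over quotient rings\<close>

lemma type_ring_simps [simp]: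
  "carrier (ring_of_type_algebra :: 's::comm_ring_1 ring) = UNIV"
  "x \<otimes>\<^bsub>ring_of_type_algebra\<^esub> y = (x * y :: 's::comm_ring_1)"
  "x \<oplus>\<^bsub>ring_of_type_algebra\<^esub> y = (x + y :: 's::comm_ring_1)"
  "\<one>\<^bsub>ring_of_type_algebra\<^esub> = (1 :: 's::comm_ring_1)"
  "\<zero>\<^bsub>ring_of_type_algebra\<^esub> = (0 :: 's::comm_ring_1)"
  by (simp_all add: ring_of_type_algebra_def)

locale quotient_ring =
  fixes I :: "'s::comm_ring_1 set" and R :: "'s set ring"
  assumes I: "ideal I ring_of_type_algebra" and R: "R = ring_of_type_algebra Quot I"
begin

definition proj :: "'s \<Rightarrow> 's set" where "proj f = I +>\<^bsub>ring_of_type_algebra\<^esub> f"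

lemma cring_R: "cring R"
  unfolding R by (rule ideal.quotient_is_cring[OF I cring_from_type_algebra])

lemma sub_ideal_I: "sub_ideal UNIV I"
  using I by (simp add: sub_ideal_UNIV_iff)

lemma carrier_R: "carrier R = range proj"
  by (auto simp: R FactRing_def A_RCOSETS_def' proj_def[abs_def])

lemma proj_closed [simp]: "proj f \<in> carrier R"
  by (simp add: carrier_R)

lemma proj_hom:
  shows proj_add: "proj (f + g) = proj f \<oplus>\<^bsub>R\<^esub> proj g"
    and proj_mult: "proj (f * g) = proj f \<otimes>\<^bsub>R\<^esub> proj g"
    and proj_one: "proj 1 = \<one>\<^bsub>R\<^esub>"
    and proj_zero: "proj 0 = \<zero>\<^bsub>R\<^esub>"
proof -
  have h: "proj \<in> ring_hom ring_of_type_algebra R"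
    using ideal.rcos_ring_hom[OF I] unfolding R proj_def[abs_def] .
  show "proj (f + g) = proj f \<oplus>\<^bsub>R\<^esub> proj g" "proj (f * g) = proj f \<otimes>\<^bsub>R\<^esub> proj g" "proj 1 = \<one>\<^bsub>R\<^esub>"
    using ring_hom_add[OF h, of f g] ring_hom_mult[OF h, of f g] ring_hom_one[OF h] by simp_all
  show "proj 0 = \<zero>\<^bsub>R\<^esub>"
    using ring_hom_zero[OF h ring_from_type_algebra] cring_R by (simp add: cring.axioms)
qed

lemma proj_eq_iff: "proj f = proj g \<longleftrightarrow> f - g \<in> I"
proof -
  interpret ring "ring_of_type_algebra :: 's ring" by (rule ring_from_type_algebra)
  have "\<ominus>\<^bsub>ring_of_type_algebra\<^esub> g = -g" by (rule minus_equality) simp_all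
  then have "f \<ominus>\<^bsub>ring_of_type_algebra\<^esub> g = f - g" by (simp add: a_minus_def)
  then show ?thesis using quotient_eq_iff_same_a_r_cos[OF I, of f g] by (simp add: proj_def)
qed

lemma proj_eq_zero_iff: "proj f = \<zero>\<^bsub>R\<^esub> \<longleftrightarrow> f \<in> I"
  using proj_eq_iff[of f 0] by (simp add: proj_zero)

text \<open>Restriction of scalars from \<open>R\<close> to \<open>S\<close>, which lets the
  complexes above work with elements of a ring type instead of cosets.\<close>

definition pullback :: "('s set, 'm) module \<Rightarrow> ('s, 'm) module" where
  "pullback M = \<lparr>carrier = carrier M, monoid.mult = monoid.mult M, one = one M,
     ring.zero = ring.zero M, add = add M, module.smult = (\<lambda>f x. proj f \<odot>\<^bsub>M\<^esub> x)\<rparr>"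

lemma pullback_simps [simp]:
  "carrier (pullback M) = carrier M" "\<zero>\<^bsub>pullback M\<^esub> = \<zero>\<^bsub>M\<^esub>"
  "x \<oplus>\<^bsub>pullback M\<^esub> y = x \<oplus>\<^bsub>M\<^esub> y" "f \<odot>\<^bsub>pullback M\<^esub> x = proj f \<odot>\<^bsub>M\<^esub> x"
  by (simp_all add: pullback_def)

lemma module_pullback:
  assumes M: "module R M"
  shows "module ring_of_type_algebra (pullback M)"
proof -
  interpret module R M by fact
  have inv: "\<exists>y\<in>carrier M. y \<oplus>\<^bsub>M\<^esub> x = \<zero>\<^bsub>M\<^esub>" if "x \<in> carrier M" for x
    by (rule bexI[of _ "\<ominus>\<^bsub>M\<^esub> x"]) (use that in \<open>simp_all add: M.l_neg\<close>)
  show ?thesis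
  proof (rule moduleI)
    show "cring (ring_of_type_algebra :: 's ring)" by (rule cring_from_type_algebra)
    show "abelian_group (pullback M)"
      by (rule abelian_groupI) (use inv in \<open>simp_all add: M.a_ac\<close>)
  qed (simp_all add: proj_hom smult_l_distr smult_r_distr smult_assoc1)
qed

text \<open>The image of \<open>B\<close> in \<open>R\<close> as a submodule of the regular module;
  injectivity is tested only on inclusions of such modules into \<open>R\<close>.\<close>

definition ideal_module :: "'s set \<Rightarrow> ('s set, 's set) module" where
  "ideal_module B = (regular_module R)\<lparr>carrier := proj ` B\<rparr>"

lemma ideal_module_simps [simp]:
  "carrier (ideal_module B) = proj ` B" "\<zero>\<^bsub>ideal_module B\<^esub> = \<zero>\<^bsub>R\<^esub>"
  "x \<oplus>\<^bsub>ideal_module B\<^esub> y = x \<oplus>\<^bsub>R\<^esub> y" "r \<odot>\<^bsub>ideal_module B\<^esub> x = r \<otimes>\<^bsub>R\<^esub> x"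
  by (simp_all add: ideal_module_def regular_module_def)

lemma module_ideal_module:
  assumes B: "sub_ideal UNIV B"
  shows "module R (ideal_module B)"
proof -
  interpret cring R by (rule cring_R)
  have add: "x \<oplus>\<^bsub>R\<^esub> y \<in> proj ` B" if xy: "x \<in> proj ` B" "y \<in> proj ` B" for x y
  proof -
    obtain f g where fg: "f \<in> B" "g \<in> B" "x = proj f" "y = proj g" using xy by blast
    then have "x \<oplus>\<^bsub>R\<^esub> y = proj (f + g)" by (simp add: proj_hom)
    then show ?thesis using sub_idealD(3)[OF B fg(1,2)] by simp
  qed
  have mult: "r \<otimes>\<^bsub>R\<^esub> x \<in> proj ` B" if rx: "r \<in> carrier R" "x \<in> proj ` B" for r x
  proof -
    obtain f g where fg: "g \<in> B" "r = proj f" "x = proj g" using rx carrier_R by blast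
    then have "r \<otimes>\<^bsub>R\<^esub> x = proj (f * g)" by (simp add: proj_hom)
    then show ?thesis using sub_idealD(4)[OF B _ fg(1)] by simp
  qed
  have sub: "x \<in> carrier R" if "x \<in> proj ` B" for x using that by auto
  have inv: "\<exists>y\<in>proj ` B. y \<oplus>\<^bsub>R\<^esub> x = \<zero>\<^bsub>R\<^esub>" if "x \<in> proj ` B" for x
    using mult[of "\<ominus>\<^bsub>R\<^esub> \<one>\<^bsub>R\<^esub>" x] sub[OF that] that
    by (intro bexI[of _ "\<ominus>\<^bsub>R\<^esub> \<one>\<^bsub>R\<^esub> \<otimes>\<^bsub>R\<^esub> x"]) (simp_all add: l_minus l_neg)
  have zero: "\<zero>\<^bsub>R\<^esub> \<in> proj ` B" using sub_idealD(2)[OF B] proj_zero by (metis imageI)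
  have "abelian_group (ideal_module B)"
    by (rule abelian_groupI) (use add inv zero sub in \<open>simp_all add: a_ac\<close>)
  then show ?thesis
    by (intro moduleI cring_R) (use mult sub in \<open>simp_all add: l_distr r_distr m_assoc\<close>)
qed

lemma ideal_module_UNIV: "ideal_module UNIV = regular_module R"
  by (simp add: ideal_module_def carrier_R[symmetric]) (simp add: regular_module_def)

text \<open>A linear map that kills \<open>I\<close> factors through the image of \<open>B\<close>
  in \<open>R\<close>. Injectivity extends it to all of \<open>R\<close>, and \<open>y\<close> is
  the value of the extension at one.\<close>

lemma injective_extend:
  assumes inj: "injective_module R M" and B: "sub_ideal UNIV B" and IB: "I \<subseteq> B"
    and g: "\<And>b. b \<in> B \<Longrightarrow> g b \<in> carrier M"
    and g_add: "\<And>a b. a \<in> B \<Longrightarrow> b \<in> B \<Longrightarrow> g (a + b) = g a \<oplus>\<^bsub>M\<^esub> g b"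
    and g_mult: "\<And>r b. b \<in> B \<Longrightarrow> g (r * b) = proj r \<odot>\<^bsub>M\<^esub> g b"
    and g_I: "\<And>b. b \<in> I \<Longrightarrow> g b = \<zero>\<^bsub>M\<^esub>"
  shows "\<exists>y\<in>carrier M. \<forall>b\<in>B. g b = proj b \<odot>\<^bsub>M\<^esub> y"
proof -
  have M: "module R M" using inj by (simp add: injective_module_def)
  interpret M: module R M by fact
  \<comment> \<open>The chosen representative is immaterial: two of them differ by an element of
    \<open>I\<close>, where \<open>g\<close> vanishes.\<close>
  define g' where "g' x = g (SOME b. b \<in> B \<and> proj b = x)" for x
  have g': "g' (proj b) = g b" if b: "b \<in> B" for b
  proof -
    let ?c = "SOME c. c \<in> B \<and> proj c = proj b"
    have c: "?c \<in> B \<and> proj ?c = proj b" by (rule someI[of _ b]) (simp add: b)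
    then have bc: "?c - b \<in> I" by (simp add: proj_eq_iff)
    have "g ?c = g (b + (?c - b))" by simp
    also have "\<dots> = g b \<oplus>\<^bsub>M\<^esub> g (?c - b)" using b bc IB by (intro g_add) auto
    also have "\<dots> = g b" using g_I[OF bc] g[OF b] by simp
    finally show ?thesis by (simp add: g'_def)
  qed
  have 1: "module R (ideal_module B)" by (rule module_ideal_module[OF B])
  have 2: "module R (regular_module R)"
    using module_ideal_module[of UNIV] ideal_module_UNIV by (simp add: sub_ideal_def)
  have 3: "(\<lambda>x. x) \<in> module_hom R (ideal_module B) (regular_module R)"
    by (auto simp: module_hom_def regular_module_def)
  have 4: "g' \<in> module_hom R (ideal_module B) M"
    unfolding module_hom_def
  proof (intro CollectI conjI ballI)
    show "g' \<in> carrier (ideal_module B) \<rightarrow> carrier M" using g' g by auto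
  next
    fix x y assume "x \<in> carrier (ideal_module B)" "y \<in> carrier (ideal_module B)"
    then obtain a b where ab: "a \<in> B" "b \<in> B" "x = proj a" "y = proj b" by auto
    then show "g' (x \<oplus>\<^bsub>ideal_module B\<^esub> y) = g' x \<oplus>\<^bsub>M\<^esub> g' y"
      using g'[OF sub_idealD(3)[OF B ab(1,2)]] g' g_add by (simp add: proj_add)
  next
    fix r x assume "r \<in> carrier R" "x \<in> carrier (ideal_module B)"
    then obtain f b where ab: "b \<in> B" "r = proj f" "x = proj b" by (auto simp: carrier_R)
    then show "g' (r \<odot>\<^bsub>ideal_module B\<^esub> x) = r \<odot>\<^bsub>M\<^esub> g' x"
      using g'[OF sub_idealD(4)[OF B UNIV_I ab(1), of f]] g' g_mult by (simp add: proj_mult)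
  qed
  have "inj_on (\<lambda>x. x) (carrier (ideal_module B))" by simp
  then obtain h where h: "h \<in> module_hom R (regular_module R) M"
    "\<forall>x\<in>carrier (ideal_module B). h x = g' x"
    using inj 1 2 3 4 unfolding injective_module_def by metis
  have "g b = proj b \<odot>\<^bsub>M\<^esub> h \<one>\<^bsub>R\<^esub>" if b: "b \<in> B" for b
  proof -
    have "g b = h (proj b)" using h(2) g' b by simp
    also have "\<dots> = h (proj b \<otimes>\<^bsub>R\<^esub> \<one>\<^bsub>R\<^esub>)" by simp
    also have "\<dots> = proj b \<odot>\<^bsub>M\<^esub> h \<one>\<^bsub>R\<^esub>"
    proof -
      have "\<forall>r\<in>carrier R. \<forall>x\<in>carrier R. h (r \<otimes>\<^bsub>R\<^esub> x) = r \<odot>\<^bsub>M\<^esub> h x"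
        using h(1) by (simp add: module_hom_def regular_module_def)
      then show ?thesis using proj_closed M.R.one_closed by blast
    qed
    finally show ?thesis .
  qed
  moreover have "h \<one>\<^bsub>R\<^esub> \<in> carrier M"
    using h(1) proj_closed[of 1] by (auto simp: module_hom_def regular_module_def proj_one)
  ultimately show ?thesis by blast
qed

text \<open>The ascending chain condition stabilises the annihilators of \<open>u\<^sup>n x\<close>; then
  \<open>u\<^sup>n\<^sup>+\<^sup>1 r + b \<mapsto> r u\<^sup>n x\<close> is well defined on the ideal generated by \<open>u\<^sup>n\<^sup>+\<^sup>1\<close> and the
  annihilator of \<open>x\<close>, and injectivity makes it multiplication by some \<open>y\<close>.\<close>

lemma injective_divisible:
  assumes acc: "acc_on (UNIV :: 's set)" and inj: "injective_module R M" and x: "x \<in> carrier M"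
  shows "\<exists>m. \<exists>y\<in>carrier M. proj (u ^ m) \<odot>\<^bsub>M\<^esub> x = proj (u ^ Suc m) \<odot>\<^bsub>M\<^esub> y \<and>
     (\<forall>r. proj r \<odot>\<^bsub>M\<^esub> x = \<zero>\<^bsub>M\<^esub> \<longrightarrow> proj r \<odot>\<^bsub>M\<^esub> y = \<zero>\<^bsub>M\<^esub>)"
proof -
  have M: "module R M" using inj by (simp add: injective_module_def)
  interpret M: module R M by fact
  interpret P: type_module "pullback M" by (rule type_module.intro[OF module_pullback[OF M]])
  have sm: "proj f \<odot>\<^bsub>M\<^esub> y \<in> carrier M" if "y \<in> carrier M" for f y
    using P.smult_closed[of y f] that by simp
  have add: "proj (f + g) \<odot>\<^bsub>M\<^esub> y = proj f \<odot>\<^bsub>M\<^esub> y \<oplus>\<^bsub>M\<^esub> proj g \<odot>\<^bsub>M\<^esub> y" if "y \<in> carrier M" for f g y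
    using P.smult_add_left[of y f g] that by simp
  have mult: "proj (f * g) \<odot>\<^bsub>M\<^esub> y = proj f \<odot>\<^bsub>M\<^esub> (proj g \<odot>\<^bsub>M\<^esub> y)" if "y \<in> carrier M" for f g y
    using P.smult_smult[of y f g] that by simp
  have null: "proj f \<odot>\<^bsub>M\<^esub> \<zero>\<^bsub>M\<^esub> = \<zero>\<^bsub>M\<^esub>" for f
    using P.smult_zero[of f] by simp
  have zero: "proj 0 \<odot>\<^bsub>M\<^esub> y = \<zero>\<^bsub>M\<^esub>" if "y \<in> carrier M" for y
    using P.zero_smult[of y] that by simp
  define J where "J n = {r. proj (r * u ^ n) \<odot>\<^bsub>M\<^esub> x = \<zero>\<^bsub>M\<^esub>}" for n
  have "sub_ideal UNIV (J n)" for n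
    unfolding sub_ideal_def J_def using x
    by (auto simp: distrib_right add mult.assoc mult zero null sm)
  moreover have "mono J"
    unfolding mono_iff_le_Suc
  proof (intro allI subsetI)
    fix n r assume r: "r \<in> J n"
    have "proj (r * u ^ Suc n) \<odot>\<^bsub>M\<^esub> x = proj u \<odot>\<^bsub>M\<^esub> (proj (r * u ^ n) \<odot>\<^bsub>M\<^esub> x)"
      using mult[OF x, of u "r * u ^ n"] by (simp add: mult_ac)
    then show "r \<in> J (Suc n)" using r null by (simp add: J_def)
  qed
  ultimately obtain N where N: "\<forall>n\<ge>N. J n = J N" by (rule acc_onD[OF acc, THEN exE])
  have JN: "J (Suc N) = J N" by (rule mp[OF spec[OF N]]) simp
  define A where "A = {r. proj r \<odot>\<^bsub>M\<^esub> x = \<zero>\<^bsub>M\<^esub>}"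
  have A: "sub_ideal UNIV A"
    unfolding sub_ideal_def A_def using x by (auto simp: add mult zero null)
  \<comment> \<open>\<open>A\<close> is included in \<open>B\<close> so that the extension is
    prescribed to be zero there; this makes \<open>y\<close> be killed by everything that kills
    \<open>x\<close>.\<close>
  define B where "B = {u ^ Suc N * r + b |r b. b \<in> A}"
  have BI: "u ^ Suc N * r + b \<in> B" if "b \<in> A" for r b using that unfolding B_def by blast
  have BE: "\<exists>r b. c = u ^ Suc N * r + b \<and> b \<in> A" if "c \<in> B" for c
    using that unfolding B_def by blast
  have B: "sub_ideal UNIV B"
    unfolding sub_ideal_def
  proof (intro conjI ballI)
    show "0 \<in> B" using BI[OF sub_idealD(2)[OF A], of 0] by simp
  next
    fix f g assume "f \<in> B" "g \<in> B"
    then obtain r b s c where "f = u ^ Suc N * r + b" "b \<in> A" "g = u ^ Suc N * s + c" "c \<in> A"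
      using BE by meson
    moreover from this have "u ^ Suc N * (r + s) + (b + c) \<in> B"
      by (intro BI sub_idealD(3)[OF A])
    ultimately show "f + g \<in> B" by (simp add: algebra_simps)
  next
    fix f g assume "g \<in> B"
    then obtain s c where "g = u ^ Suc N * s + c" "c \<in> A" using BE by meson
    moreover from this have "u ^ Suc N * (f * s) + f * c \<in> B"
      by (intro BI sub_idealD(4)[OF A UNIV_I])
    ultimately show "f * g \<in> B" by (simp add: algebra_simps)
  qed simp
  define g where "g c = proj ((SOME r. \<exists>b\<in>A. c = u ^ Suc N * r + b) * u ^ N) \<odot>\<^bsub>M\<^esub> x" for c
  have g: "g (u ^ Suc N * r + b) = proj (r * u ^ N) \<odot>\<^bsub>M\<^esub> x" if b: "b \<in> A" for r b
  proof -
    let ?s = "SOME s. \<exists>c\<in>A. u ^ Suc N * r + b = u ^ Suc N * s + c"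
    have "\<exists>c\<in>A. u ^ Suc N * r + b = u ^ Suc N * ?s + c"
      by (rule someI[of _ r]) (use b in blast)
    then obtain c where c: "c \<in> A" "u ^ Suc N * r + b = u ^ Suc N * ?s + c" by (rule bexE)
    \<comment> \<open>Two coefficients of the same element differ by a member of
      \<open>J (Suc N)\<close>, which equals \<open>J N\<close>; hence they act equally on
      \<open>u^N x\<close>.\<close>
    have "(?s - r) * u ^ Suc N = b + (-1) * c" using c(2) by (simp add: algebra_simps)
    moreover have "b + (-1) * c \<in> A"
      using sub_idealD(3)[OF A b sub_idealD(4)[OF A UNIV_I c(1)]] .
    ultimately have "?s - r \<in> J (Suc N)" by (simp add: J_def A_def del: power_Suc)
    then have "?s - r \<in> J N" using JN by simp
    then have "proj ((?s - r) * u ^ N) \<odot>\<^bsub>M\<^esub> x = \<zero>\<^bsub>M\<^esub>" by (simp add: J_def)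
    moreover have "?s * u ^ N = r * u ^ N + (?s - r) * u ^ N" by (simp add: algebra_simps)
    ultimately show ?thesis unfolding g_def using add[OF x, of "r * u ^ N" "(?s - r) * u ^ N"] sm[OF x]
      by (simp del: power_Suc)
  qed
  have AB: "A \<subseteq> B" using BI[of _ 0] by auto
  have gA: "g b = \<zero>\<^bsub>M\<^esub>" if "b \<in> A" for b using g[OF that, of 0] zero[OF x] by simp
  have IA: "I \<subseteq> A"
  proof
    fix b assume "b \<in> I"
    then have "proj b = proj 0" by (simp add: proj_eq_iff)
    then show "b \<in> A" using zero[OF x] by (simp add: A_def)
  qed
  have "\<exists>y\<in>carrier M. \<forall>b\<in>B. g b = proj b \<odot>\<^bsub>M\<^esub> y"
  proof (rule injective_extend[OF inj B subset_trans[OF IA AB]])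
    show "g b \<in> carrier M" for b by (simp add: g_def sm x)
    show "g b = \<zero>\<^bsub>M\<^esub>" if "b \<in> I" for b using gA IA that by blast
  next
    fix e f assume "e \<in> B" "f \<in> B"
    then obtain r b s c where ef: "e = u ^ Suc N * r + b" "b \<in> A" "f = u ^ Suc N * s + c" "c \<in> A"
      using BE by meson
    have "e + f = u ^ Suc N * (r + s) + (b + c)" unfolding ef by (simp add: algebra_simps)
    then have "g (e + f) = proj ((r + s) * u ^ N) \<odot>\<^bsub>M\<^esub> x"
      using g[OF sub_idealD(3)[OF A ef(2,4)], of "r + s"] by simp
    then show "g (e + f) = g e \<oplus>\<^bsub>M\<^esub> g f"
      unfolding ef(1,3) g[OF ef(2)] g[OF ef(4)] using add[OF x] by (simp add: distrib_right)
  next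
    fix f e assume "e \<in> B"
    then obtain r b where e: "e = u ^ Suc N * r + b" "b \<in> A" using BE by meson
    have "f * e = u ^ Suc N * (f * r) + f * b" unfolding e by (simp add: algebra_simps)
    then have "g (f * e) = proj (f * r * u ^ N) \<odot>\<^bsub>M\<^esub> x"
      using g[OF sub_idealD(4)[OF A UNIV_I e(2), of f], of "f * r"] by simp
    then show "g (f * e) = proj f \<odot>\<^bsub>M\<^esub> g e"
      unfolding e(1) g[OF e(2)] using mult[OF x] by (simp add: mult.assoc)
  qed
  then obtain y where y: "y \<in> carrier M" "\<forall>b\<in>B. g b = proj b \<odot>\<^bsub>M\<^esub> y" by (rule bexE)
  have "g (u ^ Suc N) = proj (u ^ N) \<odot>\<^bsub>M\<^esub> x" "u ^ Suc N \<in> B"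
    using g[OF sub_idealD(2)[OF A], of 1] BI[OF sub_idealD(2)[OF A], of 1] by simp_all
  then have "proj (u ^ N) \<odot>\<^bsub>M\<^esub> x = proj (u ^ Suc N) \<odot>\<^bsub>M\<^esub> y" using y(2) by (simp del: power_Suc)
  moreover have "proj r \<odot>\<^bsub>M\<^esub> y = \<zero>\<^bsub>M\<^esub>" if "proj r \<odot>\<^bsub>M\<^esub> x = \<zero>\<^bsub>M\<^esub>" for r
  proof -
    have "r \<in> A" using that by (simp add: A_def)
    then show ?thesis using y(2) gA subsetD[OF AB] by simp
  qed
  ultimately show ?thesis using y(1) by (intro exI[of _ N] bexI[of _ y]) simp_all
qed

end

section \<open>Local cohomology\<close>

context quotient_ring
begin

lemma ideal_image:
  assumes "sub_ideal UNIV K"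
  shows "ideal (proj ` K) R"
  using ring.ring_ideal_imp_quot_ideal[OF ring_from_type_algebra I, of K] assms
  by (simp add: sub_ideal_UNIV_iff R proj_def[abs_def])

lemma genideal_proj_subset:
  assumes "sub_ideal UNIV K" "Y \<subseteq> K"
  shows "genideal R (proj ` Y) \<subseteq> proj ` K"
  using ring.genideal_minimal[OF cring.axioms(1)[OF cring_R] ideal_image[OF assms(1)]] assms(2)
  by (simp add: image_mono)

text \<open>The next power of the ideal is the product of its \<open>n\<close>-th power with the
  ideal itself, and the scalars \<open>f\<close> for which the \<open>n\<close>-th power kills
  \<open>f x\<close> form an ideal. That ideal contains the generators, hence everything they
  generate.\<close>

lemma power_step:
  assumes "module R M" and x: "x \<in> carrier M" and us: "\<And>u. u \<in> set us \<Longrightarrow>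
      \<forall>a\<in>(genideal R (proj ` set us)) [^]\<^bsub>ideals_set R\<^esub> (n::nat). a \<odot>\<^bsub>M\<^esub> (proj u \<odot>\<^bsub>M\<^esub> x) = \<zero>\<^bsub>M\<^esub>"
  shows "\<forall>a\<in>(genideal R (proj ` set us)) [^]\<^bsub>ideals_set R\<^esub> Suc n. a \<odot>\<^bsub>M\<^esub> x = \<zero>\<^bsub>M\<^esub>"
proof
  interpret module R M by fact
  let ?J = "genideal R (proj ` set us)"
  let ?P = "?J [^]\<^bsub>ideals_set R\<^esub> n"
  interpret S: comm_monoid "ideals_set R" by (rule cring.ideals_set_is_comm_monoid[OF cring_R])
  have J: "?J \<in> carrier (ideals_set R)"
    by (simp add: ideals_set_def genideal_ideal image_subset_iff)
  have "?P \<in> carrier (ideals_set R)" by (rule S.nat_pow_closed[OF J])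
  then have P: "a \<in> carrier R" if "a \<in> ?P" for a
    using that ideal.Icarr by (auto simp: ideals_set_def)
  define K where "K = {f. \<forall>a\<in>?P. a \<odot>\<^bsub>M\<^esub> (proj f \<odot>\<^bsub>M\<^esub> x) = \<zero>\<^bsub>M\<^esub>}"
  have "sub_ideal UNIV K"
    unfolding sub_ideal_def
  proof (intro conjI ballI)
    show "0 \<in> K" using x P by (simp add: K_def proj_zero)
  next
    fix f g assume "f \<in> K" "g \<in> K"
    then show "f + g \<in> K" using x P by (simp add: K_def proj_add smult_l_distr smult_r_distr)
  next
    fix f g assume g: "g \<in> K"
    have "a \<odot>\<^bsub>M\<^esub> (proj f \<odot>\<^bsub>M\<^esub> y) = proj f \<odot>\<^bsub>M\<^esub> (a \<odot>\<^bsub>M\<^esub> y)" if "a \<in> ?P" "y \<in> carrier M" for a y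
      using that P by (simp flip: smult_assoc1 add: m_comm)
    then show "f * g \<in> K" using x g by (simp add: K_def proj_mult smult_assoc1)
  qed simp
  then have K: "?J \<subseteq> proj ` K" using us by (intro genideal_proj_subset) (auto simp: K_def)
  have Jc: "a \<in> carrier R" if "a \<in> ?J" for a using K that by auto
  fix a assume "a \<in> ?J [^]\<^bsub>ideals_set R\<^esub> Suc n"
  then have "a \<in> ideal_prod R ?P ?J" by (simp add: ideals_set_def nat_pow_def)
  then have "a \<in> carrier R \<and> a \<odot>\<^bsub>M\<^esub> x = \<zero>\<^bsub>M\<^esub>"
  proof induction
    case (prod i j)
    then show ?case using P Jc K x by (auto simp: K_def smult_assoc1)
  next
    case (sum s t)
    then show ?case using x by (simp add: smult_l_distr)
  qed
  then show "a \<odot>\<^bsub>M\<^esub> x = \<zero>\<^bsub>M\<^esub>" by simp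
qed

lemma power_descending:
  fixes J :: "'s set set"
  assumes "ideal J R" "m \<le> n"
  shows "J [^]\<^bsub>ideals_set R\<^esub> (n::nat) \<subseteq> J [^]\<^bsub>ideals_set R\<^esub> (m::nat)"
proof (rule lift_Suc_antimono_le[OF _ assms(2)])
  fix n :: nat
  interpret cring R by (rule cring_R)
  interpret S: comm_monoid "ideals_set R" by (rule cring.ideals_set_is_comm_monoid[OF cring_R])
  have "J [^]\<^bsub>ideals_set R\<^esub> n \<in> carrier (ideals_set R)"
    by (rule S.nat_pow_closed) (simp add: ideals_set_def assms(1))
  then have "ideal (J [^]\<^bsub>ideals_set R\<^esub> n) R" by (simp add: ideals_set_def)
  from ideal_prod_inter[OF this assms(1)]
  show "J [^]\<^bsub>ideals_set R\<^esub> Suc n \<subseteq> J [^]\<^bsub>ideals_set R\<^esub> n"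
    by (simp add: ideals_set_def nat_pow_def)
qed

text \<open>Induction on the sum of the exponents: for \<open>proj u\<close> times \<open>x\<close>
  the exponent of \<open>u\<close> can be lowered by one, and \<open>power_step\<close> returns from
  these products to \<open>x\<close>, at the largest of the finitely many powers involved.\<close>

lemma torsion_if_generators_nilpotent:
  assumes "module R M" and x: "x \<in> carrier M"
    and e: "\<And>u. u \<in> set us \<Longrightarrow> proj (u ^ e u) \<odot>\<^bsub>M\<^esub> x = \<zero>\<^bsub>M\<^esub>"
  shows "\<exists>n::nat. \<forall>a\<in>(genideal R (proj ` set us)) [^]\<^bsub>ideals_set R\<^esub> n. a \<odot>\<^bsub>M\<^esub> x = \<zero>\<^bsub>M\<^esub>"
  using x e
proof (induction "\<Sum>u\<in>set us. e u" arbitrary: x e rule: less_induct)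
  case less
  interpret module R M by fact
  let ?J = "genideal R (proj ` set us)"
  have J: "ideal ?J R" by (rule genideal_ideal) (simp add: image_subset_iff)
  show ?case
  proof (cases "\<exists>u\<in>set us. e u = 0")
    case True
    then obtain u where "u \<in> set us" "e u = 0" by (rule bexE)
    then have "x = \<zero>\<^bsub>M\<^esub>" using less.prems(2)[of u] less.prems(1) by (simp add: proj_one)
    moreover have "a \<odot>\<^bsub>M\<^esub> \<zero>\<^bsub>M\<^esub> = \<zero>\<^bsub>M\<^esub>" if "a \<in> ?J [^]\<^bsub>ideals_set R\<^esub> (0::nat)" for a
      using that by (simp add: ideals_set_def nat_pow_def)
    ultimately show ?thesis by (intro exI[of _ 0]) simp
  next
    case False
    have "\<exists>n::nat. \<forall>a\<in>?J [^]\<^bsub>ideals_set R\<^esub> n. a \<odot>\<^bsub>M\<^esub> (proj u \<odot>\<^bsub>M\<^esub> x) = \<zero>\<^bsub>M\<^esub>"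
      if u: "u \<in> set us" for u
    proof (rule less.hyps)
      let ?e = "e(u := e u - 1)"
      show "(\<Sum>u\<in>set us. ?e u) < (\<Sum>u\<in>set us. e u)"
        using u False by (intro sum_strict_mono_ex1) (auto intro!: bexI[of _ u])
      show "proj u \<odot>\<^bsub>M\<^esub> x \<in> carrier M" using less.prems(1) by simp
      fix v assume v: "v \<in> set us"
      show "proj (v ^ ?e v) \<odot>\<^bsub>M\<^esub> (proj u \<odot>\<^bsub>M\<^esub> x) = \<zero>\<^bsub>M\<^esub>"
      proof (cases "v = u")
        case True
        have "u ^ (e u - 1) * u = u ^ e u" using False u
          by (metis One_nat_def Suc_pred neq0_conv power_Suc2)
        then show ?thesis
          using True less.prems(1) less.prems(2)[OF u] by (simp flip: smult_assoc1 proj_mult)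
      next
        case False
        have "proj (v ^ e v) \<odot>\<^bsub>M\<^esub> (proj u \<odot>\<^bsub>M\<^esub> x) = proj u \<odot>\<^bsub>M\<^esub> (proj (v ^ e v) \<odot>\<^bsub>M\<^esub> x)"
          using less.prems(1) by (simp flip: smult_assoc1 proj_mult add: mult.commute)
        then show ?thesis using False less.prems(2)[OF v] by simp
      qed
    qed
    then obtain n :: "'s \<Rightarrow> nat" where n: "\<And>u. u \<in> set us \<Longrightarrow>
        \<forall>a\<in>?J [^]\<^bsub>ideals_set R\<^esub> n u. a \<odot>\<^bsub>M\<^esub> (proj u \<odot>\<^bsub>M\<^esub> x) = \<zero>\<^bsub>M\<^esub>"
      by metis
    define N where "N = Max (insert 0 (n ` set us))"
    have "\<forall>a\<in>?J [^]\<^bsub>ideals_set R\<^esub> N. a \<odot>\<^bsub>M\<^esub> (proj u \<odot>\<^bsub>M\<^esub> x) = \<zero>\<^bsub>M\<^esub>" if u: "u \<in> set us" for u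
    proof -
      have "n u \<le> N" unfolding N_def using u by (intro Max_ge) auto
      then show ?thesis using n[OF u] power_descending[OF J] by (meson subsetD)
    qed
    from power_step[OF \<open>module R M\<close> less.prems(1) this] show ?thesis by (rule exI)
  qed
qed

lemma torsion_module_carrier:
  assumes "module R M"
  shows "carrier (torsion_module R (genideal R (proj ` set us)) M) =
    {x \<in> carrier M. \<forall>u\<in>set us. \<exists>n. proj (u ^ n) \<odot>\<^bsub>M\<^esub> x = \<zero>\<^bsub>M\<^esub>}"
proof (intro equalityI subsetI)
  interpret module R M by fact
  let ?J = "genideal R (proj ` set us)"
  fix x assume "x \<in> carrier (torsion_module R ?J M)"
  then obtain n :: nat where x: "x \<in> carrier M"
    "\<forall>a\<in>?J [^]\<^bsub>ideals_set R\<^esub> n. a \<odot>\<^bsub>M\<^esub> x = \<zero>\<^bsub>M\<^esub>" by (auto simp: torsion_module_def)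
  have "proj (u ^ n) \<in> ?J [^]\<^bsub>ideals_set R\<^esub> n" if u: "u \<in> set us" for u
  proof (induction n)
    case 0
    then show ?case by (simp add: ideals_set_def nat_pow_def)
  next
    case (Suc n)
    have "proj u \<in> ?J" by (rule subsetD[OF genideal_self]) (use u in auto)
    with Suc have "proj (u ^ n) \<otimes>\<^bsub>R\<^esub> proj u \<in> ideal_prod R (?J [^]\<^bsub>ideals_set R\<^esub> n) ?J"
      by (rule ideal_prod.prod)
    then show ?case by (simp add: ideals_set_def nat_pow_def mult.commute flip: proj_mult)
  qed
  then show "x \<in> {x \<in> carrier M. \<forall>u\<in>set us. \<exists>n. proj (u ^ n) \<odot>\<^bsub>M\<^esub> x = \<zero>\<^bsub>M\<^esub>}" using x by auto
next
  let ?J = "genideal R (proj ` set us)"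
  fix x assume x: "x \<in> {x \<in> carrier M. \<forall>u\<in>set us. \<exists>n. proj (u ^ n) \<odot>\<^bsub>M\<^esub> x = \<zero>\<^bsub>M\<^esub>}"
  then obtain e where "\<And>u. u \<in> set us \<Longrightarrow> proj (u ^ e u) \<odot>\<^bsub>M\<^esub> x = \<zero>\<^bsub>M\<^esub>"
    unfolding mem_Collect_eq by metis
  from torsion_if_generators_nilpotent[OF assms _ this] x
  show "x \<in> carrier (torsion_module R ?J M)" by (simp add: torsion_module_def)
qed

text \<open>In \<open>quotient_module\<close> a scalar sends a coset to a union of cosets. As
  \<open>B\<close> is a submodule, this union collapses to the coset of the scaled
  representative.\<close>

lemma quotient_module_smult_eq_zero:
  fixes M :: "('s set, 'm) module" and Z :: "'m set"
  assumes "module R M" and B: "B \<subseteq> carrier M" "\<zero>\<^bsub>M\<^esub> \<in> B"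
    and B_add: "\<And>x y. x \<in> B \<Longrightarrow> y \<in> B \<Longrightarrow> x \<oplus>\<^bsub>M\<^esub> y \<in> B"
    and B_smult: "\<And>f x. x \<in> B \<Longrightarrow> proj f \<odot>\<^bsub>M\<^esub> x \<in> B"
    and z: "z \<in> carrier M"
  defines "H \<equiv> quotient_module (M\<lparr>carrier := Z\<rparr>) B"
  shows "proj f \<odot>\<^bsub>H\<^esub> (B +>\<^bsub>M\<^esub> z) = \<zero>\<^bsub>H\<^esub> \<longleftrightarrow> proj f \<odot>\<^bsub>M\<^esub> z \<in> B"
proof -
  interpret module R M by fact
  have coset: "B +>\<^bsub>M\<lparr>carrier := Z\<rparr>\<^esub> x = B +>\<^bsub>M\<^esub> x" for x by (simp add: a_r_coset_def')
  have mem: "w \<in> B +>\<^bsub>M\<^esub> x \<longleftrightarrow> (\<exists>b\<in>B. w = b \<oplus>\<^bsub>M\<^esub> x)" for w x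
    by (auto simp: a_r_coset_def')
  have neg: "\<ominus>\<^bsub>M\<^esub> b \<in> B" if b: "b \<in> B" for b
  proof -
    have bc: "b \<in> carrier M" using B(1) b by auto
    obtain f where f: "\<ominus>\<^bsub>R\<^esub> \<one>\<^bsub>R\<^esub> = proj f" using carrier_R R.a_inv_closed[OF R.one_closed] by auto
    have "\<ominus>\<^bsub>R\<^esub> \<one>\<^bsub>R\<^esub> \<odot>\<^bsub>M\<^esub> b = \<ominus>\<^bsub>M\<^esub> b" using smult_l_minus[OF R.one_closed bc] bc by simp
    then show ?thesis using B_smult[OF b, of f] f by simp
  qed
  have eq: "B +>\<^bsub>M\<^esub> x = B \<longleftrightarrow> x \<in> B" if x: "x \<in> carrier M" for x
  proof
    assume "B +>\<^bsub>M\<^esub> x = B"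
    moreover have "\<zero>\<^bsub>M\<^esub> \<oplus>\<^bsub>M\<^esub> x \<in> B +>\<^bsub>M\<^esub> x" using B(2) by (auto simp: mem)
    ultimately show "x \<in> B" using x by simp
  next
    assume xB: "x \<in> B"
    show "B +>\<^bsub>M\<^esub> x = B"
    proof (intro equalityI subsetI)
      fix w assume "w \<in> B +>\<^bsub>M\<^esub> x"
      then show "w \<in> B" using B_add xB by (auto simp: mem)
    next
      fix w assume w: "w \<in> B"
      then have "w = (w \<oplus>\<^bsub>M\<^esub> \<ominus>\<^bsub>M\<^esub> x) \<oplus>\<^bsub>M\<^esub> x" using B(1) x by (auto simp: M.a_assoc M.l_neg)
      moreover have "w \<oplus>\<^bsub>M\<^esub> \<ominus>\<^bsub>M\<^esub> x \<in> B" using B_add[OF w neg[OF xB]] .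
      ultimately show "w \<in> B +>\<^bsub>M\<^esub> x" unfolding mem by (rule rev_bexI[rotated])
    qed
  qed
  have "(\<Union>x\<in>B +>\<^bsub>M\<^esub> z. B +>\<^bsub>M\<^esub> (proj f \<odot>\<^bsub>M\<^esub> x)) = B +>\<^bsub>M\<^esub> (proj f \<odot>\<^bsub>M\<^esub> z)"
  proof (intro equalityI subsetI)
    fix w assume "w \<in> (\<Union>x\<in>B +>\<^bsub>M\<^esub> z. B +>\<^bsub>M\<^esub> (proj f \<odot>\<^bsub>M\<^esub> x))"
    then obtain b c where bc: "b \<in> B" "c \<in> B" "w = c \<oplus>\<^bsub>M\<^esub> (proj f \<odot>\<^bsub>M\<^esub> (b \<oplus>\<^bsub>M\<^esub> z))"
      by (auto simp: mem)
    have "w = (c \<oplus>\<^bsub>M\<^esub> proj f \<odot>\<^bsub>M\<^esub> b) \<oplus>\<^bsub>M\<^esub> (proj f \<odot>\<^bsub>M\<^esub> z)"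
      using bc z subsetD[OF B(1)] by (simp add: smult_r_distr M.a_assoc)
    then show "w \<in> B +>\<^bsub>M\<^esub> (proj f \<odot>\<^bsub>M\<^esub> z)"
      using B_add[OF bc(2) B_smult[OF bc(1)]] by (auto simp: mem)
  next
    fix w assume w: "w \<in> B +>\<^bsub>M\<^esub> (proj f \<odot>\<^bsub>M\<^esub> z)"
    have "z \<in> B +>\<^bsub>M\<^esub> z" unfolding mem using B(2) z by (intro bexI[of _ "\<zero>\<^bsub>M\<^esub>"]) simp_all
    with w show "w \<in> (\<Union>x\<in>B +>\<^bsub>M\<^esub> z. B +>\<^bsub>M\<^esub> (proj f \<odot>\<^bsub>M\<^esub> x))" by blast
  qed
  then show ?thesis using eq[of "proj f \<odot>\<^bsub>M\<^esub> z"] z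
    by (simp add: H_def quotient_module_def coset)
qed

lemma divisible_resolution_pullback:
  assumes acc: "acc_on (UNIV :: 's set)"
    and res: "injective_resolution R (regular_module R) \<epsilon> E d"
  shows "divisible_resolution (\<lambda>k. pullback (E k)) d (\<lambda>f. \<epsilon> (proj f)) I"
proof -
  note res = res[unfolded injective_resolution_def]
  have inj: "injective_module R (E k)" for k using res by simp
  then have M: "module R (E k)" for k by (simp add: injective_module_def)
  have eps: "\<epsilon> \<in> module_hom R (regular_module R) (E 0)" "inj_on \<epsilon> (carrier (regular_module R))"
    "\<epsilon> ` carrier (regular_module R) = {x \<in> carrier (E 0). d 0 x = \<zero>\<^bsub>E 1\<^esub>}" using res by simp_all
  have dh: "d k \<in> module_hom R (E k) (E (Suc k))" for k using res by simp
  have ex: "d k ` carrier (E k) = {x \<in> carrier (E (Suc k)). d (Suc k) x = \<zero>\<^bsub>E (Suc (Suc k))\<^esub>}" for k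
    using res by simp
  have reg [simp]: "carrier (regular_module R) = carrier R" "x \<oplus>\<^bsub>regular_module R\<^esub> y = x \<oplus>\<^bsub>R\<^esub> y"
    "x \<odot>\<^bsub>regular_module R\<^esub> y = x \<otimes>\<^bsub>R\<^esub> y" for x y
    by (simp_all add: regular_module_def)
  interpret E0: module R "E 0" by (rule M)
  have eps_closed: "\<epsilon> (proj f) \<in> carrier (E 0)" and
    eps_add: "\<epsilon> (proj (f + g)) = \<epsilon> (proj f) \<oplus>\<^bsub>E 0\<^esub> \<epsilon> (proj g)" and
    eps_mult: "\<epsilon> (proj (f * g)) = proj f \<odot>\<^bsub>E 0\<^esub> \<epsilon> (proj g)" for f g
    using eps(1) by (auto simp: module_hom_def proj_add proj_mult)
  have eps0: "\<epsilon> (proj 0) = \<zero>\<^bsub>E 0\<^esub>"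
    using eps_mult[of 0 0] eps_closed[of 0] by (simp add: proj_zero)
  show ?thesis
  proof (rule divisible_resolution.intro)
    fix k :: nat and f g r u :: 's and x y
    show "module ring_of_type_algebra (pullback (E k))" by (rule module_pullback[OF M])
    show "\<epsilon> (proj f) \<in> carrier (pullback (E 0))" using eps_closed by simp
    show "\<epsilon> (proj (f + g)) = \<epsilon> (proj f) \<oplus>\<^bsub>pullback (E 0)\<^esub> \<epsilon> (proj g)" using eps_add by simp
    show "\<epsilon> (proj (r * f)) = r \<odot>\<^bsub>pullback (E 0)\<^esub> \<epsilon> (proj f)" using eps_mult by simp
    show "(\<epsilon> (proj f) = \<zero>\<^bsub>pullback (E 0)\<^esub>) = (f \<in> I)"
      using inj_onD[OF eps(2), of "proj f" "proj 0"] eps0 proj_eq_iff[of f 0] by auto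
    show "d 0 (\<epsilon> (proj f)) = \<zero>\<^bsub>pullback (E (Suc 0))\<^esub>"
      using eps(3) proj_closed[of f] by auto
    show "\<exists>f. \<epsilon> (proj f) = x" if "x \<in> carrier (pullback (E 0))" "d 0 x = \<zero>\<^bsub>pullback (E (Suc 0))\<^esub>"
    proof -
      have "x \<in> \<epsilon> ` carrier (regular_module R)" unfolding eps(3) using that by simp
      then show ?thesis by (auto simp: carrier_R)
    qed
    assume x: "x \<in> carrier (pullback (E k))"
    then show "d k x \<in> carrier (pullback (E (Suc k)))" "d (Suc k) (d k x) = \<zero>\<^bsub>pullback (E (Suc (Suc k)))\<^esub>"
      using ex[of k] by auto
    show "d k (r \<odot>\<^bsub>pullback (E k)\<^esub> x) = r \<odot>\<^bsub>pullback (E (Suc k))\<^esub> d k x"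
      using dh[of k] x by (simp add: module_hom_def)
    show "d k (x \<oplus>\<^bsub>pullback (E k)\<^esub> y) = d k x \<oplus>\<^bsub>pullback (E (Suc k))\<^esub> d k y"
      if "y \<in> carrier (pullback (E k))"
      using dh[of k] x that by (simp add: module_hom_def)
    show "\<exists>m. \<exists>y\<in>carrier (pullback (E k)). u ^ m \<odot>\<^bsub>pullback (E k)\<^esub> x = u ^ Suc m \<odot>\<^bsub>pullback (E k)\<^esub> y \<and>
        (\<forall>r. r \<odot>\<^bsub>pullback (E k)\<^esub> x = \<zero>\<^bsub>pullback (E k)\<^esub> \<longrightarrow> r \<odot>\<^bsub>pullback (E k)\<^esub> y = \<zero>\<^bsub>pullback (E k)\<^esub>)"
      using injective_divisible[OF acc inj, of x k u] x by (simp del: power_Suc)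
  next
    fix k y assume "y \<in> carrier (pullback (E (Suc k)))" "d (Suc k) y = \<zero>\<^bsub>pullback (E (Suc (Suc k)))\<^esub>"
    then have "y \<in> d k ` carrier (E k)" unfolding ex by simp
    then show "\<exists>x\<in>carrier (pullback (E k)). d k x = y" by auto
  qed
qed

end

text \<open>The annihilator of the class of \<open>f / (u\<^sub>1 \<cdots> u\<^sub>s)\<^sup>n\<close> in the top local cohomology.\<close>

definition annihilator_ideal :: "'s::comm_ring_1 set \<Rightarrow> 's list \<Rightarrow> nat \<Rightarrow> 's \<Rightarrow> 's set" where
  "annihilator_ideal I us n f = {g. \<exists>m. prod_list us ^ m * (g * f) \<in> power_ideal I us (n + m)}"

text \<open>Expanding a fraction does not change its class. This compensates for
  \<open>represents_total\<close>, which yields a cocycle only for an expanded fraction.\<close>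

lemma annihilator_ideal_shift:
  assumes "sub_ideal UNIV I"
  shows "annihilator_ideal I us (n + m) (prod_list us ^ m * f) = annihilator_ideal I us n f"
proof (intro equalityI subsetI)
  fix g assume "g \<in> annihilator_ideal I us (n + m) (prod_list us ^ m * f)"
  then obtain l where "prod_list us ^ l * (g * (prod_list us ^ m * f)) \<in> power_ideal I us (n + m + l)"
    by (auto simp: annihilator_ideal_def)
  then have "prod_list us ^ (m + l) * (g * f) \<in> power_ideal I us (n + (m + l))"
    by (simp add: power_add mult_ac add.assoc)
  then show "g \<in> annihilator_ideal I us n f" unfolding annihilator_ideal_def by blast
next
  fix g assume "g \<in> annihilator_ideal I us n f"
  then obtain l where l: "prod_list us ^ l * (g * f) \<in> power_ideal I us (n + l)"
    by (auto simp: annihilator_ideal_def)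
  have "prod_list us ^ l * (g * (prod_list us ^ m * f)) \<in> power_ideal I us (n + m + l)"
    using power_ideal_shift[OF assms l, of m] by (simp add: mult_ac add_ac)
  then show "g \<in> annihilator_ideal I us (n + m) (prod_list us ^ m * f)"
    unfolding annihilator_ideal_def by blast
qed

context quotient_ring
begin

text \<open>\<open>represents_surj\<close> names every class by a fraction; conversely
  \<open>represents_total\<close> realises every fraction after an expansion, which leaves the
  annihilator unchanged.\<close>

theorem associated_primes_local_cohomology:
  fixes us :: "'s list"
  assumes acc: "acc_on (UNIV :: 's set)"
    and res: "injective_resolution R (regular_module R) \<epsilon> E d"
  defines "H \<equiv> local_cohomology R (genideal R (proj ` set us)) E d (length us)"
  shows "associated_primes R H =
    {P. primeideal P R \<and> (\<exists>n f. P = proj ` annihilator_ideal I us n f)}"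
proof -
  interpret D: divisible_resolution "\<lambda>k. pullback (E k)" d "\<lambda>f. \<epsilon> (proj f)" I
    by (rule divisible_resolution_pullback[OF acc res])
  have M: "module R (E k)" for k
    using res by (simp add: injective_resolution_def injective_module_def)
  let ?J = "genideal R (proj ` set us)" and ?s = "length us"
  have tors: "carrier (torsion_module R ?J (E k)) = D.tors us k" for k
    unfolding torsion_module_carrier[OF M] D.tors_def by simp
  define Z where "Z = {z \<in> D.tors us ?s. d ?s z = \<zero>\<^bsub>E (Suc ?s)\<^esub>}"
  define B where "B = D.bound us ?s"
  have zero_tors: "\<zero>\<^bsub>torsion_module R ?J (E k)\<^esub> = \<zero>\<^bsub>E k\<^esub>" for k by (simp add: torsion_module_def)
  have "H = quotient_module ((E ?s)\<lparr>carrier := Z\<rparr>) B"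
    unfolding H_def local_cohomology_def cohomology_def tors zero_tors Z_def B_def
    by (simp add: torsion_module_def D.bound_def split: nat.split)
  note H = this
  have B_carrier: "B \<subseteq> carrier (E ?s)"
    unfolding B_def
  proof (cases ?s)
    case 0
    then show "D.bound us ?s \<subseteq> carrier (E ?s)" using D.zero_closed[of 0] by simp
  next
    case (Suc j)
    then show "D.bound us ?s \<subseteq> carrier (E ?s)" using D.d_closed[OF D.tors_carrier] by auto
  qed
  have B_add: "x \<oplus>\<^bsub>E ?s\<^esub> y \<in> B" if "x \<in> B" "y \<in> B" for x y
  proof (cases ?s)
    case 0
    then show ?thesis using that D.add_zero[of "\<zero>\<^bsub>E 0\<^esub>" 0] D.zero_closed[of 0] by (simp add: B_def)
  next
    case (Suc j)
    then obtain a b where ab: "a \<in> D.tors us j" "b \<in> D.tors us j" "x = d j a" "y = d j b"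
      using \<open>x \<in> B\<close> \<open>y \<in> B\<close> by (auto simp: B_def)
    have "d j (a \<oplus>\<^bsub>E j\<^esub> b) = x \<oplus>\<^bsub>E ?s\<^esub> y"
      using D.d_add[OF D.tors_carrier[OF ab(1)] D.tors_carrier[OF ab(2)]] ab Suc by simp
    moreover have "a \<oplus>\<^bsub>E j\<^esub> b \<in> D.tors us j" using D.tors_add[OF ab(1,2)] by simp
    ultimately show ?thesis unfolding B_def Suc D.bound_Suc by (simp add: image_iff) metis
  qed
  have B_smult: "proj f \<odot>\<^bsub>E ?s\<^esub> x \<in> B" if "x \<in> B" for f x
  proof (cases ?s)
    case 0
    then show ?thesis using that D.smult_zero[of 0 f] by (simp add: B_def)
  next
    case (Suc j)
    then obtain a where a: "a \<in> D.tors us j" "x = d j a"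
      using \<open>x \<in> B\<close> by (auto simp: B_def)
    have "d j (proj f \<odot>\<^bsub>E j\<^esub> a) = proj f \<odot>\<^bsub>E ?s\<^esub> x"
      using D.d_smult[OF D.tors_carrier[OF a(1)], of f] a Suc by simp
    moreover have "proj f \<odot>\<^bsub>E j\<^esub> a \<in> D.tors us j" using D.tors_smult[OF a(1), of f] by simp
    ultimately show ?thesis unfolding B_def Suc D.bound_Suc by (simp add: image_iff) metis
  qed
  have B_zero: "\<zero>\<^bsub>E ?s\<^esub> \<in> B" using D.zero_bound[of ?s us] by (simp add: B_def)
  have carrier_H: "carrier H = (\<lambda>z. B +>\<^bsub>E ?s\<^esub> z) ` Z"
    unfolding H quotient_module_def by (auto simp: A_RCOSETS_def' a_r_coset_def')
  have Zc: "z \<in> carrier (E ?s)" if "z \<in> Z" for z using that D.tors_carrier[of z us ?s] by (simp add: Z_def)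
  \<comment> \<open>A scalar kills the class of \<open>z\<close> iff it sends \<open>z\<close> to a
    coboundary, and \<open>represents_bound_iff\<close> decides this on the numerator.\<close>
  have ann: "{r \<in> carrier R. r \<odot>\<^bsub>H\<^esub> (B +>\<^bsub>E ?s\<^esub> z) = \<zero>\<^bsub>H\<^esub>} = proj ` annihilator_ideal I us n f"
    if z: "D.represents us n z f" for z n f
  proof -
    have zc: "z \<in> carrier (E ?s)"
      using D.tors_carrier[OF D.represents_cocycle(1)[OF z]] by simp
    have "proj g \<odot>\<^bsub>H\<^esub> (B +>\<^bsub>E ?s\<^esub> z) = \<zero>\<^bsub>H\<^esub> \<longleftrightarrow> g \<in> annihilator_ideal I us n f" for g
    proof -
      have "proj g \<odot>\<^bsub>H\<^esub> (B +>\<^bsub>E ?s\<^esub> z) = \<zero>\<^bsub>H\<^esub> \<longleftrightarrow> proj g \<odot>\<^bsub>E ?s\<^esub> z \<in> B"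
        unfolding H by (rule quotient_module_smult_eq_zero[OF M B_carrier B_zero B_add B_smult zc])
      also have "\<dots> \<longleftrightarrow> g \<in> annihilator_ideal I us n f"
        using D.represents_bound_iff[OF D.represents_smult[OF z, of g]]
        by (simp add: B_def annihilator_ideal_def)
      finally show ?thesis .
    qed
    then show ?thesis unfolding carrier_R by auto
  qed
  have "(\<exists>x\<in>carrier H. P = {r \<in> carrier R. r \<odot>\<^bsub>H\<^esub> x = \<zero>\<^bsub>H\<^esub>}) \<longleftrightarrow>
      (\<exists>n f. P = proj ` annihilator_ideal I us n f)" for P
  proof
    assume "\<exists>x\<in>carrier H. P = {r \<in> carrier R. r \<odot>\<^bsub>H\<^esub> x = \<zero>\<^bsub>H\<^esub>}"
    then obtain z where z: "z \<in> Z" "P = {r \<in> carrier R. r \<odot>\<^bsub>H\<^esub> (B +>\<^bsub>E ?s\<^esub> z) = \<zero>\<^bsub>H\<^esub>}"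
      unfolding carrier_H by (elim bexE imageE) simp
    have "z \<in> D.tors us ?s" "d ?s z = \<zero>\<^bsub>pullback (E (Suc ?s))\<^esub>" using z(1) by (simp_all add: Z_def)
    from D.represents_surj[OF this, of 0] obtain n f where "D.represents us n z f" by (elim exE conjE)
    then show "\<exists>n f. P = proj ` annihilator_ideal I us n f" using ann z(2) by (intro exI) simp
  next
    assume "\<exists>n f. P = proj ` annihilator_ideal I us n f"
    then obtain n f where P: "P = proj ` annihilator_ideal I us n f" by (elim exE)
    obtain m z where z: "D.represents us (n + m) z (prod_list us ^ m * f)"
      using D.represents_total by meson
    have "P = {r \<in> carrier R. r \<odot>\<^bsub>H\<^esub> (B +>\<^bsub>E ?s\<^esub> z) = \<zero>\<^bsub>H\<^esub>}"
      unfolding ann[OF z] annihilator_ideal_shift[OF sub_ideal_I] P ..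
    moreover have "z \<in> Z" using D.represents_cocycle[OF z] by (simp add: Z_def)
    ultimately show "\<exists>x\<in>carrier H. P = {r \<in> carrier R. r \<odot>\<^bsub>H\<^esub> x = \<zero>\<^bsub>H\<^esub>}"
      unfolding carrier_H by blast
  qed
  then show ?thesis unfolding associated_primes_def by simp
qed

end

section \<open>Annihilators in polynomial rings\<close>

lemma prime_setD:
  assumes "prime_set Q"
  shows "sub_ideal UNIV Q" "1 \<notin> Q" "a * b \<in> Q \<Longrightarrow> a \<in> Q \<or> b \<in> Q"
  using assms by (simp_all add: prime_set_def)

lemma sum_induct_closed:
  fixes f :: "'k \<Rightarrow> 's::comm_monoid_add"
  assumes "0 \<in> W" "\<And>x y. x \<in> W \<Longrightarrow> y \<in> W \<Longrightarrow> x + y \<in> W" "\<And>i. i \<in> F \<Longrightarrow> f i \<in> W"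
  shows "sum f F \<in> W"
proof (cases "finite F")
  case True
  then show ?thesis using assms(3) by (induction F) (simp_all add: assms(1,2))
qed (simp add: assms(1))

lemma poly_mapping_sum_single:
  fixes f :: "'k \<Rightarrow>\<^sub>0 'b::comm_monoid_add"
  shows "(\<Sum>e\<in>Poly_Mapping.keys f. Poly_Mapping.single e (Poly_Mapping.lookup f e)) = f"
  by (rule poly_mapping_eqI)
    (simp add: lookup_sum lookup_single when_def in_keys_iff flip: sum.inter_filter)

text \<open>Modulo \<open>Q\<close> the matrix \<open>b\<close> is triangular with units on the diagonal; Gaussian elimination
  without division replaces Cramer's rule.\<close>

lemma triangular_annihilator:
  fixes b :: "'k \<Rightarrow> 'k \<Rightarrow> 's::comm_ring_1" and \<tau> :: "'k \<Rightarrow> nat"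
  assumes "finite F" "inj_on \<tau> F" and Q: "prime_set Q" and W: "sub_ideal UNIV W"
    and "\<And>i. i \<in> F \<Longrightarrow> (\<Sum>j\<in>F. b i j * e j) \<in> W"
    and "\<And>i. i \<in> F \<Longrightarrow> b i i \<notin> Q"
    and "\<And>i j. i \<in> F \<Longrightarrow> j \<in> F \<Longrightarrow> \<tau> j < \<tau> i \<Longrightarrow> b i j \<in> Q"
  shows "\<exists>a. a \<notin> Q \<and> (\<forall>i\<in>F. a * e i \<in> W)"
  using assms(1,2,5-)
proof (induction "card F" arbitrary: F b)
  case 0
  then show ?case using prime_setD(2)[OF Q] by (intro exI[of _ 1]) simp
next
  case (Suc n)
  note QI = sub_idealD[OF prime_setD(1)[OF Q]] and WI = sub_idealD[OF W]
  have "F \<noteq> {}" using Suc.hyps(2) by auto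
  then have "Max (\<tau> ` F) \<in> \<tau> ` F" using Suc.prems(1) by (intro Max_in) simp_all
  then obtain k where k: "k \<in> F" "\<tau> k = Max (\<tau> ` F)" by auto
  have less: "\<tau> j < \<tau> k" if "j \<in> F - {k}" for j
  proof -
    have "\<tau> j \<le> \<tau> k" using that Suc.prems(1) unfolding k(2) by simp
    moreover have "\<tau> j \<noteq> \<tau> k" using that k(1) inj_onD[OF Suc.prems(2)] by auto
    ultimately show ?thesis by simp
  qed
  have bk: "b k j \<in> Q" if "j \<in> F - {k}" for j using Suc.prems(5)[OF k(1) _ less[OF that]] that by simp
  \<comment> \<open>Column \<open>k\<close> is cleared by cross-multiplication. For \<open>j\<close>
    other than \<open>k\<close>, \<open>b k j\<close> lies in \<open>Q\<close>, so modulo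
    \<open>Q\<close> the new row is \<open>b k k\<close> times the old one and the triangular shape
    persists.\<close>
  define b' where "b' i j = b k k * b i j + - b i k * b k j" for i j
  have split: "(\<Sum>j\<in>F. f j) = f k + (\<Sum>j\<in>F - {k}. f j)" for f :: "'k \<Rightarrow> 's"
    using sum.remove[OF Suc.prems(1) k(1)] .
  have "\<exists>a. a \<notin> Q \<and> (\<forall>i\<in>F - {k}. a * e i \<in> W)"
  proof (rule Suc.hyps(1))
    show "n = card (F - {k})" using Suc.hyps(2) k(1) Suc.prems(1) by simp
    show "finite (F - {k})" using Suc.prems(1) by simp
    show "inj_on \<tau> (F - {k})" using Suc.prems(2) by (rule inj_on_subset) auto
  next
    fix i assume i: "i \<in> F - {k}"
    have "(\<Sum>j\<in>F - {k}. b' i j * e j) = b k k * (\<Sum>j\<in>F. b i j * e j) + - b i k * (\<Sum>j\<in>F. b k j * e j)"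
      unfolding split[of "\<lambda>j. b i j * e j"] split[of "\<lambda>j. b k j * e j"]
      by (simp add: b'_def algebra_simps sum.distrib sum_distrib_left sum_subtractf sum_negf)
    also have "\<dots> \<in> W" using i k(1) by (intro WI(3,4) Suc.prems(3) UNIV_I) auto
    finally show "(\<Sum>j\<in>F - {k}. b' i j * e j) \<in> W" .
    have "b k k * b i i \<notin> Q" using prime_setD(3)[OF Q] Suc.prems(4) i k(1) by auto
    moreover have "b i k * b k i \<in> Q" using QI(4)[OF UNIV_I bk[OF i]] .
    moreover have "b k k * b i i = b' i i + b i k * b k i" by (simp add: b'_def)
    ultimately show "b' i i \<notin> Q" using QI(3) by metis
  next
    fix i j assume ij: "i \<in> F - {k}" "j \<in> F - {k}" "\<tau> j < \<tau> i"
    then have "b i j \<in> Q" using Suc.prems(5) by simp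
    then show "b' i j \<in> Q" unfolding b'_def using bk[OF ij(2)] by (intro QI(3,4) UNIV_I)
  qed
  then obtain a where a: "a \<notin> Q" "\<And>i. i \<in> F - {k} \<Longrightarrow> a * e i \<in> W" by auto
  have "(a * b k k) * e i \<in> W" if i: "i \<in> F" for i
  proof (cases "i = k")
    case True
    have bae: "b k j * (a * e j) \<in> W" if "j \<in> F - {k}" for j by (rule WI(4)[OF UNIV_I a(2)[OF that]])
    \<comment> \<open>Back substitution: \<open>a\<close> times row \<open>k\<close>, minus the
      terms already known to lie in \<open>W\<close>.\<close>
    have "(\<Sum>j\<in>F - {k}. b k j * (a * e j)) \<in> W"
      by (rule sum_induct_closed[OF WI(2,3)]) (simp_all add: bae)
    then have "a * (\<Sum>j\<in>F. b k j * e j) + (-1) * (\<Sum>j\<in>F - {k}. b k j * (a * e j)) \<in> W"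
      using Suc.prems(3)[OF k(1)] by (intro WI(3,4) UNIV_I)
    moreover have "a * (\<Sum>j\<in>F. b k j * e j) + (-1) * (\<Sum>j\<in>F - {k}. b k j * (a * e j)) = (a * b k k) * e k"
      unfolding split[of "\<lambda>j. b k j * e j"] by (simp add: algebra_simps sum_distrib_left sum_negf)
    ultimately show ?thesis using True by simp
  next
    case False
    have "b k k * (a * e i) \<in> W" by (rule WI(4)[OF UNIV_I a(2)]) (use i False in simp)
    then show ?thesis by (simp add: mult_ac)
  qed
  moreover have "a * b k k \<notin> Q" using prime_setD(3)[OF Q] a(1) Suc.prems(4)[OF k(1)] by auto
  ultimately show ?case by blast
qed

lemma annihilator_ideal_sub_ideal:
  assumes I: "sub_ideal UNIV I"
  shows "sub_ideal UNIV (annihilator_ideal I us n f)"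
  unfolding sub_ideal_def
proof (intro conjI ballI)
  note PI = power_ideal_closed[OF I]
  show "0 \<in> annihilator_ideal I us n f" using PI(1) by (auto simp: annihilator_ideal_def)
  fix g h
  show "g * h \<in> annihilator_ideal I us n f" if "h \<in> annihilator_ideal I us n f"
  proof -
    obtain l where "prod_list us ^ l * (h * f) \<in> power_ideal I us (n + l)"
      using \<open>h \<in> _\<close> by (auto simp: annihilator_ideal_def)
    from PI(3)[OF this, of g] show ?thesis by (auto simp: annihilator_ideal_def mult_ac)
  qed
  show "g + h \<in> annihilator_ideal I us n f"
    if gh: "g \<in> annihilator_ideal I us n f" "h \<in> annihilator_ideal I us n f"
  proof -
    obtain l where l: "prod_list us ^ l * (h * f) \<in> power_ideal I us (n + l)"
      using gh(2) by (auto simp: annihilator_ideal_def)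
    obtain m where m: "prod_list us ^ m * (g * f) \<in> power_ideal I us (n + m)"
      using gh(1) by (auto simp: annihilator_ideal_def)
    have "prod_list us ^ l * (prod_list us ^ m * (g * f)) + prod_list us ^ m * (prod_list us ^ l * (h * f))
        \<in> power_ideal I us (n + (l + m))"
      using PI(2)[OF power_ideal_shift[OF I m, of l, simplified add_ac]
        power_ideal_shift[OF I l, of m, simplified add_ac]] by (simp add: add_ac)
    then have "prod_list us ^ (l + m) * ((g + h) * f) \<in> power_ideal I us (n + (l + m))"
      by (simp add: power_add algebra_simps)
    then show ?thesis by (auto simp: annihilator_ideal_def)
  qed
qed simp

lemma mem_annihilator_ideal_mult:
  "g \<in> annihilator_ideal I us n (a * f) \<longleftrightarrow> g * a \<in> annihilator_ideal I us n f"
  by (simp add: annihilator_ideal_def mult.assoc)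

lemma mem_annihilator_idealI:
  "g * f \<in> power_ideal I us n \<Longrightarrow> g \<in> annihilator_ideal I us n f"
  unfolding annihilator_ideal_def by (intro CollectI exI[of _ 0]) simp

lemma mem_power_ideal:
  assumes I: "sub_ideal UNIV I"
  shows "g \<in> I \<Longrightarrow> g \<in> power_ideal I us n" and "u \<in> set us \<Longrightarrow> u ^ n * g \<in> power_ideal I us n"
proof -
  have 1: "g \<in> power_ideal I us n" if "g \<in> I" for g
  proof (induction us)
    case (Cons u us)
    moreover have "g = u ^ n * 0 + g" by simp
    ultimately show ?case unfolding power_ideal.simps by blast
  qed (use that in simp)
  then show "g \<in> I \<Longrightarrow> g \<in> power_ideal I us n" .
  show "u \<in> set us \<Longrightarrow> u ^ n * g \<in> power_ideal I us n"
  proof (induction us)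
    case (Cons v us)
    show ?case
    proof (cases "v = u")
      case True
      have "u ^ n * g = v ^ n * g + 0" using True by simp
      then show ?thesis using power_ideal_zero[OF I, of us n] unfolding power_ideal.simps by blast
    next
      case False
      then have "u ^ n * g \<in> power_ideal I us n" using Cons by simp
      moreover have "u ^ n * g = v ^ n * 0 + u ^ n * g" by simp
      ultimately show ?thesis unfolding power_ideal.simps by blast
    qed
  qed simp
qed

text \<open>Among the annihilators contained in \<open>Q\<close>, a maximal one is prime.\<close>

lemma prime_annihilator_below:
  fixes I :: "'s::comm_ring_1 set"
  assumes acc: "acc_on (UNIV :: 's set)" and I: "sub_ideal UNIV I"
    and Q: "prime_set Q" and sub: "annihilator_ideal I us n f \<subseteq> Q"
  shows "\<exists>r. prime_set (annihilator_ideal I us n (r * f)) \<and> annihilator_ideal I us n (r * f) \<subseteq> Q"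
proof -
  let ?A = "\<lambda>r. annihilator_ideal I us n (r * f)"
  let ?J = "{?A r |r. ?A r \<subseteq> Q}"
  have sA: "sub_ideal UNIV (?A r)" for r by (rule annihilator_ideal_sub_ideal[OF I])
  have "?A 1 \<in> ?J" by (intro CollectI exI[of _ 1] conjI refl) (use sub in simp)
  then have "?J \<noteq> {}" by blast
  then have "\<exists>M\<in>?J. \<forall>J\<in>?J. M \<subseteq> J \<longrightarrow> J = M"
    by (rule acc_on_maximal[OF acc]) (use sA in blast)
  then obtain M where M: "M \<in> ?J" "\<forall>J\<in>?J. M \<subseteq> J \<longrightarrow> J = M" by (rule bexE)
  then obtain r where r: "?A r \<subseteq> Q" and MA: "M = ?A r" by blast
  have max: "?A s = ?A r" if "?A s \<subseteq> Q" "?A r \<subseteq> ?A s" for s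
  proof -
    have "?A s \<in> ?J" using that(1) by blast
    then show ?thesis using M(2) that(2) unfolding MA by simp
  qed
  have colon: "g \<in> ?A (a * s) \<longleftrightarrow> g * a \<in> ?A s" for g a s
    using mem_annihilator_ideal_mult[of g I us n a "s * f"] by (simp add: mult.assoc)
  have mono: "?A s \<subseteq> ?A (a * s)" for a s
  proof
    fix g assume "g \<in> ?A s"
    from sub_idealD(4)[OF sA UNIV_I this, of a] show "g \<in> ?A (a * s)"
      unfolding colon mult.commute[of g a] .
  qed
  have "a \<in> ?A r \<or> b \<in> ?A r" if ab: "a * b \<in> ?A r" for a b
  proof (rule ccontr)
    assume "\<not> (a \<in> ?A r \<or> b \<in> ?A r)"
    then have n: "a \<notin> ?A r" "b \<notin> ?A r" by simp_all
    have "b \<in> ?A (a * r)" using ab unfolding colon mult.commute[of b a] .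
    then have "?A (a * r) \<noteq> ?A r" using n(2) by auto
    then have "\<not> ?A (a * r) \<subseteq> Q" using max mono by meson
    \<comment> \<open>The annihilator grows strictly from numerator \<open>r * f\<close> to
      \<open>a * r * f\<close>, so by maximality it leaves \<open>Q\<close>. Replacing
      \<open>a\<close> by the witness \<open>t\<close> outside \<open>Q\<close> keeps the
      annihilator inside \<open>Q\<close>, hence equal to the maximal one, although it now contains
      \<open>a\<close>.\<close>
    then obtain t where t: "t \<in> ?A (a * r)" "t \<notin> Q" by blast
    have "?A (t * r) \<subseteq> Q"
    proof
      fix g assume "g \<in> ?A (t * r)"
      then have "g * t \<in> Q" using r by (auto simp: colon)
      then show "g \<in> Q" using prime_setD(3)[OF Q] t(2) by metis
    qed
    then have "?A (t * r) = ?A r" using max mono by meson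
    moreover have "a \<in> ?A (t * r)" using t(1) unfolding colon mult.commute[of t a] .
    ultimately show False using n(1) by simp
  qed
  moreover have "1 \<notin> ?A r" using r prime_setD(2)[OF Q] by auto
  ultimately have "prime_set (?A r)" unfolding prime_set_def using sA by simp
  then show ?thesis using r by blast
qed

section \<open>Coefficients and monomials in the power ideals\<close>

lemma lookup_single_mult:
  fixes f :: "('v \<Rightarrow>\<^sub>0 nat) \<Rightarrow>\<^sub>0 'a::comm_ring_1"
  shows "Poly_Mapping.lookup (Poly_Mapping.single k c * f) (k + m) = c * Poly_Mapping.lookup f m"
proof (induction f rule: poly_mapping_add_induct)
  case zero
  then show ?case by simp
next
  case (plus l b g)
  then show ?case by (simp add: distrib_left lookup_add mult_single lookup_single when_def)
qed

lemma keys_single_mult: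
  fixes f :: "('v \<Rightarrow>\<^sub>0 nat) \<Rightarrow>\<^sub>0 'a::comm_ring_1"
  assumes "m \<in> Poly_Mapping.keys (Poly_Mapping.single k c * f)"
  shows "\<exists>l. m = k + l"
  using subsetD[OF keys_mult assms] by (auto split: if_splits)

lemma mpoly_var_power: "mpoly_var v ^ n = Poly_Mapping.single (Poly_Mapping.single v n) (1::'a::comm_ring_1)"
proof (induction n)
  case (Suc n)
  then show ?case using single_add[of v 1 n] by (simp add: mpoly_var_def mult_single)
qed simp

lemma exponent_split:
  fixes e :: "'v \<Rightarrow>\<^sub>0 nat"
  assumes "n \<le> Poly_Mapping.lookup e v"
  shows "Poly_Mapping.single v n + (e - Poly_Mapping.single v n) = e"
  by (rule poly_mapping_eqI) (use assms in \<open>auto simp: lookup_add lookup_minus lookup_single when_def\<close>)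

lemma single_eq_mpoly_var_mult:
  assumes "n \<le> Poly_Mapping.lookup e v"
  shows "Poly_Mapping.single e (a::'a::comm_ring_1) =
    mpoly_var v ^ n * Poly_Mapping.single (e - Poly_Mapping.single v n) a"
  by (simp add: mpoly_var_power mult_single exponent_split[OF assms])

text \<open>Every term with some exponent at least \<open>n\<close> is a multiple of the
  \<open>n\<close>-th power of a variable, so only the remaining terms can obstruct
  membership.\<close>

lemma mem_power_ideal_if_coeff_zero:
  assumes I: "sub_ideal UNIV I"
    and zero: "\<And>e. (\<And>v. v \<in> set vs \<Longrightarrow> Poly_Mapping.lookup e v < n) \<Longrightarrow> Poly_Mapping.lookup f e = 0"
  shows "f \<in> power_ideal I (map mpoly_var vs) n"
proof -
  let ?W = "power_ideal I (map mpoly_var vs) n"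
  have "Poly_Mapping.single e (Poly_Mapping.lookup f e) \<in> ?W" for e
  proof (cases "\<exists>v\<in>set vs. n \<le> Poly_Mapping.lookup e v")
    case True
    then obtain v where v: "v \<in> set vs" "n \<le> Poly_Mapping.lookup e v" by (rule bexE)
    show ?thesis
      unfolding single_eq_mpoly_var_mult[OF v(2)] by (rule mem_power_ideal(2)[OF I]) (simp add: v)
  next
    case False
    then show ?thesis using zero[of e] power_ideal_zero[OF I] by (simp add: not_le)
  qed
  then have "(\<Sum>e\<in>Poly_Mapping.keys f. Poly_Mapping.single e (Poly_Mapping.lookup f e)) \<in> ?W"
    by (intro sum_induct_closed power_ideal_zero[OF I] power_ideal_add[OF I])
  then show ?thesis by (simp add: poly_mapping_sum_single)
qed

lemma prime_set_power: "prime_set Q \<Longrightarrow> u ^ n \<in> Q \<Longrightarrow> u \<in> Q"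
proof (induction n)
  case 0
  then show ?case using prime_setD(2)[of Q] by simp
next
  case (Suc n)
  then show ?case using prime_setD(3)[of Q u "u ^ n"] by auto
qed

lemma lookup_mem_ideal_content:
  fixes J :: "('v, 'a::comm_ring_1) mpoly set"
  assumes f: "f \<in> J"
  shows "Poly_Mapping.lookup f m \<in> ideal_content J"
proof -
  interpret ring "base_ring :: 'a ring" by (rule ring_from_type_algebra)
  have "Poly_Mapping.lookup f m \<in> poly_content f"
    unfolding poly_content_def by (rule subsetD[OF genideal_self]) auto
  moreover have "(\<Union>f\<in>J. poly_content f) \<subseteq> ideal_content J"
    unfolding ideal_content_def by (rule genideal_self) simp
  ultimately show ?thesis using f by blast
qed

lemma ideal_content_subset:
  fixes J :: "('v, 'a::comm_ring_1) mpoly set"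
  assumes K: "sub_ideal UNIV K" and "\<And>f m. f \<in> J \<Longrightarrow> Poly_Mapping.lookup f m \<in> K"
  shows "ideal_content J \<subseteq> K"
proof -
  interpret ring "base_ring :: 'a ring" by (rule ring_from_type_algebra)
  have Kid: "ideal K base_ring" using K by (simp add: sub_ideal_UNIV_iff)
  have "poly_content f \<subseteq> K" if "f \<in> J" for f
    unfolding poly_content_def by (rule genideal_minimal[OF Kid]) (use assms(2) that in blast)
  then show ?thesis unfolding ideal_content_def by (intro genideal_minimal[OF Kid]) blast
qed

text \<open>A multiple of the \<open>n\<close>-th power of a variable has no term in which that
  variable has a smaller exponent, so these coefficients come from the summand in
  \<open>I\<close>.\<close>

lemma lookup_power_ideal:
  assumes "f \<in> power_ideal I (map mpoly_var vs) n"
    and "\<And>v. v \<in> set vs \<Longrightarrow> Poly_Mapping.lookup e v < n"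
  shows "Poly_Mapping.lookup f e \<in> ideal_content I"
  using assms
proof (induction vs arbitrary: f)
  case Nil
  then show ?case by (simp add: lookup_mem_ideal_content)
next
  case (Cons v vs)
  then obtain g h where gh: "f = mpoly_var v ^ n * g + h" "h \<in> power_ideal I (map mpoly_var vs) n"
    by auto
  have "e \<notin> Poly_Mapping.keys (mpoly_var v ^ n * g)"
  proof
    assume "e \<in> Poly_Mapping.keys (mpoly_var v ^ n * g)"
    then obtain l where "e = Poly_Mapping.single v n + l"
      unfolding mpoly_var_power using keys_single_mult by blast
    then show False using Cons.prems(2)[of v] by (simp add: lookup_add)
  qed
  then have "Poly_Mapping.lookup f e = Poly_Mapping.lookup h e"
    unfolding gh(1) by (simp add: lookup_add in_keys_iff)
  then show ?case using Cons.IH[OF gh(2)] Cons.prems(2) by simp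
qed

lemma lookup_sum_list_single:
  "distinct vs \<Longrightarrow> Poly_Mapping.lookup (\<Sum>v\<leftarrow>vs. Poly_Mapping.single v (n::nat)) u = (if u \<in> set vs then n else 0)"
  by (induction vs) (auto simp: lookup_add lookup_single when_def)

lemma prod_list_mpoly_var_power:
  "prod_list (map mpoly_var vs) ^ n = Poly_Mapping.single (\<Sum>v\<leftarrow>vs. Poly_Mapping.single v n) (1::'a::comm_ring_1)"
proof -
  have "prod_list (map mpoly_var vs) ^ n = prod_list (map (\<lambda>v. mpoly_var v ^ n :: ('b, 'a) mpoly) vs)"
    by (induction vs) (simp_all add: power_mult_distrib)
  also have "\<dots> = Poly_Mapping.single (\<Sum>v\<leftarrow>vs. Poly_Mapping.single v n) 1"
    by (induction vs) (simp_all add: mpoly_var_power mult_single)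
  finally show ?thesis .
qed

text \<open>The arguments \<open>1 1\<close> stand for the class \<open>1 / (U_1 ... U_s)\<close>.
  Multiplication by the \<open>m\<close>-th power of the product moves the constant term of
  \<open>g\<close> to the exponent vector \<open>(m, ..., m)\<close>, just below the bound
  \<open>1 + m\<close>.\<close>

lemma lookup_zero_annihilator_ideal:
  fixes I :: "('v, 'a::comm_ring_1) mpoly set"
  assumes vs: "distinct vs" and g: "g \<in> annihilator_ideal I (map mpoly_var vs) 1 1"
  shows "Poly_Mapping.lookup g 0 \<in> ideal_content I"
proof -
  obtain m where "prod_list (map mpoly_var vs) ^ m * g \<in> power_ideal I (map mpoly_var vs) (1 + m)"
    using g by (auto simp: annihilator_ideal_def)
  then have "Poly_Mapping.lookup (prod_list (map mpoly_var vs) ^ m * g) (\<Sum>v\<leftarrow>vs. Poly_Mapping.single v m)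
      \<in> ideal_content I"
    by (rule lookup_power_ideal) (simp add: lookup_sum_list_single[OF vs])
  then show ?thesis
    unfolding prod_list_mpoly_var_power
    using lookup_single_mult[of "\<Sum>v\<leftarrow>vs. Poly_Mapping.single v m" "1::'a" g 0] by simp
qed

lemma nonconstant_mem:
  fixes g :: "('v, 'a::comm_ring_1) mpoly"
  assumes Q: "sub_ideal UNIV Q" and v: "range mpoly_var \<subseteq> Q"
  shows "g - mpoly_const (Poly_Mapping.lookup g 0) \<in> Q"
proof (induction g rule: poly_mapping_add_induct)
  case zero
  then show ?case using sub_idealD(2)[OF Q] by (simp add: mpoly_const_def)
next
  case (plus k b g)
  have "Poly_Mapping.single k b - mpoly_const (Poly_Mapping.lookup (Poly_Mapping.single k b) 0) \<in> Q"
  proof (cases "k = 0")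
    case True
    then show ?thesis using sub_idealD(2)[OF Q] by (simp add: mpoly_const_def)
  next
    case False
    then obtain u where "Poly_Mapping.lookup k u \<noteq> 0" by (metis lookup_zero poly_mapping_eqI)
    then have "Poly_Mapping.single k b = Poly_Mapping.single (k - Poly_Mapping.single u 1) b * mpoly_var u"
      using single_eq_mpoly_var_mult[of 1 k u b] by (simp add: mult.commute)
    then have "Poly_Mapping.single k b \<in> Q" using sub_idealD(4)[OF Q UNIV_I subsetD[OF v rangeI]] by simp
    then show ?thesis using False by (simp add: lookup_single mpoly_const_def)
  qed
  from sub_idealD(3)[OF Q this plus]
  show ?case by (simp add: lookup_add mpoly_const_def single_add algebra_simps)
qed

lemma annihilator_ideal_subset_prime:
  fixes I :: "('v, 'a::comm_ring_1) mpoly set"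
  assumes vs: "distinct vs" and Q: "sub_ideal UNIV Q" and v: "range mpoly_var \<subseteq> Q"
    and c: "mpoly_const ` ideal_content I \<subseteq> Q"
  shows "annihilator_ideal I (map mpoly_var vs) 1 1 \<subseteq> Q"
proof
  fix g assume "g \<in> annihilator_ideal I (map mpoly_var vs) 1 1"
  then have "mpoly_const (Poly_Mapping.lookup g 0) \<in> Q"
    using lookup_zero_annihilator_ideal[OF vs] c by auto
  from sub_idealD(3)[OF Q nonconstant_mem[OF Q v, of g] this] show "g \<in> Q" by simp
qed

text \<open>The \<open>n\<close>-th power of a variable kills every fraction with denominator
  \<open>(U_1 ... U_s)^n\<close>, and a prime contains the base of any power in it.\<close>

lemma mpoly_var_mem_annihilator_ideal:
  fixes I :: "('v::finite, 'a::comm_ring_1) mpoly set"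
  assumes I: "sub_ideal UNIV I" and vs: "set vs = UNIV"
    and Q: "prime_set (annihilator_ideal I (map mpoly_var vs) n f)"
  shows "range mpoly_var \<subseteq> annihilator_ideal I (map mpoly_var vs) n f"
proof -
  let ?Q = "annihilator_ideal I (map mpoly_var vs) n f"
  have "mpoly_var v \<in> ?Q" for v
  proof -
    have "mpoly_var v ^ n \<in> ?Q"
      by (rule mem_annihilator_idealI, rule mem_power_ideal(2)[OF I]) (simp add: vs)
    then show ?thesis by (rule prime_set_power[OF Q])
  qed
  then show ?thesis by auto
qed

section \<open>Homogeneous relations and the content\<close>

lemma lookup_homogeneous_component:
  "Poly_Mapping.lookup (homogeneous_component w n f) m =
    (if weighted_degree w m = n then Poly_Mapping.lookup f m else 0)"
  unfolding homogeneous_component_def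
  by (simp add: lookup_sum lookup_single when_def in_keys_iff sum.delta' cong: if_cong)

lemma weighted_degree_add: "weighted_degree w (k + l) = weighted_degree w k + weighted_degree w l"
  by (simp add: weighted_degree_def lookup_add algebra_simps sum.distrib)

text \<open>As every weight is at least one, no exponent exceeds the degree \<open>n\<close>. This
  is where positivity of the degrees enters.\<close>

lemma finite_weighted_degree:
  fixes w :: "'v::finite \<Rightarrow> nat"
  assumes w: "\<And>i. w i > 0"
  shows "finite {m. weighted_degree w m = n}"
proof (rule finite_imageD)
  have "Poly_Mapping.lookup m i \<le> n" if "weighted_degree w m = n" for m i
  proof -
    have "Poly_Mapping.lookup m i \<le> w i * Poly_Mapping.lookup m i" using w[of i] by simp
    also have "\<dots> \<le> weighted_degree w m" unfolding weighted_degree_def by (rule member_le_sum) simp_all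
    finally show ?thesis using that by simp
  qed
  then have "Poly_Mapping.lookup ` {m. weighted_degree w m = n} \<subseteq> UNIV \<rightarrow>\<^sub>E {..n}" by auto
  then show "finite (Poly_Mapping.lookup ` {m. weighted_degree w m = n})"
    by (rule finite_subset) (rule finite_PiE, simp_all)
  show "inj_on Poly_Mapping.lookup {m. weighted_degree w m = n}" by (simp add: inj_on_def lookup_inject)
qed

text \<open>A total order on exponent vectors that is compatible with addition, obtained by evaluating
  monomials at distinct primes.\<close>

lemma exists_monomial_order:
  "\<exists>\<tau> :: ('v::finite \<Rightarrow>\<^sub>0 nat) \<Rightarrow> nat. inj \<tau> \<and> (\<forall>k l. \<tau> (k + l) = \<tau> k * \<tau> l) \<and> (\<forall>k. \<tau> k > 0)"
proof -
  obtain B :: "nat set" where B: "finite B" "card B = CARD('v)" "B \<subseteq> {p. Factorial_Ring.prime p}"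
    using infinite_arbitrarily_large[OF primes_infinite] by metis
  then obtain p :: "'v \<Rightarrow> nat" where p: "bij_betw p UNIV B"
    using finite_same_card_bij[of "UNIV :: 'v set" B] by auto
  have inj: "inj p" and prime: "Factorial_Ring.prime (p v)" for v using p B(3) by (auto simp: bij_betw_def)
  define \<tau> :: "('v \<Rightarrow>\<^sub>0 nat) \<Rightarrow> nat" where "\<tau> k = (\<Prod>v\<in>UNIV. p v ^ Poly_Mapping.lookup k v)" for k
  have mult: "multiplicity (p v) (\<tau> k) = Poly_Mapping.lookup k v" for v k
  proof -
    have "\<tau> k = (\<Prod>q\<in>range p. q ^ Poly_Mapping.lookup k (inv_into UNIV p q))"
      unfolding \<tau>_def by (subst prod.reindex[OF inj]) (simp add: inj)
    moreover have "Factorial_Ring.prime q" if "q \<in> range p" for q using that prime by auto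
    ultimately show ?thesis
      using multiplicity_prod_prime_powers[of "range p" "p v" "\<lambda>q. Poly_Mapping.lookup k (inv_into UNIV p q)"]
      by (simp add: prime inj)
  qed
  have "inj \<tau>" by (rule injI, rule poly_mapping_eqI) (metis mult)
  moreover have "\<tau> (k + l) = \<tau> k * \<tau> l" for k l
    unfolding \<tau>_def by (simp add: lookup_add power_add prod.distrib)
  moreover have "\<tau> k > 0" for k
    unfolding \<tau>_def by (rule prod_pos) (simp add: prime prime_gt_0_nat)
  ultimately show ?thesis by blast
qed

text \<open>The classes \<open>U\<^sup>-\<^sup>\<nu>\<close> with all entries of \<open>\<nu>\<close> positive and of a fixed degree are finitely many.
  Multiplying \<open>U\<^sup>-\<^sup>(\<^sup>\<nu>\<^sup>+\<^sup>\<beta>\<^sup>)\<close> by \<open>h\<close>, where \<open>\<beta>\<close> is the largest exponent of \<open>h\<close> whose coefficient is outside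
  \<open>Q\<close>, gives a relation among them whose matrix is triangular modulo \<open>Q\<close>.\<close>

lemma monomial_annihilator:
  fixes I :: "('v::finite, 'a::comm_ring_1) mpoly set"
  assumes w: "\<And>i. w i > 0" and I: "sub_ideal UNIV I" and vs: "distinct vs" "set vs = UNIV"
    and Q: "prime_set Q" and h: "h \<in> I"
    and hom: "\<And>m. m \<in> Poly_Mapping.keys h \<Longrightarrow> weighted_degree w m = D"
    and nQ: "mpoly_const (Poly_Mapping.lookup h m0) \<notin> Q"
  shows "\<exists>a. a \<notin> Q \<and>
    a * Poly_Mapping.single e 1 \<in> annihilator_ideal I (map mpoly_var vs) n 1"
proof (cases "\<exists>v. n \<le> Poly_Mapping.lookup e v")
  \<comment> \<open>Here the \<open>n\<close>-th power of a variable divides the monomial, so the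
    fraction is zero and \<open>a = 1\<close> serves.\<close>
  case True
  then obtain v where v: "n \<le> Poly_Mapping.lookup e v" by (rule exE)
  have "Poly_Mapping.single e (1::'a) \<in> power_ideal I (map mpoly_var vs) n"
    unfolding single_eq_mpoly_var_mult[OF v] by (rule mem_power_ideal(2)[OF I]) (simp add: vs)
  then have "1 * Poly_Mapping.single e (1::'a) \<in> annihilator_ideal I (map mpoly_var vs) n 1"
    by (intro mem_annihilator_idealI) simp
  then show ?thesis using prime_setD(2)[OF Q] by blast
next
  case False
  then have e: "Poly_Mapping.lookup e v < n" for v by (simp add: not_le)
  \<comment> \<open>\<open>?c n\<close> has all entries \<open>n\<close>: it is the exponent vector
    of the denominator \<open>(U_1 ... U_s)^n\<close>.\<close>
  let ?c = "\<lambda>n::nat. \<Sum>v\<leftarrow>vs. Poly_Mapping.single v n"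
  have lc [simp]: "Poly_Mapping.lookup (?c n) v = n" for n v
    using lookup_sum_list_single[OF vs(1), of n v] vs(2) by simp
  obtain \<tau> :: "('v \<Rightarrow>\<^sub>0 nat) \<Rightarrow> nat" where \<tau>: "inj \<tau>" "\<And>k l. \<tau> (k + l) = \<tau> k * \<tau> l" "\<And>k. \<tau> k > 0"
    using exists_monomial_order by metis
  note QI = sub_idealD[OF prime_setD(1)[OF Q]]
  have const0: "mpoly_const 0 \<in> Q" using QI(2) by (simp add: mpoly_const_def)
  define K where "K = {m \<in> Poly_Mapping.keys h. mpoly_const (Poly_Mapping.lookup h m) \<notin> Q}"
  have "m0 \<in> K" using nQ const0 unfolding K_def by (cases "Poly_Mapping.lookup h m0 = 0") (auto simp: in_keys_iff)
  moreover have finK: "finite K" by (simp add: K_def)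
  ultimately have "Max (\<tau> ` K) \<in> \<tau> ` K" by (intro Max_in) auto
  then obtain \<beta> where \<beta>: "\<beta> \<in> K" "\<tau> \<beta> = Max (\<tau> ` K)" by auto
  have \<beta>max: "mpoly_const (Poly_Mapping.lookup h l) \<in> Q" if "\<tau> \<beta> < \<tau> l" for l
  proof (rule ccontr)
    assume n: "mpoly_const (Poly_Mapping.lookup h l) \<notin> Q"
    then have "l \<in> K" using const0 unfolding K_def
      by (cases "Poly_Mapping.lookup h l = 0") (auto simp: in_keys_iff)
    then have "\<tau> l \<le> \<tau> \<beta>" unfolding \<beta>(2) using finK by (intro Max_ge) auto
    then show False using that by simp
  qed
  \<comment> \<open>The fraction in question is the inverse monomial with exponent vector
    \<open>\<nu>0\<close>, whose entries are positive because those of \<open>e\<close> are below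
    \<open>n\<close>.\<close>
  define \<nu>0 where "\<nu>0 = ?c n - e"
  define F where "F = {\<nu>. weighted_degree w \<nu> = weighted_degree w \<nu>0 \<and> (\<forall>v. 1 \<le> Poly_Mapping.lookup \<nu> v)}"
  have finF: "finite F"
    unfolding F_def
    by (rule finite_subset[OF _ finite_weighted_degree[of w "weighted_degree w \<nu>0"]]) (auto intro: w)
  \<comment> \<open>A common denominator: with this \<open>N\<close> the truncated differences
    \<open>?c N - j\<close> and \<open>?c N - (i + \<beta>)\<close> for \<open>i\<close>,
    \<open>j\<close> in \<open>F\<close> are true differences.\<close>
  define N where "N = Max (insert n ((\<lambda>(\<nu>, v). Poly_Mapping.lookup (\<nu> + \<beta>) v) ` (F \<times> UNIV)))"
  have Nn: "n \<le> N" unfolding N_def by (rule Max_ge) (simp_all add: finF)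
  have NF: "Poly_Mapping.lookup \<nu> v + Poly_Mapping.lookup \<beta> v \<le> N" if "\<nu> \<in> F" for \<nu> v
  proof -
    have "(\<lambda>(\<nu>, v). Poly_Mapping.lookup (\<nu> + \<beta>) v) (\<nu>, v) \<le> N"
      unfolding N_def by (rule Max_ge) (use finF that in \<open>auto intro!: insertI2 imageI\<close>)
    then show ?thesis by (simp add: lookup_add)
  qed
  let ?W = "power_ideal I (map mpoly_var vs) N"
  note WI = power_ideal_closed[OF I]
  \<comment> \<open>Over the denominator with exponent \<open>N\<close>, \<open>t i\<close> is the
    numerator of \<open>h\<close> times the inverse monomial of \<open>i + \<beta>\<close>, and
    \<open>b i j\<close> is its coefficient at the inverse monomial of \<open>j\<close>.\<close>
  define t where "t i = Poly_Mapping.single (?c N - (i + \<beta>)) 1 * h" for i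
  define b :: "('v \<Rightarrow>\<^sub>0 nat) \<Rightarrow> ('v \<Rightarrow>\<^sub>0 nat) \<Rightarrow> ('v, 'a) mpoly" where
    "b i j = mpoly_const (Poly_Mapping.lookup (t i) (?c N - j))" for i j
  have split\<beta>: "?c N - (i + \<beta>) + (i + \<beta>) = ?c N" if "i \<in> F" for i
    by (rule poly_mapping_eqI) (use NF[OF that] in \<open>simp add: lookup_add lookup_minus\<close>)
  have splitF: "?c N - j + j = ?c N" if "j \<in> F" for j
    by (rule poly_mapping_eqI) (use add_leD1[OF NF[OF that]] in \<open>simp add: lookup_add lookup_minus\<close>)
  have splitx: "?c N - x + x = ?c N" if "\<And>v. Poly_Mapping.lookup x v < N" for x
    by (rule poly_mapping_eqI) (use that in \<open>simp add: lookup_add lookup_minus less_imp_le\<close>)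
  have t_keys: "\<exists>l\<in>Poly_Mapping.keys h. x = ?c N - (i + \<beta>) + l" if "Poly_Mapping.lookup (t i) x \<noteq> 0" for i x
  proof -
    have "x \<in> Poly_Mapping.keys (t i)" using that by (simp add: in_keys_iff)
    then show ?thesis unfolding t_def using keys_mult by (fastforce split: if_splits)
  qed
  have injF: "inj_on \<tau> F" using \<tau>(1) by (rule inj_on_subset) simp
  have "\<exists>a. a \<notin> Q \<and> (\<forall>i\<in>F. a * Poly_Mapping.single (?c N - i) 1 \<in> ?W)"
  proof (rule triangular_annihilator[where b = b, OF finF injF Q])
    show "sub_ideal UNIV ?W" unfolding sub_ideal_def using WI by simp
  next
    fix i assume i: "i \<in> F"
    have "?c N - i = ?c N - (i + \<beta>) + \<beta>"
      by (rule poly_mapping_eqI) (use NF[OF i] in \<open>simp add: lookup_add lookup_minus\<close>)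
    then have "b i i = mpoly_const (Poly_Mapping.lookup h \<beta>)"
      unfolding b_def t_def using lookup_single_mult[of _ "1::'a" h \<beta>] by simp
    then show "b i i \<notin> Q" using \<beta>(1) by (simp add: K_def)
  next
    fix i j assume ij: "i \<in> F" "j \<in> F" "\<tau> j < \<tau> i"
    show "b i j \<in> Q"
    proof (cases "Poly_Mapping.lookup (t i) (?c N - j) = 0")
      case True
      then show ?thesis using const0 by (simp add: b_def)
    next
      case False
      then obtain l where l: "?c N - j = ?c N - (i + \<beta>) + l" using t_keys by blast
      \<comment> \<open>Comparison of exponents gives \<open>l + j = i + \<beta>\<close>. As
        \<open>\<tau>\<close> is multiplicative and \<open>j\<close> precedes \<open>i\<close>,
        \<open>l\<close> comes after \<open>\<beta>\<close>, where all coefficients of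
        \<open>h\<close> lie in \<open>Q\<close>.\<close>
      have "?c N - (i + \<beta>) + (l + j) = ?c N - (i + \<beta>) + (i + \<beta>)"
        using splitF[OF ij(2)] split\<beta>[OF ij(1)] l by (simp add: add.assoc)
      then have "\<tau> l * \<tau> j = \<tau> i * \<tau> \<beta>" using \<tau>(2) by (metis add_left_cancel)
      moreover have "\<tau> \<beta> * \<tau> j < \<tau> \<beta> * \<tau> i" using ij(3) \<tau>(3)[of \<beta>] by simp
      ultimately have "\<tau> \<beta> * \<tau> j < \<tau> l * \<tau> j" by (simp add: mult.commute)
      then have "\<tau> \<beta> < \<tau> l" by simp
      moreover have "b i j = mpoly_const (Poly_Mapping.lookup h l)"
        unfolding b_def l t_def using lookup_single_mult[of _ "1::'a" h l] by simp
      ultimately show ?thesis using \<beta>max by simp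
    qed
  next
    fix i assume i: "i \<in> F"
    let ?s = "\<Sum>j\<in>F. b i j * Poly_Mapping.single (?c N - j) 1"
    have tW: "t i \<in> ?W"
      unfolding t_def by (rule mem_power_ideal(1)[OF I]) (rule sub_idealD(4)[OF I UNIV_I h])
    \<comment> \<open>A term of \<open>t i\<close> with all exponents below \<open>N\<close> is an
      inverse monomial of the degree of \<open>i\<close>, because \<open>h\<close> is homogeneous,
      and is therefore indexed by \<open>F\<close>. All other terms lie in
      \<open>?W\<close>.\<close>
    have "t i - ?s \<in> ?W"
    proof (rule mem_power_ideal_if_coeff_zero[OF I])
      fix x assume "\<And>v. v \<in> set vs \<Longrightarrow> Poly_Mapping.lookup x v < N"
      then have x: "Poly_Mapping.lookup x v < N" for v using vs(2) by simp
      have iff: "?c N - j = x \<longleftrightarrow> j = ?c N - x" if j: "j \<in> F" for j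
        using splitF[OF j] splitx[OF x] by (metis add.commute add_left_cancel)
      have "Poly_Mapping.lookup ?s x = (\<Sum>j\<in>F. if j = ?c N - x then Poly_Mapping.lookup (t i) x else 0)"
        unfolding lookup_sum
      proof (rule sum.cong[OF refl])
        fix j assume j: "j \<in> F"
        show "Poly_Mapping.lookup (b i j * Poly_Mapping.single (?c N - j) 1) x =
            (if j = ?c N - x then Poly_Mapping.lookup (t i) x else 0)"
          unfolding b_def mpoly_const_def mult_single iff[OF j, symmetric]
          by (auto simp: lookup_single when_def)
      qed
      also have "\<dots> = (if ?c N - x \<in> F then Poly_Mapping.lookup (t i) x else 0)"
        using finF by simp
      also have "\<dots> = Poly_Mapping.lookup (t i) x"
      proof (cases "Poly_Mapping.lookup (t i) x = 0")
        case False
        then obtain l where l: "l \<in> Poly_Mapping.keys h" "x = ?c N - (i + \<beta>) + l" using t_keys by blast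
        have \<beta>D: "weighted_degree w \<beta> = D" using \<beta>(1) hom by (simp add: K_def)
        have "weighted_degree w (?c N - x) + weighted_degree w x = weighted_degree w (?c N)"
          unfolding weighted_degree_add[symmetric] splitx[OF x] ..
        moreover have "weighted_degree w (?c N - (i + \<beta>)) + (weighted_degree w i + weighted_degree w \<beta>) =
            weighted_degree w (?c N)"
          unfolding weighted_degree_add[symmetric] split\<beta>[OF i] ..
        moreover have "weighted_degree w x = weighted_degree w (?c N - (i + \<beta>)) + weighted_degree w l"
          unfolding l(2) weighted_degree_add ..
        ultimately have "weighted_degree w (?c N - x) = weighted_degree w i"
          using hom[OF l(1)] \<beta>D by linarith
        then have "?c N - x \<in> F"
          using i x unfolding F_def by (simp add: lookup_minus Suc_le_eq)
        then show ?thesis by simp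
      qed simp
      finally show "Poly_Mapping.lookup (t i - ?s) x = 0" by (simp add: lookup_minus)
    qed
    from WI(2)[OF tW WI(3)[OF this, of "-1"]] show "?s \<in> ?W" by simp
  qed
  then obtain a where a: "a \<notin> Q" "\<And>i. i \<in> F \<Longrightarrow> a * Poly_Mapping.single (?c N - i) 1 \<in> ?W" by blast
  have \<nu>0F: "\<nu>0 \<in> F" using e unfolding F_def \<nu>0_def by (simp add: lookup_minus Suc_le_eq)
  \<comment> \<open>Back to the exponent \<open>n\<close>: over the denominator with exponent
    \<open>N\<close>, the original fraction appears expanded by the power \<open>N - n\<close> of
    the product.\<close>
  have "?c N - \<nu>0 = ?c (N - n) + e"
    by (rule poly_mapping_eqI) (use e Nn in \<open>simp add: \<nu>0_def lookup_add lookup_minus less_imp_le\<close>)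
  then have "Poly_Mapping.single (?c N - \<nu>0) (1::'a) =
      prod_list (map mpoly_var vs) ^ (N - n) * Poly_Mapping.single e 1"
    unfolding prod_list_mpoly_var_power mult_single by simp
  then have "prod_list (map mpoly_var vs) ^ (N - n) * (a * Poly_Mapping.single e 1 * 1)
      \<in> power_ideal I (map mpoly_var vs) (n + (N - n))"
    using a(2)[OF \<nu>0F] Nn by (simp add: mult_ac)
  then have "a * Poly_Mapping.single e 1 \<in> annihilator_ideal I (map mpoly_var vs) n 1"
    unfolding annihilator_ideal_def by blast
  then show ?thesis using a(1) by blast
qed

lemma ideal_content_subset_prime_annihilator:
  fixes I :: "('v::finite, 'a::comm_ring_1) mpoly set"
  assumes w: "\<And>i. w i > 0" and I: "sub_ideal UNIV I" and vs: "distinct vs" "set vs = UNIV"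
    and hom: "\<And>f n. f \<in> I \<Longrightarrow> homogeneous_component w n f \<in> I"
    and Q: "prime_set (annihilator_ideal I (map mpoly_var vs) n f)"
  shows "mpoly_const ` ideal_content I \<subseteq> annihilator_ideal I (map mpoly_var vs) n f"
proof -
  let ?Q = "annihilator_ideal I (map mpoly_var vs) n f"
  \<comment> \<open>Membership of \<open>a * r\<close> in \<open>?L\<close> says that
    \<open>a\<close> kills the fraction with numerator \<open>r\<close> and exponent
    \<open>n\<close>; for \<open>r = f\<close> it says that \<open>a\<close> lies in
    \<open>?Q\<close>.\<close>
  let ?L = "annihilator_ideal I (map mpoly_var vs) n 1"
  have L: "sub_ideal UNIV ?L" by (rule annihilator_ideal_sub_ideal[OF I])
  note LI = sub_idealD[OF L] and QI = sub_idealD[OF prime_setD(1)[OF Q]]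
  have coeff: "mpoly_const (Poly_Mapping.lookup g m) \<in> ?Q" if g: "g \<in> I" for g m
  proof (rule ccontr)
    assume n: "mpoly_const (Poly_Mapping.lookup g m) \<notin> ?Q"
    \<comment> \<open>The component of \<open>g\<close> in the degree of \<open>m\<close> keeps the
      offending coefficient and still lies in \<open>I\<close>.\<close>
    define h where "h = homogeneous_component w (weighted_degree w m) g"
    have h: "h \<in> I" "\<And>l. l \<in> Poly_Mapping.keys h \<Longrightarrow> weighted_degree w l = weighted_degree w m"
      "mpoly_const (Poly_Mapping.lookup h m) \<notin> ?Q"
      using hom[OF g] n by (auto simp: h_def in_keys_iff lookup_homogeneous_component split: if_splits)
    \<comment> \<open>From monomials to all numerators: a sum is killed by the product of the
      multipliers of its terms, which stays outside the prime.\<close>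
    have "\<exists>a. a \<notin> ?Q \<and> a * r \<in> ?L" for r
    proof (induction r rule: poly_mapping_add_induct)
      case zero
      then show ?case using prime_setD(2)[OF Q] LI(2) by (intro exI[of _ 1]) simp
    next
      case (plus k b r)
      obtain a where a: "a \<notin> ?Q" "a * r \<in> ?L" using plus by blast
      obtain a' where a': "a' \<notin> ?Q" "a' * Poly_Mapping.single k 1 \<in> ?L"
        using monomial_annihilator[OF w I vs Q h] by blast
      have "(a * mpoly_const b) * (a' * Poly_Mapping.single k 1) + a' * (a * r) \<in> ?L"
        by (intro LI(3) LI(4)[OF UNIV_I a'(2)] LI(4)[OF UNIV_I a(2)])
      moreover have "Poly_Mapping.single k b = mpoly_const b * Poly_Mapping.single k 1"
        by (simp add: mpoly_const_def mult_single)
      ultimately have "(a * a') * (Poly_Mapping.single k b + r) \<in> ?L"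
        by (simp add: algebra_simps)
      moreover have "a * a' \<notin> ?Q" using prime_setD(3)[OF Q] a(1) a'(1) by blast
      ultimately show ?case by blast
    qed
    then obtain a where "a \<notin> ?Q" "a * f \<in> ?L" by blast
    then show False using mem_annihilator_ideal_mult[of a I "map mpoly_var vs" n f 1] by simp
  qed
  have c: "mpoly_const (a + b) = mpoly_const a + mpoly_const b" "mpoly_const (a * b) = mpoly_const a * mpoly_const b"
    "mpoly_const 0 = 0" for a b :: 'a
    by (simp_all add: mpoly_const_def mult_single single_add)
  have "sub_ideal UNIV {a. mpoly_const a \<in> ?Q}"
    unfolding sub_ideal_def using QI by (simp add: c)
  from ideal_content_subset[OF this, of I] coeff show ?thesis by blast
qed

section \<open>Correspondence between primes of \<open>R\<close> and primes of \<open>S\<close>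
  containing \<open>I\<close>\<close>

context quotient_ring
begin

lemma mem_proj_image:
  assumes K: "sub_ideal UNIV K" and IK: "I \<subseteq> K"
  shows "proj f \<in> proj ` K \<longleftrightarrow> f \<in> K"
proof
  assume "proj f \<in> proj ` K"
  then obtain k where k: "k \<in> K" "f - k \<in> I" by (auto simp: proj_eq_iff)
  then have "(f - k) + k \<in> K" using IK sub_idealD(3)[OF K] by blast
  then show "f \<in> K" by simp
qed simp

lemma sub_ideal_vimage_proj:
  assumes "ideal P R"
  shows "sub_ideal UNIV {f. proj f \<in> P}"
proof -
  interpret ideal P R by fact
  show ?thesis
    unfolding sub_ideal_def
    using additive_subgroup.a_closed[OF is_additive_subgroup] additive_subgroup.zero_closed[OF is_additive_subgroup]
      I_l_closed by (simp add: proj_add proj_mult proj_zero)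
qed

lemma proj_vimage_proj: "P \<subseteq> carrier R \<Longrightarrow> proj ` {f. proj f \<in> P} = P"
  unfolding carrier_R by blast

lemma I_subset_vimage_proj:
  assumes "ideal P R"
  shows "I \<subseteq> {f. proj f \<in> P}"
proof
  fix f assume "f \<in> I"
  then have "proj f = \<zero>\<^bsub>R\<^esub>" by (simp add: proj_eq_zero_iff)
  then show "f \<in> {f. proj f \<in> P}"
    using additive_subgroup.zero_closed[OF ideal.axioms(1)[OF assms]] by simp
qed

lemma prime_set_vimage_proj:
  assumes "primeideal P R"
  shows "prime_set {f. proj f \<in> P}"
proof -
  interpret primeideal P R by fact
  have "proj 1 \<notin> P" using one_imp_carrier I_notcarr by (auto simp: proj_one)
  moreover have "proj a \<in> P \<or> proj b \<in> P" if "proj (a * b) \<in> P" for a b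
    using I_prime[of "proj a" "proj b"] that by (simp add: proj_mult)
  ultimately show ?thesis
    unfolding prime_set_def using sub_ideal_vimage_proj[OF is_ideal] by simp
qed

lemma primeideal_proj_image:
  assumes Q: "prime_set Q" and IQ: "I \<subseteq> Q"
  shows "primeideal (proj ` Q) R"
proof (rule primeidealI)
  note mem = mem_proj_image[OF prime_setD(1)[OF Q] IQ]
  show "ideal (proj ` Q) R" by (rule ideal_image[OF prime_setD(1)[OF Q]])
  show "cring R" by (rule cring_R)
  show "carrier R \<noteq> proj ` Q" using mem[of 1] prime_setD(2)[OF Q] proj_closed[of 1] by metis
  fix a b assume "a \<in> carrier R" "b \<in> carrier R" "a \<otimes>\<^bsub>R\<^esub> b \<in> proj ` Q"
  moreover obtain f g where fg: "a = proj f" "b = proj g"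
    using \<open>a \<in> carrier R\<close> \<open>b \<in> carrier R\<close> by (auto simp: carrier_R)
  ultimately have "proj (f * g) \<in> proj ` Q" by (simp add: proj_mult)
  then have "f * g \<in> Q" unfolding mem .
  then show "a \<in> proj ` Q \<or> b \<in> proj ` Q"
    unfolding fg mem using prime_setD(3)[OF Q] by simp
qed

text \<open>The preimage of a minimal prime over \<open>J\<close> contains a member of the finite
  family from \<open>finite_primes_below\<close>; by minimality the image of that member is the
  given prime.\<close>

lemma finite_minimal_primes:
  assumes acc: "acc_on (UNIV :: 's set)" and J: "ideal J R"
  shows "finite (minimal_primes R J)"
proof -
  obtain F where F: "finite F" "\<forall>P\<in>F. prime_set P \<and> {f. proj f \<in> J} \<subseteq> P"
    "\<forall>P. prime_set P \<and> {f. proj f \<in> J} \<subseteq> P \<longrightarrow> (\<exists>Q\<in>F. Q \<subseteq> P)"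
    using finite_primes_below[OF acc sub_ideal_vimage_proj[OF J]] by (elim exE conjE)
  have "minimal_primes R J \<subseteq> (\<lambda>Q. proj ` Q) ` F"
  proof
    fix P assume P: "P \<in> minimal_primes R J"
    then have pP: "primeideal P R" and JP: "J \<subseteq> P" by (simp_all add: minimal_primes_def)
    then have "{f. proj f \<in> J} \<subseteq> {f. proj f \<in> P}" by blast
    then obtain Q where Q: "Q \<in> F" "Q \<subseteq> {f. proj f \<in> P}"
      using F(3) prime_set_vimage_proj[OF pP] by meson
    have Qp: "prime_set Q" "{f. proj f \<in> J} \<subseteq> Q" using F(2) Q(1) by simp_all
    have "primeideal (proj ` Q) R"
      by (rule primeideal_proj_image[OF Qp(1) subset_trans[OF I_subset_vimage_proj[OF J] Qp(2)]])
    moreover have "J \<subseteq> proj ` Q"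
      using image_mono[OF Qp(2), of proj] proj_vimage_proj[OF subsetI[OF ideal.Icarr[OF J]]] by simp
    moreover have "proj ` Q \<subseteq> P" using Q(2) by blast
    ultimately have "proj ` Q = P" using P unfolding minimal_primes_def by simp
    then show "P \<in> (\<lambda>Q. proj ` Q) ` F" using Q(1) by blast
  qed
  then show ?thesis using F(1) by (rule finite_surj[rotated])
qed

end

theorem corollary2p8:
  fixes w :: "'v::finite \<Rightarrow> nat"
    and I :: "('v, 'a::idom) mpoly set"
    and R :: "('v, 'a) mpoly set ring"
    and E :: "nat \<Rightarrow> (('v, 'a) mpoly set, 'e) module"
    and d :: "nat \<Rightarrow> 'e \<Rightarrow> 'e"
    and \<epsilon> :: "('v, 'a) mpoly set \<Rightarrow> 'e"
  assumes "noetherian_domain (base_ring :: 'a ring)"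
    and "\<And>i. w i > 0"
    and "homogeneous_ideal w I"
    and "R = mpoly_ring Quot I"
    and "injective_resolution R (regular_module R) \<epsilon> E d"
  shows "finite (minimal_associated_primes R
           (local_cohomology R (irrelevant_ideal I) E d CARD('v))) \<and>
         minimal_associated_primes R (local_cohomology R (irrelevant_ideal I) E d CARD('v)) =
           minimal_primes R (extended_content I <+>\<^bsub>R\<^esub> irrelevant_ideal I)"
proof -
  have idI: "ideal I mpoly_ring" and hom: "\<And>f n. f \<in> I \<Longrightarrow> homogeneous_component w n f \<in> I"
    using assms(3) by (simp_all add: homogeneous_ideal_def)
  interpret quotient_ring I R by (rule quotient_ring.intro[OF idI assms(4)])
  interpret R: cring R by (rule cring_R)
  have acc: "acc_on (UNIV :: ('v, 'a) mpoly set)"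
    by (rule hilbert_basis_mpoly[OF noetherian_domain.axioms(1)[OF assms(1)]])
  \<comment> \<open>Any order of the variables will do, since the torsion functor depends only on
    the ideal generated by \<open>set ?us\<close>.\<close>
  obtain vs :: "'v list" where vs: "set vs = UNIV" "distinct vs"
    using finite_distinct_list[of "UNIV :: 'v set"] by auto
  let ?us = "map mpoly_var vs :: ('v, 'a) mpoly list"
  let ?H = "local_cohomology R (irrelevant_ideal I) E d CARD('v)"
  let ?J = "extended_content I <+>\<^bsub>R\<^esub> irrelevant_ideal I"
  let ?A = "annihilator_ideal I ?us"
  have len: "CARD('v) = length ?us" using distinct_card[OF vs(2)] vs(1) by simp
  have irr: "irrelevant_ideal I = genideal R (proj ` set ?us)"
    unfolding irrelevant_ideal_def assms(4) by (simp add: vs(1) image_image proj_def)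
  have ext: "extended_content I = genideal R (proj ` mpoly_const ` ideal_content I)"
    unfolding extended_content_def assms(4) by (simp add: image_image proj_def)
  have sub: "proj ` B \<subseteq> carrier R" for B by (simp add: image_subset_iff)
  have ids: "ideal (extended_content I) R" "ideal (irrelevant_ideal I) R"
    unfolding irr ext by (rule R.genideal_ideal[OF sub])+
  have J: "ideal ?J R" by (rule R.add_ideals[OF ids])
  have J_subset: "?J \<subseteq> P \<longleftrightarrow>
      mpoly_const ` ideal_content I \<subseteq> {f. proj f \<in> P} \<and> range mpoly_var \<subseteq> {f. proj f \<in> P}"
    if P: "ideal P R" for P
  proof -
    have "?J \<subseteq> P \<longleftrightarrow> extended_content I \<union> irrelevant_ideal I \<subseteq> P"
      unfolding R.union_genideal[OF ids, symmetric]
      by (rule R.Idl_subset_ideal[OF P]) (use ideal.Icarr[OF ids(1)] ideal.Icarr[OF ids(2)] in blast)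
    also have "\<dots> \<longleftrightarrow> proj ` mpoly_const ` ideal_content I \<subseteq> P \<and> proj ` set ?us \<subseteq> P"
      unfolding irr ext using R.Idl_subset_ideal[OF P sub] by simp
    finally show ?thesis using vs(1) by (auto simp: image_subset_iff)
  qed
  have ass: "associated_primes R ?H = {P. primeideal P R \<and> (\<exists>n f. P = proj ` ?A n f)}"
    unfolding irr len by (rule associated_primes_local_cohomology[OF acc assms(5)])
  have A: "sub_ideal UNIV (?A n f)" "I \<subseteq> ?A n f" for n f
  proof -
    show "sub_ideal UNIV (?A n f)" by (rule annihilator_ideal_sub_ideal[OF sub_ideal_I])
    show "I \<subseteq> ?A n f"
    proof
      fix g assume "g \<in> I"
      then have "g * f \<in> I" using sub_idealD(4)[OF sub_ideal_I UNIV_I, of g f] by (simp add: mult.commute)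
      then show "g \<in> ?A n f" by (intro mem_annihilator_idealI mem_power_ideal(1)[OF sub_ideal_I])
    qed
  qed
  have vimage_A: "{g. proj g \<in> proj ` ?A n f} = ?A n f" for n f
    using mem_proj_image[OF A] by blast
  have J_le: "?J \<subseteq> P" if P: "P \<in> associated_primes R ?H" for P
  proof -
    obtain n f where Pp: "primeideal P R" and Pe: "P = proj ` ?A n f" using P unfolding ass by blast
    have prime: "prime_set (?A n f)"
      using prime_set_vimage_proj[OF Pp] unfolding Pe vimage_A .
    show ?thesis
      unfolding J_subset[OF primeideal.axioms(1)[OF Pp]] unfolding Pe vimage_A
      using ideal_content_subset_prime_annihilator[OF assms(2) sub_ideal_I vs(2,1) hom prime]
        mpoly_var_mem_annihilator_ideal[OF sub_ideal_I vs(1) prime] by (rule conjI)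
  qed
  have below: "\<exists>P'\<in>associated_primes R ?H. P' \<subseteq> P" if P: "primeideal P R" "?J \<subseteq> P" for P
  proof -
    let ?Q = "{f. proj f \<in> P}"
    have Q: "prime_set ?Q" by (rule prime_set_vimage_proj[OF P(1)])
    have "mpoly_const ` ideal_content I \<subseteq> ?Q" "range mpoly_var \<subseteq> ?Q"
      using P(2) J_subset[OF primeideal.axioms(1)[OF P(1)]] by simp_all
    then have "?A 1 1 \<subseteq> ?Q"
      using annihilator_ideal_subset_prime[OF vs(2) prime_setD(1)[OF Q]] by blast
    then obtain r where r: "prime_set (?A 1 (r * 1))" "?A 1 (r * 1) \<subseteq> ?Q"
      using prime_annihilator_below[OF acc sub_ideal_I Q] by blast
    have "proj ` ?A 1 (r * 1) \<in> associated_primes R ?H"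
      unfolding ass using primeideal_proj_image[OF r(1) A(2)] by blast
    then show ?thesis using r(2) by blast
  qed
  have prime: "primeideal P R" if "P \<in> associated_primes R ?H" for P
    using that unfolding ass by blast
  \<comment> \<open>By \<open>J_le\<close> the associated primes are among the primes containing
    \<open>?J\<close>, and by \<open>below\<close> each of the latter contains one of the former;
    two such families have the same minimal elements.\<close>
  have eq: "minimal_associated_primes R ?H = minimal_primes R ?J"
  proof (intro equalityI subsetI)
    fix P assume "P \<in> minimal_associated_primes R ?H"
    then have P: "P \<in> associated_primes R ?H" "\<And>Q. Q \<in> associated_primes R ?H \<Longrightarrow> Q \<subseteq> P \<Longrightarrow> Q = P"
      by (simp_all add: minimal_associated_primes_def)
    have "Q = P" if Q: "primeideal Q R" "?J \<subseteq> Q" "Q \<subseteq> P" for Q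
    proof -
      obtain P' where P': "P' \<in> associated_primes R ?H" "P' \<subseteq> Q" using below[OF Q(1,2)] by blast
      then have "P' = P" using P(2) Q(3) by blast
      then show ?thesis using P'(2) Q(3) by blast
    qed
    then show "P \<in> minimal_primes R ?J"
      unfolding minimal_primes_def using prime[OF P(1)] J_le[OF P(1)] by blast
  next
    fix P assume "P \<in> minimal_primes R ?J"
    then have P: "primeideal P R" "?J \<subseteq> P"
      "\<And>Q. primeideal Q R \<Longrightarrow> ?J \<subseteq> Q \<Longrightarrow> Q \<subseteq> P \<Longrightarrow> Q = P"
      by (simp_all add: minimal_primes_def)
    have min: "Q = P" if "Q \<in> associated_primes R ?H" "Q \<subseteq> P" for Q
      using P(3)[OF prime[OF that(1)] J_le[OF that(1)] that(2)] .
    obtain P' where P': "P' \<in> associated_primes R ?H" "P' \<subseteq> P" using below[OF P(1,2)] by blast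
    then have "P \<in> associated_primes R ?H" using min by blast
    then show "P \<in> minimal_associated_primes R ?H"
      unfolding minimal_associated_primes_def using min by blast
  qed
  then show ?thesis using finite_minimal_primes[OF acc J] by simp
qed

end
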